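(* Let $\beta\in(\beta_c,\infty)$ and $h\in[0,h_c(\beta))$. Let $\mathbf m_n\in\mathcal M_n$ be such that the following hold: (i) the set $\mathcal M_n(\mathbf m_n)$ is non-empty; (ii) the Hessian of $F_n$ has only non-zero eigenvalues at $\mathbf m_n$ and at all points of the gate $\mathcal G(\mathbf m_n,\mathcal M_n(\mathbf m_n))$; (iii) there is a unique point $\mathbf t_n$ in $\mathcal G(\mathbf m_n,\mathcal M_n(\mathbf m_n))$; (iv) the numbers $r_\ell\,[\,|A_{\ell,n}|(1-\mathbf t_{\ell,n}^2)]^{-1}$, $\ell\in[k]$, are distinct. Then, in distribution, as $n\to\infty$, $$n[F_n(\mathbf t_n)-F_n(\mathbf m_n)]=n[F_{\beta,h}(\mathbf t)-F_{\beta,h}(\mathbf m)]+Z\sqrt n+O(1),$$ where $Z$ is a normal random variable with mean zero and variance in $(0,\infty)$, defined on $(\Omega,\mathcal F,\mathcal P)$ and independent of $J$.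
   Context: Model. $[n]=\{1,\dots,n\}$, $k\in\mathbb N$. $J=(J(i))_{i\in[n]}$ are i.i.d. random variables on a probability space $(\Omega,\mathcal F,\mathcal P)$ with values in a set $\{a_1,\dots,a_k\}\subset[0,\infty)$ of cardinality $k$, with $\mathcal P(J(i)=a_\ell)=\omega_\ell\in(0,1)$ and $\sum_{\ell\in[k]}\omega_\ell=1$. $\beta>0$ is the inverse temperature and $h\ge0$ the magnetic field. Level sets. $A_{\ell,n}=\{i\in[n]:J(i)=a_\ell\}$, $\omega_{\ell,n}=|A_{\ell,n}|/n$, and $\Gamma_n=\prod_{\ell\in[k]}\{-1,-1+\tfrac{2}{|A_{\ell,n}|},\dots,1\}$ (for $n$ large all $A_{\ell,n}$ are non-empty with probability tending to 1). Free energies. For $m\in\Gamma_n$, $$F_n(m)=-\tfrac12\Big(\sum_{\ell}a_\ell\omega_{\ell,n}m_\ell\Big)^2-h\sum_\ell\omega_{\ell,n}m_\ell-\frac{1}{\beta n}\log\prod_{\ell\in[k]}\binom{|A_{\ell,n}|}{\frac{1+m_\ell}{2}|A_{\ell,n}|}.$$ Its Hessian is the $k\times k$ matrix with entries $-a_\ell\omega_{\ell,n}a_{\ell'}\omega_{\ell',n}+O(n^{-1})$ for $\ell\ne\ell'$ and $\frac{\omega_{\ell,n}}{\beta(1-m_\ell^2)}-a_\ell^2\omega_{\ell,n}^2+O(n^{-1})$ on the diagonal. For $m\in[-1,1]^k$, $$F_{\beta,h}(m)=-\tfrac12\Big(\sum_\ell a_\ell\omega_\ell m_\ell\Big)^2-h\sum_\ell\omega_\ell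 m_\ell+\frac1\beta\sum_\ell\omega_\ell I_{\mathbf C}(m_\ell),\qquad I_{\mathbf C}(x)=\tfrac{1-x}{2}\log\tfrac{1-x}{2}+\tfrac{1+x}{2}\log\tfrac{1+x}{2},$$ which is the uniform limit in probability of $F_n$. Minima and gate. $\mathcal M_n$ is the set of local minima of $F_n$ on $\Gamma_n$, and $\mathcal M_n(\mathbf m_n)=\{m\in\mathcal M_n\setminus\{\mathbf m_n\}:F_n(m)\le F_n(\mathbf m_n)\}$. For disjoint $A,B\subset\mathcal M_n$, consider nearest-neighbour paths in $\Gamma_n$ from $A$ to $B$ (each step changes one coordinate $m_\ell$ by $\pm2/|A_{\ell,n}|$); the communication height is the minimum over such paths of the maximum of $F_n$ along the path, and a path is optimal if its maximum equals this height. The gate $\mathcal G(A,B)$ is a minimal subset of the points at which $F_n$ equals the communication height such that every optimal path from $A$ to $B$ intersects it. We write $\mathcal G(\mathbf m_n,B)$ for $\mathcal G(\{\mathbf m_n\},B)$. $\mathbf m$ and $\mathbf t$ denote the critical points of $F_{\beta,h}$ closest to $\mathbf m_n$ and $\mathbf t_n$, respectively, so that $\mathbf m_n\to\mathbf m$ and $\mathbf t_n\to\mathbf t$ as $n\to\infty$. Rates. With $\mathbf t_n=(\mathbf t_{\ell,n})_{\ell\in[k]}$ the gate point and $(\cdot)_+$ the positive part, $$r_\ell=|A_{\ell,n}|\,\frac{1-\mathbf t_{\ell,n}}{2}\exp\Big[-2\beta\Big(-h-a_\ell\Big(\frac{a_\ell}{n}+\sum_{\ell'\in[k]}a_{\ell'}\omega_{\ell',n}\mathbf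 t_{\ell',n}\Big)\Big)_+\Big].$$ Thresholds. $T_{\beta,h}(K)=\sum_{\ell\in[k]}a_\ell\omega_\ell\tanh(\beta[a_\ell K+h])$ for $K\in\mathbb R$. The pair $(\beta,h)$ is called metastable if the equation $K=T_{\beta,h}(K)$ has more than one solution at which $T_{\beta,h}$ is not tangent to the diagonal. $\beta_c=\big[\sum_\ell a_\ell^2\omega_\ell\big]^{-1}$, and for $\beta>\beta_c$, $h_c(\beta)$ is the minimal $h\ge0$ for which $(\beta,h)$ is not metastable.
   Formalization: In (ii) the eigenvalues (of the leading-order Hessian) are bounded away from zero uniformly in n with probability tending to 1; the limits m and t are assumed distinct; and Ω is assumed to carry a standard normal variable independent of J. *)

theory Defs
  imports "HOL-Probability.Probability"
begin

text \<open>
  The classes \<open>\<ell> \<in> [k]\<close> are the elements of a finite type \<open>'k\<close>. The quenched objects are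
  deterministic functions of a realisation \<open>j :: nat \<Rightarrow> real\<close> of the couplings, of which only
  \<open>j 1, \<dots>, j n\<close> matter at system size \<open>n\<close>.
\<close>

definition level_set :: "('k \<Rightarrow> real) \<Rightarrow> (nat \<Rightarrow> real) \<Rightarrow> nat \<Rightarrow> 'k \<Rightarrow> nat set" where
  "level_set a j n l = {i \<in> {1..n}. j i = a l}"

definition class_size :: "('k \<Rightarrow> real) \<Rightarrow> (nat \<Rightarrow> real) \<Rightarrow> nat \<Rightarrow> 'k \<Rightarrow> nat" where
  "class_size a j n l = card (level_set a j n l)"

definition freq :: "('k \<Rightarrow> real) \<Rightarrow> (nat \<Rightarrow> real) \<Rightarrow> nat \<Rightarrow> 'k \<Rightarrow> real" where
  "freq a j n l = real (class_size a j n l) / real n"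

text \<open>If some class is empty, its coordinate is \<open>-1\<close> (since \<open>0 / 0 = 0\<close>); the probability of
  this event vanishes as \<open>n \<rightarrow> \<infinity>\<close>.\<close>

definition grid :: "('k::finite \<Rightarrow> real) \<Rightarrow> (nat \<Rightarrow> real) \<Rightarrow> nat \<Rightarrow> (real^'k) set" where
  "grid a j n =
     {m. \<forall>l. \<exists>i \<le> class_size a j n l. m $ l = - 1 + 2 * real i / real (class_size a j n l)}"

text \<open>On the grid the argument of the floor is already an integer.\<close>

definition free_energy_n ::
  "('k::finite \<Rightarrow> real) \<Rightarrow> real \<Rightarrow> real \<Rightarrow> (nat \<Rightarrow> real) \<Rightarrow> nat \<Rightarrow> real^'k \<Rightarrow> real" where
  "free_energy_n a \<beta> h j n m =
     - (1 / 2) * (\<Sum>l\<in>UNIV. a l * freq a j n l * m $ l)\<^sup>2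
     - h * (\<Sum>l\<in>UNIV. freq a j n l * m $ l)
     - 1 / (\<beta> * real n) *
         ln (\<Prod>l\<in>UNIV. real (class_size a j n l choose
                  nat \<lfloor>(1 + m $ l) / 2 * real (class_size a j n l)\<rfloor>))"

text \<open>Leading order of the Hessian of \<^term>\<open>free_energy_n\<close>, which is a function on a grid and
  whose Hessian is only determined up to corrections of order \<open>1 / n\<close>.\<close>

definition hessian_n ::
  "('k::finite \<Rightarrow> real) \<Rightarrow> real \<Rightarrow> (nat \<Rightarrow> real) \<Rightarrow> nat \<Rightarrow> real^'k \<Rightarrow> real^'k^'k" where
  "hessian_n a \<beta> j n m = (\<chi> l l'.
     if l = l' then freq a j n l / (\<beta> * (1 - (m $ l)\<^sup>2)) - (a l)\<^sup>2 * (freq a j n l)\<^sup>2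
     else - (a l * freq a j n l * a l' * freq a j n l'))"

definition is_eigenvalue :: "real^'k^'k \<Rightarrow> real \<Rightarrow> bool" where
  "is_eigenvalue A c \<longleftrightarrow> (\<exists>v. v \<noteq> 0 \<and> A *v v = c *s v)"

definition cramer_entropy :: "real \<Rightarrow> real" where
  "cramer_entropy x = (1 - x) / 2 * ln ((1 - x) / 2) + (1 + x) / 2 * ln ((1 + x) / 2)"

definition free_energy ::
  "('k::finite \<Rightarrow> real) \<Rightarrow> ('k \<Rightarrow> real) \<Rightarrow> real \<Rightarrow> real \<Rightarrow> real^'k \<Rightarrow> real" where
  "free_energy a w \<beta> h m =
     - (1 / 2) * (\<Sum>l\<in>UNIV. a l * w l * m $ l)\<^sup>2
     - h * (\<Sum>l\<in>UNIV. w l * m $ l)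
     + 1 / \<beta> * (\<Sum>l\<in>UNIV. w l * cramer_entropy (m $ l))"

text \<open>The slope of the entropy is infinite at \<open>\<plusminus>1\<close>, so all critical points in the cube are interior.\<close>

definition critical_points ::
  "('k::finite \<Rightarrow> real) \<Rightarrow> ('k \<Rightarrow> real) \<Rightarrow> real \<Rightarrow> real \<Rightarrow> (real^'k) set" where
  "critical_points a w \<beta> h =
     {m. (\<forall>l. \<bar>m $ l\<bar> < 1) \<and> (free_energy a w \<beta> h has_derivative (\<lambda>_. 0)) (at m)}"

definition nn ::
  "('k::finite \<Rightarrow> real) \<Rightarrow> (nat \<Rightarrow> real) \<Rightarrow> nat \<Rightarrow> real^'k \<Rightarrow> real^'k \<Rightarrow> bool" where
  "nn a j n x y \<longleftrightarrow>
     (\<exists>l. (y $ l = x $ l + 2 / real (class_size a j n l) \<or>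
           y $ l = x $ l - 2 / real (class_size a j n l)) \<and>
          (\<forall>l'. l' \<noteq> l \<longrightarrow> y $ l' = x $ l'))"

definition local_minima ::
  "('k::finite \<Rightarrow> real) \<Rightarrow> real \<Rightarrow> real \<Rightarrow> (nat \<Rightarrow> real) \<Rightarrow> nat \<Rightarrow> (real^'k) set" where
  "local_minima a \<beta> h j n =
     {x \<in> grid a j n. \<forall>y \<in> grid a j n.
        nn a j n x y \<longrightarrow> free_energy_n a \<beta> h j n x \<le> free_energy_n a \<beta> h j n y}"

definition lower_minima ::
  "('k::finite \<Rightarrow> real) \<Rightarrow> real \<Rightarrow> real \<Rightarrow> (nat \<Rightarrow> real) \<Rightarrow> nat \<Rightarrow> real^'k \<Rightarrow> (real^'k) set" where
  "lower_minima a \<beta> h j n x =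
     {y \<in> local_minima a \<beta> h j n - {x}. free_energy_n a \<beta> h j n y \<le> free_energy_n a \<beta> h j n x}"

definition is_path ::
  "('k::finite \<Rightarrow> real) \<Rightarrow> (nat \<Rightarrow> real) \<Rightarrow> nat \<Rightarrow> (real^'k) set \<Rightarrow> (real^'k) set
     \<Rightarrow> (real^'k) list \<Rightarrow> bool" where
  "is_path a j n A B p \<longleftrightarrow>
     p \<noteq> [] \<and> set p \<subseteq> grid a j n \<and> successively (nn a j n) p \<and> hd p \<in> A \<and> last p \<in> B"

definition path_height ::
  "('k::finite \<Rightarrow> real) \<Rightarrow> real \<Rightarrow> real \<Rightarrow> (nat \<Rightarrow> real) \<Rightarrow> nat \<Rightarrow> (real^'k) list \<Rightarrow> real" where
  "path_height a \<beta> h j n p = Max (free_energy_n a \<beta> h j n ` set p)"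

text \<open>There are infinitely many paths, but finitely many heights, as the grid is finite.\<close>

definition comm_height ::
  "('k::finite \<Rightarrow> real) \<Rightarrow> real \<Rightarrow> real \<Rightarrow> (nat \<Rightarrow> real) \<Rightarrow> nat
     \<Rightarrow> (real^'k) set \<Rightarrow> (real^'k) set \<Rightarrow> real" where
  "comm_height a \<beta> h j n A B = Min {path_height a \<beta> h j n p |p. is_path a j n A B p}"

definition optimal_path ::
  "('k::finite \<Rightarrow> real) \<Rightarrow> real \<Rightarrow> real \<Rightarrow> (nat \<Rightarrow> real) \<Rightarrow> nat
     \<Rightarrow> (real^'k) set \<Rightarrow> (real^'k) set \<Rightarrow> (real^'k) list \<Rightarrow> bool" where
  "optimal_path a \<beta> h j n A B p \<longleftrightarrow>
     is_path a j n A B p \<and> path_height a \<beta> h j n p = comm_height a \<beta> h j n A B"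

definition crossed_by_optimal_paths ::
  "('k::finite \<Rightarrow> real) \<Rightarrow> real \<Rightarrow> real \<Rightarrow> (nat \<Rightarrow> real) \<Rightarrow> nat
     \<Rightarrow> (real^'k) set \<Rightarrow> (real^'k) set \<Rightarrow> (real^'k) set \<Rightarrow> bool" where
  "crossed_by_optimal_paths a \<beta> h j n A B G \<longleftrightarrow>
     (\<forall>p. optimal_path a \<beta> h j n A B p \<longrightarrow> set p \<inter> G \<noteq> {})"

text \<open>Minimal with respect to inclusion.\<close>

definition is_gate ::
  "('k::finite \<Rightarrow> real) \<Rightarrow> real \<Rightarrow> real \<Rightarrow> (nat \<Rightarrow> real) \<Rightarrow> nat
     \<Rightarrow> (real^'k) set \<Rightarrow> (real^'k) set \<Rightarrow> (real^'k) set \<Rightarrow> bool" where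
  "is_gate a \<beta> h j n A B G \<longleftrightarrow>
     G \<subseteq> {x \<in> grid a j n. free_energy_n a \<beta> h j n x = comm_height a \<beta> h j n A B} \<and>
     crossed_by_optimal_paths a \<beta> h j n A B G \<and>
     (\<forall>G'. G' \<subset> G \<longrightarrow> \<not> crossed_by_optimal_paths a \<beta> h j n A B G')"

definition rate ::
  "('k::finite \<Rightarrow> real) \<Rightarrow> real \<Rightarrow> real \<Rightarrow> (nat \<Rightarrow> real) \<Rightarrow> nat \<Rightarrow> real^'k \<Rightarrow> 'k \<Rightarrow> real" where
  "rate a \<beta> h j n t l =
     real (class_size a j n l) * ((1 - t $ l) / 2) *
     exp (- 2 * \<beta> *
       max 0 (- h - a l * (a l / real n + (\<Sum>l'\<in>UNIV. a l' * freq a j n l' * t $ l'))))"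

definition T_map :: "('k::finite \<Rightarrow> real) \<Rightarrow> ('k \<Rightarrow> real) \<Rightarrow> real \<Rightarrow> real \<Rightarrow> real \<Rightarrow> real" where
  "T_map a w \<beta> h K = (\<Sum>l\<in>UNIV. a l * w l * tanh (\<beta> * (a l * K + h)))"

definition metastable :: "('k::finite \<Rightarrow> real) \<Rightarrow> ('k \<Rightarrow> real) \<Rightarrow> real \<Rightarrow> real \<Rightarrow> bool" where
  "metastable a w \<beta> h \<longleftrightarrow>
     (\<exists>K1 K2. K1 \<noteq> K2 \<and>
        (\<forall>K \<in> {K1, K2}. K = T_map a w \<beta> h K \<and> deriv (T_map a w \<beta> h) K \<noteq> 1))"

definition beta_crit :: "('k::finite \<Rightarrow> real) \<Rightarrow> ('k \<Rightarrow> real) \<Rightarrow> real" where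
  "beta_crit a w = 1 / (\<Sum>l\<in>UNIV. (a l)\<^sup>2 * w l)"

definition h_crit :: "('k::finite \<Rightarrow> real) \<Rightarrow> ('k \<Rightarrow> real) \<Rightarrow> real \<Rightarrow> real" where
  "h_crit a w \<beta> = (LEAST h. 0 \<le> h \<and> \<not> metastable a w \<beta> h)"

text \<open>\<open>P n\<close> holds with probability tending to one. The events \<open>E n\<close> spare measurability
  requirements on \<open>P\<close>.\<close>

definition whp :: "'w measure \<Rightarrow> (nat \<Rightarrow> 'w \<Rightarrow> bool) \<Rightarrow> bool" where
  "whp M P \<longleftrightarrow>
     (\<exists>E. (\<forall>n. E n \<in> sets M) \<and> (\<lambda>n. measure M (E n)) \<longlonglongrightarrow> 1 \<and> (\<forall>n. \<forall>x \<in> E n. P n x))"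

definition converges_in_prob ::
  "'w measure \<Rightarrow> (nat \<Rightarrow> 'w \<Rightarrow> 'b::metric_space) \<Rightarrow> 'b \<Rightarrow> bool" where
  "converges_in_prob M X c \<longleftrightarrow> (\<forall>\<epsilon>>0. whp M (\<lambda>n x. dist (X n x) c < \<epsilon>))"

text \<open>Independence of a real random variable and the whole sequence \<open>J 1, J 2, \<dots>\<close>. The
  constant \<^term>\<open>prob_space.indep_var\<close> does not apply, as it needs equal value types.\<close>

definition indep_of_seq :: "'w measure \<Rightarrow> ('w \<Rightarrow> real) \<Rightarrow> (nat \<Rightarrow> 'w \<Rightarrow> real) \<Rightarrow> bool" where
  "indep_of_seq M Z J \<longleftrightarrow>
     prob_space.indep_set M
       (sets (vimage_algebra (space M) Z borel))
       (sets (vimage_algebra (space M) (\<lambda>x. \<lambda>i\<in>{1..}. J i x) (PiM {1..} (\<lambda>_. borel))))"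

end

theory Submission
  imports Defs
begin

text \<open>
  The discrete gradient of \<open>n F\<^sub>n\<close> is of order \<open>1/n\<close> not only at the local minimum \<open>m\<^sub>n\<close> but also
  at the gate point \<open>t\<^sub>n\<close>, because a steep direction at \<open>t\<^sub>n\<close> would allow optimal paths to bypass it.
  Hence both points solve \<open>m\<^sub>l = tanh (\<beta> (a\<^sub>l K + h))\<close> up to \<open>O(1/n)\<close> with the empirical
  frequencies, and non-degeneracy of the Hessian places them at distance \<open>O(\<bar>\<omega>\<^sub>n - \<omega>\<bar> + 1/n)\<close> from
  \<open>m\<close> and \<open>t\<close>. With Stirling's formula and a second order Taylor expansion,
  \<open>n [F\<^sub>n(t\<^sub>n) - F\<^sub>n(m\<^sub>n)]\<close> is \<open>n [F(t) - F(m)]\<close> plus a linear statistic of \<open>n (\<omega>\<^sub>n - \<omega>)\<close>, up to a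
  tight error. The linear statistic is a sum of bounded i.i.d. variables; the Berry-Esseen bound
  (by Stein's method) and the quantile coupling match it with \<open>Z \<surd>n\<close> up to a tight error. Its variance
  is positive because \<open>\<partial>F/\<partial>\<omega>\<^sub>l = - ln (2 cosh (\<beta> (a\<^sub>l K + h))) / \<beta>\<close> at a critical point, and the
  difference of these numbers at \<open>t\<close> and \<open>m\<close> depends on \<open>l\<close>.
\<close>

section \<open>Stein's equation and the Berry-Esseen bound\<close>

text \<open>A central limit theorem would not do: the remainder has to be bounded while the
  fluctuations are of order \<surd>n, and it is the rate 1 / \<surd>n in the Berry-Esseen bound that
  keeps the quantile error bounded after rescaling. The remainder of the expansion depends on the
  same couplings as the linear statistic, so the law of their sum is preserved only if the pair is
  transported jointly. As Z must be independent of J, the claim is an equality of laws, and the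
  final remainder is a function of the Gaussian variable instead of J. Stirling's formula leaves
  logarithms of the class sizes, which are unbounded but equal at both points and cancel. Positivity
  of the variance has one genuine exception: without field, two fixed points of opposite sign and
  equal modulus give a difference that vanishes in every class. It is ruled out by the geometry of
  optimal paths, since every path between opposite magnetisations passes near magnetisation zero,
  where the energy exceeds that of any magnetised critical point.\<close>

lemma has_derivative_std_normal_density:
  "(std_normal_density has_real_derivative - x * std_normal_density x) (at x)"
  unfolding std_normal_density_def[abs_def]
  by (auto intro!: derivative_eq_intros simp: field_simps)

lemma continuous_std_normal_density: "continuous_on A std_normal_density"
  using has_derivative_std_normal_density DERIV_isCont
  by (blast intro: continuous_at_imp_continuous_on)

lemma std_normal_density_le: "std_normal_density x \<le> 1 / 2"
proof -
  have "2 \<le> sqrt (2 * pi)"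
    using pi_gt3 by (intro real_le_rsqrt) auto
  then have "1 / sqrt (2 * pi) \<le> 1 / 2"
    by (intro divide_left_mono) auto
  moreover have "exp (- x\<^sup>2 / 2) \<le> 1" by simp
  ultimately show ?thesis
    unfolding std_normal_density_def
    using mult_mono[of "1 / sqrt (2 * pi)" "1/2" "exp (- x\<^sup>2 / 2)" 1] by simp
qed

text \<open>Mills ratio bound: \<open>x / w\<close> is at least 1 on the tail, and \<open>x\<close>
  times the density has minus the density as a primitive.\<close>

lemma std_normal_tail_le:
  fixes w :: real
  assumes "0 < w"
  shows "(\<integral>x. indicator {w..} x * std_normal_density x \<partial>lborel) \<le> std_normal_density w / w"
proof -
  have lim: "((\<lambda>x. - std_normal_density x / w) \<longlongrightarrow> 0) at_top"
    unfolding std_normal_density_def using assms by real_asymp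
  have "(\<integral>\<^sup>+x. ennreal (x / w * std_normal_density x) * indicator {w..} x \<partial>lborel)
     = 0 - (- std_normal_density w / w)"
    using assms
    by (intro nn_integral_FTC_atLeast lim)
      (auto intro!: derivative_eq_intros DERIV_cong[OF has_derivative_std_normal_density] simp: field_simps
        intro: mult_nonneg_nonneg)
  then have *: "(\<integral>\<^sup>+x. ennreal (x / w * std_normal_density x) * indicator {w..} x \<partial>lborel)
     = ennreal (std_normal_density w / w)" by simp
  have "(\<integral>\<^sup>+x. ennreal (indicator {w..} x * std_normal_density x) \<partial>lborel)
      \<le> (\<integral>\<^sup>+x. ennreal (x / w * std_normal_density x) * indicator {w..} x \<partial>lborel)"
    using assms by (intro nn_integral_mono)
      (auto simp: indicator_def field_simps intro!: ennreal_leI mult_right_mono)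
  also note *
  finally have "(\<integral>\<^sup>+x. ennreal (indicator {w..} x * std_normal_density x) \<partial>lborel)
      \<le> ennreal (std_normal_density w / w)" .
  then show ?thesis
    by (subst integral_eq_nn_integral) (use assms in \<open>auto intro!: enn2real_leI\<close>)
qed

lemma std_normal_left_tail_le:
  fixes w :: real
  assumes "w < 0"
  shows "(\<integral>x. indicator {..w} x * std_normal_density x \<partial>lborel) \<le> std_normal_density w / (- w)"
proof -
  have "(\<integral>x. indicator {..w} x * std_normal_density x \<partial>lborel)
      = (\<integral>x. indicator {-w..} x * std_normal_density x \<partial>lborel)"
    by (subst lborel_integral_real_affine[where c="-1" and t=0])
      (auto intro!: Bochner_Integration.integral_cong simp: indicator_def std_normal_density_def)
  also have "\<dots> \<le> std_normal_density (-w) / (-w)"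
    using assms by (intro std_normal_tail_le) auto
  finally show ?thesis by (simp add: std_normal_density_def)
qed

lemma integrable_std_normal_mult:
  fixes q :: "real \<Rightarrow> real"
  assumes [measurable]: "q \<in> borel_measurable borel" and "\<And>x. \<bar>q x\<bar> \<le> 1"
  shows "integrable lborel (\<lambda>x. std_normal_density x * q x)"
proof (rule Bochner_Integration.integrable_bound)
  show "integrable lborel std_normal_density" by simp
  show "AE x in lborel. norm (std_normal_density x * q x) \<le> norm (std_normal_density x)"
    using assms(2) by (auto simp: abs_mult mult_left_le)
qed simp

text \<open>Stein's equation \<open>g' x - x * g x = h x - \<nu>\<close> is solved by the primitive
  of \<open>std_normal_density x * (h x - \<nu>)\<close> divided by the density. The crude bounds 6
  and 1 are enough for a Berry-Esseen bound with an explicit constant.\<close>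

lemma stein_solution:
  fixes h :: "real \<Rightarrow> real"
  assumes cont: "continuous_on UNIV h" and h: "\<And>x. 0 \<le> h x" "\<And>x. h x \<le> 1"
  defines "\<nu> \<equiv> (\<integral>x. std_normal_density x * h x \<partial>lborel)"
  obtains g where "\<And>x. (g has_real_derivative (x * g x + h x - \<nu>)) (at x)"
    "\<And>x. \<bar>g x\<bar> \<le> 6" "\<And>x. \<bar>x * g x\<bar> \<le> 1" "0 \<le> \<nu>" "\<nu> \<le> 1"
proof -
  let ?\<phi> = std_normal_density
  have [measurable]: "h \<in> borel_measurable borel"
    using cont by (rule borel_measurable_continuous_onI)
  have int: "integrable lborel (\<lambda>x. ?\<phi> x * h x)"
    using h by (intro integrable_std_normal_mult) (auto simp: abs_le_iff intro: order_trans[of _ 0])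
  have int1: "integrable lborel ?\<phi>" and i1: "(\<integral>x. ?\<phi> x \<partial>lborel) = 1" by auto
  have \<nu>: "0 \<le> \<nu>" "\<nu> \<le> 1"
  proof -
    show "0 \<le> \<nu>" unfolding \<nu>_def using h by (intro integral_nonneg_AE) auto
    have "\<nu> \<le> (\<integral>x. ?\<phi> x \<partial>lborel)"
      unfolding \<nu>_def using int int1 h by (intro integral_mono) (auto simp: mult_left_le)
    then show "\<nu> \<le> 1" using i1 by simp
  qed
  define q where "q x = h x - \<nu>" for x
  have q: "\<bar>q x\<bar> \<le> 1" for x using \<nu> h[of x] unfolding q_def by (auto simp: abs_le_iff)
  have [measurable]: "q \<in> borel_measurable borel" unfolding q_def[abs_def] by simp
  have contq: "continuous_on A q" for A
    unfolding q_def[abs_def] using cont by (auto intro!: continuous_intros intro: continuous_on_subset)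
  define \<psi> where "\<psi> x = ?\<phi> x * q x" for x
  have [measurable]: "\<psi> \<in> borel_measurable borel" unfolding \<psi>_def[abs_def] by simp
  have int\<psi>: "integrable lborel \<psi>" unfolding \<psi>_def[abs_def]
    by (rule integrable_std_normal_mult) (use q in auto)
  have int\<psi>A: "integrable lborel (\<lambda>x. indicator A x * \<psi> x)" if "A \<in> sets borel" for A
    using integrable_mult_indicator[OF _ int\<psi>, of A] that by (simp add: mult.commute)
  have int\<phi>A: "integrable lborel (\<lambda>x. indicator A x * ?\<phi> x)" if "A \<in> sets borel" for A
    using integrable_mult_indicator[OF _ int1, of A] that by (simp add: mult.commute)
  \<comment> \<open>The centred integrand has total mass zero, so left and right tails agree up to
    sign; this gives the bound at positive arguments.\<close>
  have tot: "(\<integral>x. \<psi> x \<partial>lborel) = 0"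
  proof -
    have "(\<integral>x. \<psi> x \<partial>lborel) = (\<integral>x. ?\<phi> x * h x - \<nu> * ?\<phi> x \<partial>lborel)"
      by (auto simp: \<psi>_def q_def algebra_simps intro!: Bochner_Integration.integral_cong)
    also have "\<dots> = \<nu> - \<nu> * 1"
      by (subst Bochner_Integration.integral_diff) (use int in \<open>auto simp: \<nu>_def\<close>)
    finally show ?thesis by simp
  qed
  define G where "G w = (\<integral>x. indicator {..w} x * \<psi> x \<partial>lborel)" for w
  have bnd: "\<bar>\<integral>x. indicator A x * \<psi> x \<partial>lborel\<bar> \<le> (\<integral>x. indicator A x * ?\<phi> x \<partial>lborel)"
    if "A \<in> sets borel" for A
  proof -
    have "\<bar>\<integral>x. indicator A x * \<psi> x \<partial>lborel\<bar> \<le> (\<integral>x. \<bar>indicator A x * \<psi> x\<bar> \<partial>lborel)"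
      by (rule integral_abs_bound)
    also have "\<dots> \<le> (\<integral>x. indicator A x * ?\<phi> x \<partial>lborel)"
      using that by (intro integral_mono integrable_abs int\<psi>A int\<phi>A)
        (auto simp: \<psi>_def abs_mult indicator_def q mult_left_le)
    finally show ?thesis .
  qed
  have Gneg: "\<bar>G w\<bar> \<le> ?\<phi> w / (- w)" if "w < 0" for w
    unfolding G_def using bnd[of "{..w}"] std_normal_left_tail_le[OF that] by simp
  have Gpos: "\<bar>G w\<bar> \<le> ?\<phi> w / w" if "w > 0" for w
  proof -
    have "G w + (\<integral>x. indicator {w<..} x * \<psi> x \<partial>lborel) = (\<integral>x. \<psi> x \<partial>lborel)"
      unfolding G_def
      by (subst Bochner_Integration.integral_add[OF int\<psi>A int\<psi>A, symmetric])
        (auto intro!: Bochner_Integration.integral_cong simp: indicator_def)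
    then have "\<bar>G w\<bar> = \<bar>\<integral>x. indicator {w<..} x * \<psi> x \<partial>lborel\<bar>" using tot by simp
    also have "\<dots> \<le> (\<integral>x. indicator {w<..} x * ?\<phi> x \<partial>lborel)" by (rule bnd) simp
    also have "\<dots> \<le> (\<integral>x. indicator {w..} x * ?\<phi> x \<partial>lborel)"
      by (intro integral_mono int\<phi>A) (auto simp: indicator_def)
    also have "\<dots> \<le> ?\<phi> w / w" by (rule std_normal_tail_le[OF that])
    finally show ?thesis .
  qed
  have G1: "\<bar>G w\<bar> \<le> 1" for w
  proof -
    have "\<bar>G w\<bar> \<le> (\<integral>x. indicator {..w} x * ?\<phi> x \<partial>lborel)" unfolding G_def by (rule bnd) simp
    also have "\<dots> \<le> (\<integral>x. ?\<phi> x \<partial>lborel)"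
      by (intro integral_mono int\<phi>A int1) (auto simp: indicator_def)
    finally show ?thesis using i1 by simp
  qed
  have cont\<psi>: "continuous_on A \<psi>" for A
    unfolding \<psi>_def[abs_def] by (intro continuous_intros contq continuous_std_normal_density)
  \<comment> \<open>On a window around \<open>w\<close> the primitive from minus infinity differs by
    a constant from an integral over a compact interval, to which the fundamental theorem of
    calculus applies.\<close>
  have dG: "(G has_real_derivative \<psi> w) (at w)" for w
  proof -
    let ?a = "w - 1" and ?b = "w + 1"
    have eq: "G u = G ?a + integral {?a..u} \<psi>" if "u \<in> {?a<..<?b}" for u
    proof -
      have "set_integrable lborel {?a..u} \<psi>"
        unfolding set_integrable_def using int\<psi>A[of "{?a..u}"] by simp
      from set_borel_integral_eq_integral(2)[OF this]
      have "integral {?a..u} \<psi> = (\<integral>x. indicator {?a..u} x * \<psi> x \<partial>lborel)"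
        unfolding set_lebesgue_integral_def by simp
      also have "\<dots> = (\<integral>x. indicator {?a<..u} x * \<psi> x \<partial>lborel)"
        by (intro integral_cong_AE eventually_mono[OF AE_lborel_singleton[of ?a]])
          (auto simp: indicator_def)
      finally show ?thesis unfolding G_def
        using that by (simp, subst Bochner_Integration.integral_add[OF int\<psi>A int\<psi>A, symmetric])
          (auto intro!: Bochner_Integration.integral_cong simp: indicator_def)
    qed
    have "((\<lambda>u. G ?a + integral {?a..u} \<psi>) has_real_derivative 0 + \<psi> w) (at w within {?a..?b})"
      by (intro derivative_intros integral_has_real_derivative cont\<psi>) auto
    then have "((\<lambda>u. G ?a + integral {?a..u} \<psi>) has_real_derivative \<psi> w) (at w)"
      by (simp add: at_within_Icc_at)
    then show ?thesis
      by (rule has_field_derivative_transform_within_open[where S="{?a<..<?b}"]) (auto simp: eq)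
  qed
  define g where "g w = G w / ?\<phi> w" for w
  have pos: "?\<phi> w > 0" for w by (simp add: normal_density_pos)
  have "(g has_real_derivative (x * g x + h x - \<nu>)) (at x)" for x
    unfolding g_def[abs_def] using pos[of x]
    by (auto intro!: derivative_eq_intros dG has_derivative_std_normal_density
        simp: \<psi>_def q_def field_simps power2_eq_square)
  moreover have wg: "\<bar>x * g x\<bar> \<le> 1" for x
  proof (cases x "0::real" rule: linorder_cases)
    case less
    then show ?thesis using Gneg[OF less] pos[of x]
      by (auto simp: g_def abs_mult field_simps)
  next
    case greater
    then show ?thesis using Gpos[OF greater] pos[of x]
      by (auto simp: g_def abs_mult field_simps)
  qed simp
  \<comment> \<open>Near the origin the density is at least 1/6 and the numerator at most 1;
    elsewhere the bound on \<open>x * g x\<close> is stronger.\<close>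
  moreover have "\<bar>g x\<bar> \<le> 6" for x
  proof (cases "\<bar>x\<bar> \<le> 1")
    case True
    have "exp (- (1/2)) \<le> exp (- x\<^sup>2 / 2)" using True by (simp add: abs_square_le_1)
    moreover have "exp (-(1/2)::real) \<ge> 1 / 2"
      using exp_ge_add_one_self[of "-(1/2)::real"] by simp
    ultimately have e: "exp (- x\<^sup>2 / 2) \<ge> 1 / 2" by linarith
    have s: "sqrt (2 * pi) \<le> 3"
      using pi_less_4 by (intro real_le_lsqrt) (auto simp: power2_eq_square)
    have "1 / 6 \<le> ?\<phi> x"
    proof -
      have "1 / 6 = 1 / 3 * (1/2 :: real)" by simp
      also have "\<dots> \<le> 1 / sqrt (2 * pi) * exp (- x\<^sup>2 / 2)"
        using e s by (intro mult_mono divide_left_mono) auto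
      finally show ?thesis by (simp add: std_normal_density_def)
    qed
    then have "\<bar>g x\<bar> \<le> 1 / (1/6)"
      unfolding g_def abs_divide using G1[of x] pos[of x] by (simp add: field_simps)
    then show ?thesis by simp
  next
    case False
    then have "1 * \<bar>g x\<bar> \<le> \<bar>x\<bar> * \<bar>g x\<bar>" by (intro mult_right_mono) auto
    then show ?thesis using wg[of x] by (simp add: abs_mult)
  qed
  ultimately show thesis using that \<nu> by blast
qed

section \<open>Lipschitz test functions and the Stein exchange\<close>

definition ramp :: "real \<Rightarrow> real \<Rightarrow> real \<Rightarrow> real" where
  "ramp z \<alpha> x = max 0 (min 1 ((z + \<alpha> - x) / \<alpha>))"

lemma ramp_bounds: "0 \<le> ramp z \<alpha> x" "ramp z \<alpha> x \<le> 1"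
  by (auto simp: ramp_def)

lemma continuous_ramp: "continuous_on A (ramp z \<alpha>)"
  unfolding ramp_def[abs_def] divide_inverse by (intro continuous_intros)

lemma borel_measurable_ramp[measurable]: "ramp z \<alpha> \<in> borel_measurable borel"
  by (rule borel_measurable_continuous_onI[OF continuous_ramp])

lemma ramp_eq_1: "0 < \<alpha> \<Longrightarrow> x \<le> z \<Longrightarrow> ramp z \<alpha> x = 1"
  by (auto simp: ramp_def)

lemma ramp_eq_0: "0 < \<alpha> \<Longrightarrow> z + \<alpha> \<le> x \<Longrightarrow> ramp z \<alpha> x = 0"
  by (auto simp: ramp_def divide_nonpos_pos)

lemma ramp_lipschitz:
  assumes "0 < \<alpha>"
  shows "\<bar>ramp z \<alpha> x - ramp z \<alpha> y\<bar> \<le> \<bar>x - y\<bar> / \<alpha>"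
proof -
  have "\<bar>ramp z \<alpha> x - ramp z \<alpha> y\<bar> \<le> \<bar>(z + \<alpha> - x) / \<alpha> - (z + \<alpha> - y) / \<alpha>\<bar>"
    unfolding ramp_def by (auto simp: max_def min_def)
  also have "\<dots> = \<bar>x - y\<bar> / \<alpha>"
    using assms by (simp add: diff_divide_distrib[symmetric] abs_minus_commute)
  finally show ?thesis .
qed

text \<open>The increment is localised at the slope of the ramp. The bound
  \<open>\<delta> / \<alpha>\<close> alone is of order one once \<alpha> is proportional to
  \<delta>; the indicator turns it into the probability of a short interval.\<close>

lemma ramp_increment:
  assumes "0 < \<alpha>" "\<bar>t\<bar> \<le> \<delta>"
  shows "\<bar>ramp z \<alpha> (w + t) - ramp z \<alpha> w\<bar> \<le> \<delta> * (indicator {z - \<delta>..z + \<alpha> + \<delta>} w / \<alpha>)"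
proof (cases "w \<in> {z - \<delta>..z + \<alpha> + \<delta>}")
  case True
  have "\<bar>ramp z \<alpha> (w + t) - ramp z \<alpha> w\<bar> \<le> \<bar>t\<bar> / \<alpha>"
    using ramp_lipschitz[OF assms(1), of z "w + t" w] by simp
  also have "\<dots> \<le> \<delta> / \<alpha>" using assms by (intro divide_right_mono) auto
  finally show ?thesis using True by simp
next
  case False
  then consider "w + t \<le> z" "w \<le> z" | "z + \<alpha> \<le> w + t" "z + \<alpha> \<le> w" using assms by fastforce
  then show ?thesis
    by cases (use assms False in \<open>auto simp: ramp_eq_0 ramp_eq_1\<close>)
qed

text \<open>Ramps have kinks, so second derivatives of the Stein solution are avoided: increments of
  \<open>g'\<close> are read off from Stein's equation itself. The three summands of
  \<open>B\<close> stem from \<open>t * g (w + t)\<close>, from \<open>w\<close> times the increment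
  of \<open>g\<close>, and from the ramp.\<close>

lemma stein_ramp:
  fixes z \<alpha> \<delta> \<nu> :: real and B :: "real \<Rightarrow> real"
  assumes "0 < \<alpha>" "0 < \<delta>"
    and \<nu>_def: "\<nu> = (\<integral>x. std_normal_density x * ramp z \<alpha> x \<partial>lborel)"
    and B_def: "B = (\<lambda>w. \<delta> * (6 + 2 * \<bar>w\<bar> + indicator {z - \<delta>..z + \<alpha> + \<delta>} w / \<alpha>))"
  obtains g g' :: "real \<Rightarrow> real" where "g \<in> borel_measurable borel" "g' \<in> borel_measurable borel"
    "\<And>x. g' x = x * g x + ramp z \<alpha> x - \<nu>" "\<And>x. \<bar>g x\<bar> \<le> 6" "\<And>x. \<bar>g' x\<bar> \<le> 2"
    "\<And>w t. \<bar>t\<bar> \<le> \<delta> \<Longrightarrow> \<bar>g' (w + t) - g' w\<bar> \<le> B w"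
    "\<And>w t. \<bar>t\<bar> \<le> \<delta> \<Longrightarrow> \<bar>g (w + t) - g w - t * g' w\<bar> \<le> \<bar>t\<bar> * B w"
proof -
  obtain g where g: "\<And>x. (g has_real_derivative (x * g x + ramp z \<alpha> x - \<nu>)) (at x)"
    "\<And>x. \<bar>g x\<bar> \<le> 6" "\<And>x. \<bar>x * g x\<bar> \<le> 1" and \<nu>: "0 \<le> \<nu>" "\<nu> \<le> 1"
    using stein_solution[OF continuous_ramp ramp_bounds] unfolding \<nu>_def by metis
  define g' where "g' x = x * g x + ramp z \<alpha> x - \<nu>" for x
  have dg: "(g has_real_derivative g' x) (at x)" for x using g(1) unfolding g'_def .
  have cg: "continuous_on UNIV g"
    using dg DERIV_isCont by (blast intro: continuous_at_imp_continuous_on)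
  then have [measurable]: "g \<in> borel_measurable borel" by (rule borel_measurable_continuous_onI)
  have mg': "g' \<in> borel_measurable borel" unfolding g'_def[abs_def] by measurable
  have g'2: "\<bar>g' x\<bar> \<le> 2" for x
    using g(3)[of x] ramp_bounds[of z \<alpha> x] \<nu> unfolding g'_def by linarith
  have mvt: "\<exists>s. \<bar>s\<bar> \<le> \<bar>t\<bar> \<and> g (w + t) - g w = t * g' (w + s)" for w t
  proof (cases t "0::real" rule: linorder_cases)
    case less
    then obtain x where "w + t < x" "x < w" "g w - g (w + t) = (w - (w + t)) * g' x"
      using MVT2[of "w + t" w g g'] dg by auto
    then show ?thesis using less by (intro exI[of _ "x - w"]) (auto simp: algebra_simps)
  next
    case greater
    then obtain x where "w < x" "x < w + t" "g (w + t) - g w = (w + t - w) * g' x"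
      using MVT2[of w "w + t" g g'] dg by auto
    then show ?thesis using greater by (intro exI[of _ "x - w"]) (auto simp: algebra_simps)
  qed auto
  have inc: "\<bar>g' (w + t) - g' w\<bar> \<le> B w" if t: "\<bar>t\<bar> \<le> \<delta>" for w t
  proof -
    have "\<bar>g (w + t) - g w\<bar> \<le> \<delta> * 2"
    proof -
      obtain s where "g (w + t) - g w = t * g' (w + s)" using mvt by blast
      then show ?thesis using t g'2[of "w + s"] assms by (auto simp: abs_mult intro!: mult_mono)
    qed
    then have 1: "\<bar>w * (g (w + t) - g w)\<bar> \<le> \<bar>w\<bar> * (\<delta> * 2)"
      by (auto simp: abs_mult intro!: mult_left_mono)
    have 2: "\<bar>t * g (w + t)\<bar> \<le> \<delta> * 6"
      using t g(2)[of "w + t"] assms by (auto simp: abs_mult intro!: mult_mono)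
    have "g' (w + t) - g' w = t * g (w + t) + w * (g (w + t) - g w) + (ramp z \<alpha> (w + t) - ramp z \<alpha> w)"
      unfolding g'_def by (simp add: algebra_simps)
    then have "\<bar>g' (w + t) - g' w\<bar> \<le> \<delta> * 6 + \<bar>w\<bar> * (\<delta> * 2)
        + \<delta> * (indicator {z - \<delta>..z + \<alpha> + \<delta>} w / \<alpha>)"
      using 1 2 ramp_increment[OF assms(1) t, of z w] by linarith
    also have "\<dots> = B w" unfolding B_def by (simp add: algebra_simps)
    finally show ?thesis .
  qed
  have rem: "\<bar>g (w + t) - g w - t * g' w\<bar> \<le> \<bar>t\<bar> * B w" if t: "\<bar>t\<bar> \<le> \<delta>" for w t
  proof -
    obtain s where s: "\<bar>s\<bar> \<le> \<bar>t\<bar>" "g (w + t) - g w = t * g' (w + s)" using mvt by blast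
    then have "g (w + t) - g w - t * g' w = t * (g' (w + s) - g' w)" by (simp add: algebra_simps)
    then show ?thesis using inc[of s w] s t by (auto simp: abs_mult intro!: mult_left_mono)
  qed
  show thesis
    by (rule that[of g g']) (use mg' g'2 g inc rem in \<open>auto simp: g'_def\<close>)
qed

lemma (in prob_space) integrable_bounded:
  assumes [measurable]: "f \<in> borel_measurable M" and "\<And>x. x \<in> space M \<Longrightarrow> \<bar>f x :: real\<bar> \<le> C"
  shows "integrable M f"
  by (rule integrable_const_bound[of _ C]) (use assms(2) in auto)

text \<open>Here \<open>Y\<close> is the sum without its summand \<open>X\<close>. When
  \<open>g\<close> is expanded at \<open>Y\<close>, the linear term vanishes by independence and
  centring, and the quadratic one produces \<open>g' (Y x)\<close>; replacing this by
  \<open>g' (Y x + X x)\<close> costs the same error again, whence the factor 2.\<close>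

lemma (in prob_space) stein_exchange:
  fixes X Y :: "'a \<Rightarrow> real"
  assumes ind: "indep_var borel X borel Y"
    and X: "\<And>x. x \<in> space M \<Longrightarrow> \<bar>X x\<bar> \<le> \<delta>" "expectation X = 0"
    and [measurable]: "g \<in> borel_measurable borel" "g' \<in> borel_measurable borel" "B \<in> borel_measurable borel"
    and b: "\<And>x. \<bar>g x :: real\<bar> \<le> C" "\<And>x. \<bar>g' x :: real\<bar> \<le> C" "integrable M (\<lambda>x. B (Y x))"
    and inc: "\<And>w t. \<bar>t\<bar> \<le> \<delta> \<Longrightarrow> \<bar>g' (w + t) - g' w\<bar> \<le> B w"
    and rem: "\<And>w t. \<bar>t\<bar> \<le> \<delta> \<Longrightarrow> \<bar>g (w + t) - g w - t * g' w\<bar> \<le> \<bar>t\<bar> * B w"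
  shows "\<bar>expectation (\<lambda>x. X x * g (Y x + X x)) - expectation (\<lambda>x. (X x)\<^sup>2) * expectation (\<lambda>x. g' (Y x + X x))\<bar>
    \<le> 2 * expectation (\<lambda>x. (X x)\<^sup>2) * expectation (\<lambda>x. B (Y x))"
proof -
  have [measurable]: "X \<in> borel_measurable M" "Y \<in> borel_measurable M"
    using indep_var_rv1[OF ind] indep_var_rv2[OF ind] by auto
  have C: "0 \<le> C" using b(1)[of 0] by linarith
  have iX: "integrable M X" by (rule integrable_bounded[OF _ X(1)]) auto
  have iX2: "integrable M (\<lambda>x. (X x)\<^sup>2)"
    by (rule integrable_bounded[of _ "\<delta>\<^sup>2"]) (auto, metis X(1) abs_ge_zero power2_abs power_mono)
  have ig: "integrable M (\<lambda>x. g (Y x))" "integrable M (\<lambda>x. g' (Y x))" "integrable M (\<lambda>x. g' (Y x + X x))"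
    "integrable M (\<lambda>x. g (Y x + X x))"
    by (auto intro!: integrable_bounded[of _ C] simp: b)
  have ind1: "indep_var borel X borel (\<lambda>x. g (Y x))"
    using indep_var_compose[OF ind, of "\<lambda>x. x" borel g borel] by (simp add: comp_def)
  have ind2: "indep_var borel (\<lambda>x. (X x)\<^sup>2) borel (\<lambda>x. g' (Y x))"
    using indep_var_compose[OF ind, of "\<lambda>x. x\<^sup>2" borel g' borel] by (simp add: comp_def)
  have ind3: "indep_var borel (\<lambda>x. (X x)\<^sup>2) borel (\<lambda>x. B (Y x))"
    using indep_var_compose[OF ind, of "\<lambda>x. x\<^sup>2" borel B borel] by (simp add: comp_def)
  note e1 = indep_var_lebesgue_integral[OF ind1 iX ig(1)] indep_var_integrable[OF ind1 iX ig(1)]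
  note e2 = indep_var_lebesgue_integral[OF ind2 iX2 ig(2)] indep_var_integrable[OF ind2 iX2 ig(2)]
  note e3 = indep_var_lebesgue_integral[OF ind3 iX2 b(3)] indep_var_integrable[OF ind3 iX2 b(3)]
  have i4: "integrable M (\<lambda>x. X x * g (Y x + X x))"
    by (rule integrable_bounded[of _ "\<delta> * C"]) (use X(1) b(1) C in \<open>auto simp: abs_mult intro!: mult_mono intro: order_trans[OF abs_ge_zero]\<close>)
  have "expectation (\<lambda>x. X x * g (Y x + X x)) - expectation (\<lambda>x. (X x)\<^sup>2) * expectation (\<lambda>x. g' (Y x))
     = expectation (\<lambda>x. X x * g (Y x + X x) - X x * g (Y x) - (X x)\<^sup>2 * g' (Y x))"
    using e1 e2 i4 X(2) by simp
  also have "\<bar>\<dots>\<bar> \<le> expectation (\<lambda>x. \<bar>X x * g (Y x + X x) - X x * g (Y x) - (X x)\<^sup>2 * g' (Y x)\<bar>)"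
    by (rule integral_abs_bound)
  also have "\<dots> \<le> expectation (\<lambda>x. (X x)\<^sup>2 * B (Y x))"
  proof (intro integral_mono integrable_abs Bochner_Integration.integrable_diff i4 e1 e2 e3)
    fix x assume x: "x \<in> space M"
    have "X x * g (Y x + X x) - X x * g (Y x) - (X x)\<^sup>2 * g' (Y x)
      = X x * (g (Y x + X x) - g (Y x) - X x * g' (Y x))" by (simp add: algebra_simps power2_eq_square)
    also have "\<bar>\<dots>\<bar> \<le> \<bar>X x\<bar> * (\<bar>X x\<bar> * B (Y x))"
      unfolding abs_mult using rem[OF X(1)[OF x]] by (intro mult_left_mono) auto
    also have "\<dots> = (X x)\<^sup>2 * B (Y x)" by (simp add: power2_eq_square abs_mult_self_eq mult.assoc[symmetric])
    finally show "\<bar>X x * g (Y x + X x) - X x * g (Y x) - (X x)\<^sup>2 * g' (Y x)\<bar> \<le> (X x)\<^sup>2 * B (Y x)" .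
  qed
  finally have A: "\<bar>expectation (\<lambda>x. X x * g (Y x + X x)) - expectation (\<lambda>x. (X x)\<^sup>2) * expectation (\<lambda>x. g' (Y x))\<bar>
     \<le> expectation (\<lambda>x. (X x)\<^sup>2) * expectation (\<lambda>x. B (Y x))" using e3 by simp
  have "\<bar>expectation (\<lambda>x. g' (Y x + X x)) - expectation (\<lambda>x. g' (Y x))\<bar>
      = \<bar>expectation (\<lambda>x. g' (Y x + X x) - g' (Y x))\<bar>" using ig by simp
  also have "\<dots> \<le> expectation (\<lambda>x. \<bar>g' (Y x + X x) - g' (Y x)\<bar>)" by (rule integral_abs_bound)
  also have "\<dots> \<le> expectation (\<lambda>x. B (Y x))"
    using inc[OF X(1)] by (intro integral_mono integrable_abs Bochner_Integration.integrable_diff ig b) auto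
  finally have "\<bar>expectation (\<lambda>x. (X x)\<^sup>2) * (expectation (\<lambda>x. g' (Y x)) - expectation (\<lambda>x. g' (Y x + X x)))\<bar>
    \<le> expectation (\<lambda>x. (X x)\<^sup>2) * expectation (\<lambda>x. B (Y x))"
    unfolding abs_mult by (auto intro!: mult_mono simp: abs_minus_commute integral_nonneg_AE)
  with A show ?thesis by (simp add: algebra_simps)
qed

section \<open>Distribution functions against ramps, and the self-bounding argument\<close>

lemma std_normal_cdf:
  "cdf std_normal_distribution x = (\<integral>y. indicator {..x} y * std_normal_density y \<partial>lborel)"
  unfolding cdf_def measure_def
  by (subst emeasure_density) (auto simp: integral_eq_nn_integral mult.commute nn_integral_set_ennreal
      intro!: arg_cong[where f=enn2real] nn_integral_cong split: split_indicator)

lemma std_normal_cdf_lipschitz: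
  assumes "a \<le> b"
  shows "cdf std_normal_distribution b - cdf std_normal_distribution a \<le> (b - a) / 2"
proof -
  have int: "integrable lborel (\<lambda>x. indicator A x * std_normal_density x)" if "A \<in> sets borel" for A
    using integrable_mult_indicator[of A lborel std_normal_density] that by (simp add: mult.commute)
  have "cdf std_normal_distribution b - cdf std_normal_distribution a
     = (\<integral>y. indicator {a<..b} y * std_normal_density y \<partial>lborel)"
    unfolding std_normal_cdf
    by (subst Bochner_Integration.integral_diff[OF int int, symmetric])
      (use assms in \<open>auto intro!: Bochner_Integration.integral_cong simp: indicator_def\<close>)
  also have "\<dots> \<le> (\<integral>y. indicator {a<..b} y * (1/2) \<partial>lborel)"
  proof (intro integral_mono int)
    show "indicator {a<..b} x * std_normal_density x \<le> indicator {a<..b} x * (1/2)" for x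
      by (intro mult_left_mono std_normal_density_le) auto
  qed (use assms in \<open>auto intro!: integrable_divide integrable_real_indicator\<close>)
  finally show ?thesis using assms by simp
qed

lemma std_normal_ramp_bounds:
  assumes "0 < \<alpha>"
  shows "cdf std_normal_distribution z \<le> (\<integral>x. std_normal_density x * ramp z \<alpha> x \<partial>lborel)"
    and "(\<integral>x. std_normal_density x * ramp z \<alpha> x \<partial>lborel) \<le> cdf std_normal_distribution (z + \<alpha>)"
proof -
  have int: "integrable lborel (\<lambda>x. indicator A x * std_normal_density x)" if "A \<in> sets borel" for A
    using integrable_mult_indicator[of A lborel std_normal_density] that by (simp add: mult.commute)
  have int2: "integrable lborel (\<lambda>x. std_normal_density x * ramp z \<alpha> x)"
    by (rule integrable_std_normal_mult) (use ramp_bounds in \<open>auto simp: abs_le_iff intro: order_trans[of _ 0]\<close>)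
  show "cdf std_normal_distribution z \<le> (\<integral>x. std_normal_density x * ramp z \<alpha> x \<partial>lborel)"
    unfolding std_normal_cdf using assms
    by (intro integral_mono int int2) (auto simp: ramp_eq_1 ramp_bounds indicator_def)
  show "(\<integral>x. std_normal_density x * ramp z \<alpha> x \<partial>lborel) \<le> cdf std_normal_distribution (z + \<alpha>)"
    unfolding std_normal_cdf using assms
    by (intro integral_mono int int2) (auto simp: ramp_eq_0 ramp_bounds indicator_def mult_left_le)
qed

text \<open>Each summand is independent of the sum of the others, so only the diagonal terms
  survive.\<close>

lemma (in prob_space) second_moment_sum:
  fixes \<xi> :: "'i \<Rightarrow> 'a \<Rightarrow> real"
  assumes fin: "finite I" and indep: "indep_vars (\<lambda>_. borel) \<xi> I"
    and bd: "\<And>i x. i \<in> I \<Longrightarrow> x \<in> space M \<Longrightarrow> \<bar>\<xi> i x\<bar> \<le> \<delta>"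
    and mean: "\<And>i. i \<in> I \<Longrightarrow> expectation (\<xi> i) = 0"
  shows "integrable M (\<lambda>x. (\<Sum>i\<in>I. \<xi> i x)\<^sup>2)"
    and "expectation (\<lambda>x. (\<Sum>i\<in>I. \<xi> i x)\<^sup>2) = (\<Sum>i\<in>I. expectation (\<lambda>x. (\<xi> i x)\<^sup>2))"
proof -
  define W where "W x = (\<Sum>i\<in>I. \<xi> i x)" for x
  define Y where "Y i x = (\<Sum>j\<in>I - {i}. \<xi> j x)" for i x
  have rv: "\<xi> i \<in> borel_measurable M" if "i \<in> I" for i
    using indep that unfolding indep_vars_def by auto
  have WY: "W x = Y i x + \<xi> i x" if "i \<in> I" for i x
    unfolding W_def Y_def using fin that by (simp add: sum.remove)
  have ind: "indep_var borel (\<xi> i) borel (Y i)" if "i \<in> I" for i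
    unfolding Y_def[abs_def]
    by (rule indep_vars_sum) (use fin indep that in \<open>auto simp: insert_absorb\<close>)
  have i\<xi>: "integrable M (\<xi> i)" if "i \<in> I" for i
    by (rule integrable_bounded[OF rv[OF that] bd[OF that]])
  have iY: "integrable M (Y i)" for i
    unfolding Y_def[abs_def] by (intro Bochner_Integration.integrable_sum i\<xi>) auto
  have i\<xi>2: "integrable M (\<lambda>x. (\<xi> i x)\<^sup>2)" if "i \<in> I" for i
    using rv[OF that] by (intro integrable_bounded[of _ "\<delta>\<^sup>2"])
      (auto, metis bd[OF that] abs_ge_zero power2_abs power_mono)
  have \<xi>W: "integrable M (\<lambda>x. \<xi> i x * W x) \<and> expectation (\<lambda>x. \<xi> i x * W x) = expectation (\<lambda>x. (\<xi> i x)\<^sup>2)"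
    if "i \<in> I" for i
  proof -
    note e = indep_var_lebesgue_integral[OF ind i\<xi> iY, OF that that] indep_var_integrable[OF ind i\<xi> iY, OF that that]
    have eq: "(\<lambda>x. \<xi> i x * W x) = (\<lambda>x. \<xi> i x * Y i x + (\<xi> i x)\<^sup>2)"
      by (auto simp: WY[OF that] algebra_simps power2_eq_square)
    show ?thesis unfolding eq using e i\<xi>2[OF that] mean[OF that] by simp
  qed
  have W2eq: "(\<lambda>x. (W x)\<^sup>2) = (\<lambda>x. \<Sum>i\<in>I. \<xi> i x * W x)"
    by (simp add: sum_distrib_right[symmetric] W_def power2_eq_square)
  show "integrable M (\<lambda>x. (\<Sum>i\<in>I. \<xi> i x)\<^sup>2)"
    "expectation (\<lambda>x. (\<Sum>i\<in>I. \<xi> i x)\<^sup>2) = (\<Sum>i\<in>I. expectation (\<lambda>x. (\<xi> i x)\<^sup>2))"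
    unfolding W_def[symmetric] W2eq using \<xi>W by auto
qed

text \<open>The Stein error contains the probability that the sum lies in an interval of length
  proportional to \<delta>. This is a Gaussian probability up to twice the unknown supremum
  \<open>\<Delta>\<close> of the error, which returns with a factor below one and is absorbed on the
  left.\<close>

theorem (in prob_space) berry_esseen_bounded:
  fixes \<xi> :: "'i \<Rightarrow> 'a \<Rightarrow> real"
  assumes fin: "finite I" and indep: "indep_vars (\<lambda>_. borel) \<xi> I"
    and bd: "\<And>i x. i \<in> I \<Longrightarrow> x \<in> space M \<Longrightarrow> \<bar>\<xi> i x\<bar> \<le> \<delta>"
    and mean: "\<And>i. i \<in> I \<Longrightarrow> expectation (\<xi> i) = 0"
    and var: "(\<Sum>i\<in>I. expectation (\<lambda>x. (\<xi> i x)\<^sup>2)) = 1"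
    and \<delta>: "0 < \<delta>" "\<delta> \<le> 1"
  shows "\<bar>prob {x \<in> space M. (\<Sum>i\<in>I. \<xi> i x) \<le> z} - cdf std_normal_distribution z\<bar> \<le> 52 * \<delta>"
proof -
  let ?\<Phi> = "cdf std_normal_distribution"
  interpret N: real_distribution std_normal_distribution
    by (rule real_dist_normal_dist)
  define W where "W x = (\<Sum>i\<in>I. \<xi> i x)" for x
  define Y where "Y i x = (\<Sum>j\<in>I - {i}. \<xi> j x)" for i x
  define F where "F z = prob {x \<in> space M. W x \<le> z}" for z
  have rv: "\<xi> i \<in> borel_measurable M" if "i \<in> I" for i
    using indep that unfolding indep_vars_def by auto
  have mW[measurable]: "W \<in> borel_measurable M" unfolding W_def[abs_def] using rv by measurable
  have mY: "Y i \<in> borel_measurable M" for i unfolding Y_def[abs_def] using rv by measurable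
  have WY: "W x = Y i x + \<xi> i x" if "i \<in> I" for i x
    unfolding W_def Y_def using fin that by (simp add: sum.remove)
  have ind: "indep_var borel (\<xi> i) borel (Y i)" if "i \<in> I" for i
    unfolding Y_def[abs_def]
    by (rule indep_vars_sum) (use fin indep that in \<open>auto simp: insert_absorb\<close>)
  have i\<xi>: "integrable M (\<xi> i)" if "i \<in> I" for i
    by (rule integrable_bounded[OF rv[OF that] bd[OF that]])
  have iY: "integrable M (Y i)" for i
    unfolding Y_def[abs_def] by (intro Bochner_Integration.integrable_sum i\<xi>) auto
  have iW: "integrable M W"
    unfolding W_def[abs_def] by (intro Bochner_Integration.integrable_sum i\<xi>) auto
  have iW2: "integrable M (\<lambda>x. (W x)\<^sup>2)" and EW2: "expectation (\<lambda>x. (W x)\<^sup>2) = 1"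
    unfolding W_def using second_moment_sum[OF fin indep bd mean] var by auto
  have EW: "expectation (\<lambda>x. \<bar>W x\<bar>) \<le> 1"
  proof -
    have "expectation (\<lambda>x. \<bar>W x\<bar>) \<le> expectation (\<lambda>x. (1 + (W x)\<^sup>2) / 2)"
    proof (intro integral_mono integrable_abs iW)
      fix x
      have "0 \<le> (\<bar>W x\<bar> - 1)\<^sup>2" by simp
      then show "\<bar>W x\<bar> \<le> (1 + (W x)\<^sup>2) / 2" by (simp add: power2_diff)
    qed (use iW2 in auto)
    also have "\<dots> = 1" using EW2 iW2 by (simp add: prob_space)
    finally show ?thesis .
  qed
  have EY: "expectation (\<lambda>x. \<bar>Y i x\<bar>) \<le> 2" if "i \<in> I" for i
  proof -
    have "expectation (\<lambda>x. \<bar>Y i x\<bar>) \<le> expectation (\<lambda>x. \<bar>W x\<bar> + 1)"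
    proof (intro integral_mono integrable_abs iY)
      show "\<bar>Y i x\<bar> \<le> \<bar>W x\<bar> + 1" if "x \<in> space M" for x
        using bd[OF \<open>i \<in> I\<close> that] \<delta> WY[OF \<open>i \<in> I\<close>, of x] by linarith
    qed (use iW in auto)
    also have "\<dots> \<le> 2" using EW iW by (simp add: prob_space)
    finally show ?thesis .
  qed
  \<comment> \<open>The supremum is finite since both distribution functions take values in the unit
    interval; absorbing it later relies on that.\<close>
  define \<Delta> where "\<Delta> = (SUP z. \<bar>F z - ?\<Phi> z\<bar>)"
  have bdd: "bdd_above (range (\<lambda>z. \<bar>F z - ?\<Phi> z\<bar>))"
  proof (rule bdd_aboveI)
    fix y assume "y \<in> range (\<lambda>z. \<bar>F z - ?\<Phi> z\<bar>)"
    then obtain z where "y = \<bar>F z - ?\<Phi> z\<bar>" by auto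
    moreover have "0 \<le> F z" "F z \<le> 1" unfolding F_def by auto
    ultimately show "y \<le> 1"
      using N.cdf_bounded_prob[of z] N.cdf_nonneg[of z] by linarith
  qed
  have \<Delta>: "\<bar>F z - ?\<Phi> z\<bar> \<le> \<Delta>" for z
    unfolding \<Delta>_def by (rule cSUP_upper[OF _ bdd]) simp
  \<comment> \<open>With a slope of width \<open>8 * \<delta>\<close> the term
    \<open>2 * \<Delta>\<close> of the interval probability enters \<open>b\<close> as
    \<open>\<Delta> / 4\<close>, and the final bound \<open>4 * \<delta> + 2 * b\<close> as
    \<open>\<Delta> / 2\<close>.\<close>
  define \<alpha> where "\<alpha> = 8 * \<delta>"
  have \<alpha>: "0 < \<alpha>" using \<delta> by (simp add: \<alpha>_def)
  \<comment> \<open>The 10 is 6 plus twice the bound 2 on the mean of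
    \<open>\<bar>Y i x\<bar>\<close>; 13/16 comes from a window of length
    \<open>13 * \<delta>\<close> under a density of at most 1/2, divided by
    \<open>\<alpha> = 8 * \<delta>\<close>.\<close>
  define b where "b = \<delta> * (10 + 13/16) + \<Delta> / 4"
  have err: "\<bar>expectation (\<lambda>x. ramp z \<alpha> (W x)) - (\<integral>x. std_normal_density x * ramp z \<alpha> x \<partial>lborel)\<bar> \<le> 2 * b" for z
  proof -
    define \<nu> where "\<nu> = (\<integral>x. std_normal_density x * ramp z \<alpha> x \<partial>lborel)"
    let ?T = "{z - \<delta>..z + \<alpha> + \<delta>}"
    define B where "B = (\<lambda>w. \<delta> * (6 + 2 * \<bar>w\<bar> + indicator ?T w / \<alpha>))"
    obtain g g' where [measurable]: "g \<in> borel_measurable borel" "g' \<in> borel_measurable borel"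
      and g: "\<And>x. g' x = x * g x + ramp z \<alpha> x - \<nu>" "\<And>x. \<bar>g x\<bar> \<le> 6" "\<And>x. \<bar>g' x\<bar> \<le> 2"
      "\<And>w t. \<bar>t\<bar> \<le> \<delta> \<Longrightarrow> \<bar>g' (w + t) - g' w\<bar> \<le> B w"
      "\<And>w t. \<bar>t\<bar> \<le> \<delta> \<Longrightarrow> \<bar>g (w + t) - g w - t * g' w\<bar> \<le> \<bar>t\<bar> * B w"
      by (rule stein_ramp[OF \<alpha> \<delta>(1) \<nu>_def B_def]) (rule that)
    have [measurable]: "B \<in> borel_measurable borel" unfolding B_def by measurable
    have iind: "integrable M (\<lambda>x. indicator ?T (Y i x) :: real)" for i
      by (rule integrable_bounded[of _ 1]) (use mY in \<open>auto simp: indicator_def\<close>)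
    have iB: "integrable M (\<lambda>x. B (Y i x))" for i
      unfolding B_def using iind iY by (intro integrable_mult_right Bochner_Integration.integrable_add integrable_divide) auto
    have EB: "expectation (\<lambda>x. B (Y i x)) \<le> b" if i: "i \<in> I" for i
    proof -
      \<comment> \<open>Passing from \<open>Y i x\<close> to \<open>W x\<close> widens the interval
        by \<delta> on both sides; one further \<delta> on the left lets a half-open interval
        contain the closed one.\<close>
      have "expectation (\<lambda>x. indicat_real ?T (Y i x)) \<le> expectation (indicat_real {x \<in> space M. W x \<in> {z - 3 * \<delta><..z + \<alpha> + 2 * \<delta>}})"
      proof (intro integral_mono iind)
        fix x assume "x \<in> space M"
        then show "indicator ?T (Y i x) \<le> (indicator {x \<in> space M. W x \<in> {z - 3 * \<delta><..z + \<alpha> + 2 * \<delta>}} x :: real)"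
          using bd[OF i, of x] \<delta> WY[OF i, of x] by (auto simp: indicator_def abs_le_iff)
      qed (auto intro!: integrable_bounded[of _ 1] simp: indicator_def)
      also have "\<dots> = prob {x \<in> space M. W x \<in> {z - 3 * \<delta><..z + \<alpha> + 2 * \<delta>}}" by simp
      also have "\<dots> = F (z + \<alpha> + 2 * \<delta>) - F (z - 3 * \<delta>)"
        unfolding F_def using \<delta> \<alpha>
        by (subst finite_measure_Diff[symmetric]) (auto intro!: arg_cong[where f=prob])
      also have "\<dots> \<le> 2 * \<Delta> + (?\<Phi> (z + \<alpha> + 2 * \<delta>) - ?\<Phi> (z - 3 * \<delta>))"
        using \<Delta>[of "z + \<alpha> + 2 * \<delta>"] \<Delta>[of "z - 3 * \<delta>"] by linarith
      also have "\<dots> \<le> 2 * \<Delta> + 13 * \<delta> / 2"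
        using std_normal_cdf_lipschitz[of "z - 3 * \<delta>" "z + \<alpha> + 2 * \<delta>"] \<delta> \<alpha> unfolding \<alpha>_def by (simp add: field_simps)
      finally have p: "expectation (\<lambda>x. indicat_real ?T (Y i x)) \<le> 2 * \<Delta> + 13 * \<delta> / 2" .
      have "expectation (\<lambda>x. B (Y i x)) = \<delta> * (6 + 2 * expectation (\<lambda>x. \<bar>Y i x\<bar>) + expectation (\<lambda>x. indicat_real ?T (Y i x)) / \<alpha>)"
        unfolding B_def using iind[of i] iY[of i] by (simp add: prob_space)
      also have "\<dots> \<le> \<delta> * (6 + 2 * 2 + (2 * \<Delta> + 13 * \<delta> / 2) / \<alpha>)"
        using EY[OF i] p \<delta> \<alpha> by (intro mult_left_mono add_mono divide_right_mono) auto
      also have "\<dots> = b" unfolding \<alpha>_def b_def using \<delta> by (simp add: field_simps)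
      finally show ?thesis .
    qed
    have gW: "integrable M (\<lambda>x. \<xi> i x * g (W x))" if "i \<in> I" for i
      by (rule integrable_bounded[of _ "\<delta> * 6"]) (use rv[OF that] bd[OF that] g(2) \<delta> in \<open>auto simp: abs_mult intro!: mult_mono\<close>)
    have ig': "integrable M (\<lambda>x. g' (W x))" by (rule integrable_bounded[of _ 2]) (use g in auto)
    have ir: "integrable M (\<lambda>x. ramp z \<alpha> (W x))"
      by (rule integrable_bounded[of _ 1]) (use ramp_bounds in \<open>auto simp: abs_le_iff intro: order_trans[of _ 0]\<close>)
    have Wg_eq: "(\<lambda>x. W x * g (W x)) = (\<lambda>x. \<Sum>i\<in>I. \<xi> i x * g (W x))"
      by (simp add: W_def sum_distrib_right)
    have WgW: "expectation (\<lambda>x. W x * g (W x)) = (\<Sum>i\<in>I. expectation (\<lambda>x. \<xi> i x * g (W x)))"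
      unfolding Wg_eq by (rule Bochner_Integration.integral_sum) (rule gW)
    have iWg: "integrable M (\<lambda>x. W x * g (W x))"
      unfolding Wg_eq using gW by auto
    have "expectation (\<lambda>x. g' (W x)) = expectation (\<lambda>x. W x * g (W x)) + expectation (\<lambda>x. ramp z \<alpha> (W x)) - \<nu>"
      unfolding g(1) using iWg ir by (simp add: prob_space)
    then have "\<bar>expectation (\<lambda>x. ramp z \<alpha> (W x)) - \<nu>\<bar> = \<bar>expectation (\<lambda>x. W x * g (W x)) - expectation (\<lambda>x. g' (W x))\<bar>"
      by simp
    also have "\<dots> = \<bar>\<Sum>i\<in>I. expectation (\<lambda>x. \<xi> i x * g (W x)) - expectation (\<lambda>x. (\<xi> i x)\<^sup>2) * expectation (\<lambda>x. g' (W x))\<bar>"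
      unfolding WgW by (simp add: sum_subtractf sum_distrib_right[symmetric] var)
    also have "\<dots> \<le> (\<Sum>i\<in>I. \<bar>expectation (\<lambda>x. \<xi> i x * g (W x)) - expectation (\<lambda>x. (\<xi> i x)\<^sup>2) * expectation (\<lambda>x. g' (W x))\<bar>)"
      by (rule sum_abs)
    also have "\<dots> \<le> (\<Sum>i\<in>I. 2 * expectation (\<lambda>x. (\<xi> i x)\<^sup>2) * b)"
    proof (intro sum_mono)
      fix i assume i: "i \<in> I"
      have "\<bar>expectation (\<lambda>x. \<xi> i x * g (W x)) - expectation (\<lambda>x. (\<xi> i x)\<^sup>2) * expectation (\<lambda>x. g' (W x))\<bar>
        \<le> 2 * expectation (\<lambda>x. (\<xi> i x)\<^sup>2) * expectation (\<lambda>x. B (Y i x))"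
        unfolding WY[OF i]
      proof (rule stein_exchange[OF ind[OF i] bd[OF i] mean[OF i], where C=6])
        show "\<bar>g' x\<bar> \<le> 6" for x using g(3)[of x] by linarith
      qed (use g iB in auto)
      also have "\<dots> \<le> 2 * expectation (\<lambda>x. (\<xi> i x)\<^sup>2) * b"
        using EB[OF i] by (intro mult_left_mono) auto
      finally show "\<bar>expectation (\<lambda>x. \<xi> i x * g (W x)) - expectation (\<lambda>x. (\<xi> i x)\<^sup>2) * expectation (\<lambda>x. g' (W x))\<bar>
        \<le> 2 * expectation (\<lambda>x. (\<xi> i x)\<^sup>2) * b" .
    qed
    also have "\<dots> = 2 * b" using var by (simp add: sum_distrib_left[symmetric] sum_distrib_right[symmetric])
    finally show ?thesis unfolding \<nu>_def .
  qed
  have ir: "integrable M (\<lambda>x. ramp z \<alpha> (W x))" for z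
    by (rule integrable_bounded[of _ 1]) (use ramp_bounds in \<open>auto simp: abs_le_iff intro: order_trans[of _ 0]\<close>)
  have Fle: "F z \<le> expectation (\<lambda>x. ramp z \<alpha> (W x))" for z
  proof -
    have "F z = expectation (indicat_real {x \<in> space M. W x \<le> z})" unfolding F_def by simp
    also have "\<dots> \<le> expectation (\<lambda>x. ramp z \<alpha> (W x))"
      by (intro integral_mono ir) (auto simp: indicator_def ramp_bounds ramp_eq_1 \<alpha> intro!: integrable_bounded[of _ 1])
    finally show ?thesis .
  qed
  \<comment> \<open>Shifting the ramp to the left by its width puts it below the indicator of
    \<open>{..z}\<close>.\<close>
  have Fge: "expectation (\<lambda>x. ramp (z - \<alpha>) \<alpha> (W x)) \<le> F z" for z
  proof -
    have "expectation (\<lambda>x. ramp (z - \<alpha>) \<alpha> (W x)) \<le> expectation (indicat_real {x \<in> space M. W x \<le> z})"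
      by (intro integral_mono ir) (auto simp: indicator_def ramp_bounds ramp_eq_0 \<alpha> intro!: integrable_bounded[of _ 1])
    also have "\<dots> = F z" unfolding F_def by simp
    finally show ?thesis .
  qed
  have main: "\<bar>F z - ?\<Phi> z\<bar> \<le> 4 * \<delta> + 2 * b" for z
  proof -
    have "F z \<le> ?\<Phi> z + 4 * \<delta> + 2 * b"
      using Fle[of z] err[of z] std_normal_ramp_bounds(2)[OF \<alpha>, of z] std_normal_cdf_lipschitz[of z "z + \<alpha>"] \<alpha>
      unfolding \<alpha>_def by simp
    moreover have "?\<Phi> z \<le> F z + 4 * \<delta> + 2 * b"
      using Fge[of z] err[of "z - \<alpha>"] std_normal_ramp_bounds(1)[OF \<alpha>, of "z - \<alpha>"] std_normal_cdf_lipschitz[of "z - \<alpha>" z] \<alpha>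
      unfolding \<alpha>_def by simp
    ultimately show ?thesis by linarith
  qed
  have "\<Delta> \<le> 4 * \<delta> + 2 * b" unfolding \<Delta>_def by (rule cSUP_least) (auto intro: main)
  \<comment> \<open>Solving the inequality for \<open>\<Delta>\<close> gives the factor
    51.25.\<close>
  then have "\<Delta> \<le> 52 * \<delta>" unfolding b_def using \<delta> by (simp add: field_simps)
  then show ?thesis using \<Delta>[of z] unfolding F_def W_def by linarith
qed

section \<open>Quantile coupling with a Gaussian variable\<close>

text \<open>Lower counterpart of the Lipschitz bound: on a compact interval the distribution
  function grows at a definite speed, so a small error in it moves quantiles by a comparable amount
  only.\<close>

lemma std_normal_cdf_growth:
  assumes "- K \<le> a" "a \<le> b" "b \<le> K"
  shows "std_normal_density K * (b - a) \<le> cdf std_normal_distribution b - cdf std_normal_distribution a"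
proof -
  have int: "integrable lborel (\<lambda>x. indicator A x * std_normal_density x)" if "A \<in> sets borel" for A
    using integrable_mult_indicator[of A lborel std_normal_density] that by (simp add: mult.commute)
  have "std_normal_density K * (b - a) = (\<integral>y. indicator {a<..b} y * std_normal_density K \<partial>lborel)"
    using assms by simp
  also have "\<dots> \<le> (\<integral>y. indicator {a<..b} y * std_normal_density y \<partial>lborel)"
  proof (intro integral_mono int)
    fix x
    show "indicator {a<..b} x * std_normal_density K \<le> indicator {a<..b} x * std_normal_density x"
    proof (cases "x \<in> {a<..b}")
      case True
      then have "\<bar>x\<bar> \<le> K" using assms by auto
      then have "x\<^sup>2 \<le> K\<^sup>2" by (metis abs_ge_zero power2_abs power_mono)
      then show ?thesis using True by (auto simp: std_normal_density_def intro!: divide_right_mono)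
    qed auto
  qed (use assms in auto)
  also have "\<dots> = cdf std_normal_distribution b - cdf std_normal_distribution a"
    unfolding std_normal_cdf
    by (subst Bochner_Integration.integral_diff[OF int int, symmetric])
      (use assms in \<open>auto intro!: Bochner_Integration.integral_cong simp: indicator_def\<close>)
  finally show ?thesis .
qed

lemma std_normal_cdf_less:
  assumes "a < b" shows "cdf std_normal_distribution a < cdf std_normal_distribution b"
proof -
  define K where "K = max \<bar>a\<bar> \<bar>b\<bar>"
  have "0 < std_normal_density K * (b - a)" using assms by (simp add: normal_density_pos)
  also have "\<dots> \<le> cdf std_normal_distribution b - cdf std_normal_distribution a"
    using assms by (intro std_normal_cdf_growth) (auto simp: K_def)
  finally show ?thesis by simp
qed

lemma std_normal_cdf_open: "0 < cdf std_normal_distribution u" "cdf std_normal_distribution u < 1"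
proof -
  interpret N: real_distribution std_normal_distribution by (rule real_dist_normal_dist)
  show "0 < cdf std_normal_distribution u"
    using N.cdf_nonneg[of "u - 1"] std_normal_cdf_less[of "u - 1" u] by linarith
  show "cdf std_normal_distribution u < 1"
    using N.cdf_bounded_prob[of "u + 1"] std_normal_cdf_less[of u "u + 1"] by linarith
qed

text \<open>The transform is the quantile function of \<open>P\<close> after the Gaussian
  distribution function. That the latter maps the Gaussian law to the uniform one is seen by writing
  the Gaussian as the image of the uniform law under its own pseudoinverse \<open>N.I\<close>, of
  which the distribution function is a left inverse by \<open>inv\<close>.\<close>

lemma std_normal_quantile_transform:
  assumes "real_distribution P"
  obtains q :: "real \<Rightarrow> real" where "q \<in> borel_measurable borel"
    "distr std_normal_distribution borel q = P"
    "\<And>u x. q u \<le> x \<longleftrightarrow> cdf std_normal_distribution u \<le> cdf P x"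
proof -
  let ?\<Phi> = "cdf std_normal_distribution"
  let ?R = "restrict_space lborel {0<..<1::real}"
  interpret N: cdf_distribution std_normal_distribution
    unfolding cdf_distribution_def by (rule real_dist_normal_dist)
  interpret P: cdf_distribution P unfolding cdf_distribution_def by fact
  have inv: "?\<Phi> (N.I u) = u" if u: "0 < u" "u < 1" for u
  proof (rule antisym)
    show "u \<le> ?\<Phi> (N.I u)" using N.pseudoinverse[OF u, of "N.I u"] by simp
    \<comment> \<open>To the left of \<open>N.I u\<close> the distribution function is below
      \<open>u\<close>; the Lipschitz bound carries this over to the point itself.\<close>
    show "?\<Phi> (N.I u) \<le> u"
    proof (rule field_le_epsilon)
      fix e :: real assume "0 < e"
      then have "?\<Phi> (N.I u - e) < u" using N.pseudoinverse[OF u, of "N.I u - e"] by auto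
      moreover have "?\<Phi> (N.I u) - ?\<Phi> (N.I u - e) \<le> e / 2"
        using std_normal_cdf_lipschitz[of "N.I u - e" "N.I u"] \<open>0 < e\<close> by simp
      ultimately show "?\<Phi> (N.I u) \<le> u + e" using \<open>0 < e\<close> by linarith
    qed
  qed
  have m\<Phi>: "?\<Phi> \<in> borel \<rightarrow>\<^sub>M restrict_space borel {0<..<1}"
    by (rule measurable_restrict_space2) (auto simp: std_normal_cdf_open)
  have mq: "(\<lambda>u. P.I (?\<Phi> u)) \<in> borel_measurable borel"
    using measurable_compose[OF m\<Phi> P.measurable_CI] .
  have mI: "N.I \<in> ?R \<rightarrow>\<^sub>M borel" using N.measurable_CI
    by (simp cong: measurable_cong_sets add: sets_restrict_space)
  have e1: "distr std_normal_distribution borel (\<lambda>u. P.I (?\<Phi> u))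
      = distr (distr ?R borel N.I) borel (\<lambda>u. P.I (?\<Phi> u))"
    by (simp only: N.distr_I_eq_M)
  have e2: "distr (distr ?R borel N.I) borel (\<lambda>u. P.I (?\<Phi> u)) = distr ?R borel (\<lambda>u. P.I (?\<Phi> (N.I u)))"
    by (subst distr_distr[OF mq mI]) (simp only: comp_def)
  have e3: "distr ?R borel (\<lambda>u. P.I (?\<Phi> (N.I u))) = distr ?R borel P.I"
  proof (rule distr_cong)
    fix u assume "u \<in> space ?R"
    then have "0 < u" "u < 1" by (auto simp: space_restrict_space)
    then show "P.I (?\<Phi> (N.I u)) = P.I u" by (simp only: inv)
  qed (rule refl)+
  have law: "distr std_normal_distribution borel (\<lambda>u. P.I (?\<Phi> u)) = P"
    by (simp only: e1 e2 e3 P.distr_I_eq_M)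
  have iff: "P.I (?\<Phi> u) \<le> x \<longleftrightarrow> ?\<Phi> u \<le> cdf P x" for u x
    using P.pseudoinverse[OF std_normal_cdf_open, of u x] by (simp only:)
  show thesis by (rule that[OF mq law iff])
qed

text \<open>The pair \<open>(S, E)\<close> is encoded in one real number whose integer part is the rank of \<open>S\<close>, so
  that the quantile transform of the code reproduces the joint law of \<open>S\<close> and \<open>E\<close> and yields the
  quantile transform of \<open>S\<close> in the first component.\<close>

lemma (in prob_space) joint_quantile_coupling:
  fixes S E :: "'a \<Rightarrow> real"
  assumes [measurable]: "S \<in> borel_measurable M" "E \<in> borel_measurable M"
    and fin: "finite (S ` space M)"
  obtains V W :: "real \<Rightarrow> real" where "V \<in> borel_measurable borel" "W \<in> borel_measurable borel"
    "\<And>f. f \<in> borel_measurable (borel \<Otimes>\<^sub>M borel) \<Longrightarrow>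
       distr std_normal_distribution borel (\<lambda>u. f (V u, W u)) = distr M borel (\<lambda>x. f (S x, E x) :: real)"
    "\<And>u y. V u \<le> y \<longleftrightarrow> cdf std_normal_distribution u \<le> prob {x \<in> space M. S x \<le> y}"
proof -
  let ?\<Phi> = "cdf std_normal_distribution"
  define A where "A = S ` space M"
  have A: "finite A" "A \<noteq> {}" using fin not_empty by (auto simp: A_def)
  define rank where "rank s = real (card {s' \<in> A. s' < s})" for s
  have rank_less: "rank s + 1 \<le> rank t" if "s \<in> A" "s < t" for s t
  proof -
    have "card {s' \<in> A. s' < s} < card {s' \<in> A. s' < t}"
      using that A by (intro psubset_card_mono) auto
    then show ?thesis unfolding rank_def by linarith
  qed
  have rank_mono: "rank s \<le> rank t" if "s \<le> t" for s t
    unfolding rank_def using that A by (auto intro!: card_mono)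
  \<comment> \<open>Squashes the reals into the open unit interval, so that ranks and fractional
    parts cannot interfere.\<close>
  define sq where "sq e = 1 / 2 + arctan e / pi" for e
  have sq: "0 < sq e" "sq e < 1" for e
    using arctan_lbound[of e] arctan_ubound[of e] pi_gt_zero by (auto simp: sq_def field_simps)
  define code where "code x = rank (S x) + sq (E x)" for x
  \<comment> \<open>Inserting the least atom keeps the maximum defined where no atom has a rank
    below \<open>p\<close>; the result is monotone, hence measurable.\<close>
  define dS where "dS p = Max (insert (Min A) {s \<in> A. rank s < p})" for p
  define dE where "dE p = tan (pi * (p - rank (dS p) - 1 / 2))" for p
  have mono_rank: "mono rank" using rank_mono by (auto intro: monoI)
  have [measurable]: "rank \<in> borel_measurable borel" by (rule borel_measurable_mono[OF mono_rank])
  have "mono dS" unfolding dS_def using A by (intro monoI Max_mono) auto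
  then have [measurable]: "dS \<in> borel_measurable borel" by (rule borel_measurable_mono)
  have [measurable]: "sq \<in> borel_measurable borel" unfolding sq_def[abs_def] by measurable
  have mcode[measurable]: "code \<in> borel_measurable M" unfolding code_def[abs_def] by measurable
  have [measurable]: "dE \<in> borel_measurable borel" unfolding dE_def[abs_def] tan_def by measurable
  have dS_code: "dS (code x) = S x" if x: "x \<in> space M" for x
  proof -
    have SA: "S x \<in> A" using x by (auto simp: A_def)
    have "{s \<in> A. rank s < code x} = {s \<in> A. s \<le> S x}"
    proof (intro Collect_cong conj_cong refl)
      fix s assume "s \<in> A"
      show "rank s < code x \<longleftrightarrow> s \<le> S x"
      proof (cases "s \<le> S x")
        case True then show ?thesis using rank_mono[OF True] sq[of "E x"] by (simp add: code_def)
      next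
        case False then show ?thesis using rank_less[OF SA, of s] sq[of "E x"] by (simp add: code_def)
      qed
    qed
    then show ?thesis unfolding dS_def using SA A
      by (intro Max_eqI) (auto intro: Min_le)
  qed
  have dE_code: "dE (code x) = E x" if x: "x \<in> space M" for x
    unfolding dE_def dS_code[OF x] by (simp add: code_def sq_def arctan tan_arctan)
  interpret P: real_distribution "distr M borel code"
    by (rule real_distribution_distr) simp
  obtain q where q: "q \<in> borel_measurable borel" "distr std_normal_distribution borel q = distr M borel code"
    "\<And>u x. q u \<le> x \<longleftrightarrow> ?\<Phi> u \<le> cdf (distr M borel code) x"
    using std_normal_quantile_transform[OF P.real_distribution_axioms] by metis
  note [measurable] = q(1)
  have cdfP: "cdf (distr M borel code) y = prob {x \<in> space M. code x \<le> y}" for y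
    unfolding cdf_def by (subst measure_distr) (auto intro!: arg_cong[where f=prob])
  \<comment> \<open>Codes are positive and so are their quantiles; hence the inserted least atom,
    whose rank is 0, is among the candidates anyway.\<close>
  have qpos: "0 < q u" for u
  proof -
    have "{x \<in> space M. code x \<le> 0} = {}" using sq by (force simp: code_def rank_def not_le intro: add_nonneg_pos)
    then have "cdf (distr M borel code) 0 = 0" unfolding cdfP by (metis measure_empty)
    then show ?thesis using q(3)[of u 0] std_normal_cdf_open[of u] by auto
  qed
  define V where "V u = dS (q u)" for u
  define W where "W u = dE (q u)" for u
  have Vle: "V u \<le> y \<longleftrightarrow> (\<forall>s\<in>A. rank s < q u \<longrightarrow> s \<le> y)" for u y
  proof -
    have "rank (Min A) = 0" using A by (auto simp: rank_def dest: Min_le)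
    then have "insert (Min A) {s \<in> A. rank s < q u} = {s \<in> A. rank s < q u}"
      and "{s \<in> A. rank s < q u} \<noteq> {}" using Min_in[OF A] qpos[of u] by force+
    then show ?thesis unfolding V_def dS_def using A by (simp add: Max_le_iff) blast
  qed
  have Viff: "V u \<le> y \<longleftrightarrow> ?\<Phi> u \<le> prob {x \<in> space M. S x \<le> y}" for u y
  proof (cases "\<exists>s\<in>A. y < s")
    case False
    then have "{x \<in> space M. S x \<le> y} = space M" by (force simp: A_def)
    then have "prob {x \<in> space M. S x \<le> y} = 1" by (simp add: prob_space)
    moreover have "V u \<le> y" using False Vle by force
    ultimately show ?thesis using std_normal_cdf_open[of u] by simp
  next
    case True
    \<comment> \<open>The next atom above \<open>y\<close>: its rank separates the codes of the
      atoms up to \<open>y\<close> from the codes of those above.\<close>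
    define s0 where "s0 = Min {s \<in> A. y < s}"
    have s0: "s0 \<in> A" "y < s0" "\<And>s. s \<in> A \<Longrightarrow> y < s \<Longrightarrow> s0 \<le> s"
    proof -
      have "s0 \<in> {s \<in> A. y < s}" unfolding s0_def using True A by (intro Min_in) auto
      then show "s0 \<in> A" "y < s0" by auto
      show "s0 \<le> s" if "s \<in> A" "y < s" for s unfolding s0_def using that A by (intro Min_le) auto
    qed
    have "{x \<in> space M. S x \<le> y} = {x \<in> space M. code x \<le> rank s0}"
    proof (intro Collect_cong conj_cong refl)
      fix x assume "x \<in> space M"
      then have SA: "S x \<in> A" by (auto simp: A_def)
      show "S x \<le> y \<longleftrightarrow> code x \<le> rank s0"
      proof (cases "S x \<le> y")
        case True then show ?thesis using rank_less[OF SA, of s0] s0 sq[of "E x"] by (simp add: code_def)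
      next
        case False then show ?thesis
          using rank_mono[OF s0(3)[OF SA]] sq[of "E x"] by (simp add: code_def)
      qed
    qed
    then have "?\<Phi> u \<le> prob {x \<in> space M. S x \<le> y} \<longleftrightarrow> q u \<le> rank s0" using q(3) cdfP by simp
    also have "\<dots> \<longleftrightarrow> V u \<le> y"
      unfolding Vle using s0 rank_mono by (meson leD le_less_linear order_less_le_trans)
    finally show ?thesis ..
  qed
  show thesis
  proof (rule that[of V W])
    show "V \<in> borel_measurable borel" "W \<in> borel_measurable borel"
      unfolding V_def[abs_def] W_def[abs_def] by measurable
    fix f :: "real \<times> real \<Rightarrow> real" assume f: "f \<in> borel_measurable (borel \<Otimes>\<^sub>M borel)"
    have mg: "(\<lambda>p. f (dS p, dE p)) \<in> borel_measurable borel" using f by measurable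
    have "distr std_normal_distribution borel (\<lambda>u. f (V u, W u))
        = distr (distr std_normal_distribution borel q) borel (\<lambda>p. f (dS p, dE p))"
      by (subst distr_distr[OF mg]) (auto simp: V_def W_def comp_def)
    also have "\<dots> = distr M borel (\<lambda>x. f (dS (code x), dE (code x)))"
      unfolding q(2) by (subst distr_distr[OF mg]) (auto simp: comp_def)
    also have "\<dots> = distr M borel (\<lambda>x. f (S x, E x))"
      by (intro distr_cong) (auto simp: dS_code dE_code)
    finally show "distr std_normal_distribution borel (\<lambda>u. f (V u, W u)) = distr M borel (\<lambda>x. f (S x, E x))" .
  qed (rule Viff)
qed

text \<open>Asked along the tail of the sequence only, because events of probability tending to one
  say nothing about small \<open>n\<close>.\<close>

definition bounded_in_prob :: "'a measure \<Rightarrow> (nat \<Rightarrow> 'a \<Rightarrow> real) \<Rightarrow> bool" where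
  "bounded_in_prob M X \<longleftrightarrow>
     (\<forall>\<epsilon>>0. \<exists>B. \<forall>\<^sub>F n in sequentially. measure M {x \<in> space M. B < \<bar>X n x\<bar>} \<le> \<epsilon>)"

lemma (in prob_space) tight_singleton:
  assumes [measurable]: "X \<in> borel_measurable M" and "0 < \<epsilon>"
  obtains B where "prob {x \<in> space M. B < \<bar>X x :: real\<bar>} < \<epsilon>"
proof -
  have "(\<lambda>k. prob {x \<in> space M. real k < \<bar>X x\<bar>}) \<longlonglongrightarrow> prob (\<Inter>k. {x \<in> space M. real k < \<bar>X x\<bar>})"
    by (intro finite_Lim_measure_decseq) (auto simp: decseq_def)
  also have "(\<Inter>k. {x \<in> space M. real k < \<bar>X x\<bar>}) = {}"
  proof -
    have "\<exists>k. \<not> real k < \<bar>X x\<bar>" for x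
      using reals_Archimedean2[of "\<bar>X x\<bar>"] by (meson less_asym)
    then show ?thesis by auto
  qed
  finally have "(\<lambda>k. prob {x \<in> space M. real k < \<bar>X x\<bar>}) \<longlonglongrightarrow> 0" by simp
  from order_tendstoD(2)[OF this \<open>0 < \<epsilon>\<close>] show thesis
    using that by (auto dest: eventually_happens)
qed

text \<open>Only finitely many laws escape the uniform bound, and each single law is tight.\<close>

lemma (in prob_space) tight_distr:
  assumes [measurable]: "\<And>n. X n \<in> borel_measurable M" and b: "bounded_in_prob M X"
  shows "tight (\<lambda>n. distr M borel (X n))"
  unfolding tight_def
proof (intro conjI allI impI)
  show "real_distribution (distr M borel (X n))" for n by (rule real_distribution_distr) simp
  fix \<epsilon> :: real assume \<epsilon>: "0 < \<epsilon>"
  obtain B N where B: "prob {x \<in> space M. B < \<bar>X n x\<bar>} \<le> \<epsilon> / 2" if "N \<le> n" for n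
    using b \<epsilon> unfolding bounded_in_prob_def eventually_sequentially by (meson half_gt_zero)
  have "\<exists>b. prob {x \<in> space M. b < \<bar>X n x\<bar>} < \<epsilon>" for n
    using tight_singleton[of "X n" \<epsilon>] \<epsilon> by auto
  then obtain b where b: "\<And>n. prob {x \<in> space M. b n < \<bar>X n x\<bar>} < \<epsilon>" by metis
  define K where "K = Max (insert 0 (insert B (b ` {..<N})))"
  have K: "0 \<le> K" "B \<le> K" "n < N \<Longrightarrow> b n \<le> K" for n
    unfolding K_def by (rule Max_ge; auto)+
  have p: "prob {x \<in> space M. K < \<bar>X n x\<bar>} < \<epsilon>" for n
  proof (cases "n < N")
    case True
    have "prob {x \<in> space M. K < \<bar>X n x\<bar>} \<le> prob {x \<in> space M. b n < \<bar>X n x\<bar>}"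
      using K(3)[OF True] by (intro finite_measure_mono) auto
    then show ?thesis using b[of n] by linarith
  next
    case False
    have "prob {x \<in> space M. K < \<bar>X n x\<bar>} \<le> prob {x \<in> space M. B < \<bar>X n x\<bar>}"
      using K(2) by (intro finite_measure_mono) auto
    then show ?thesis using B[of n] False \<epsilon> by linarith
  qed
  show "\<exists>a b. a < b \<and> (\<forall>n. 1 - \<epsilon> < measure (distr M borel (X n)) {a<..b})"
  proof (intro exI conjI allI)
    \<comment> \<open>The half-open interval excludes its left end, hence the extra 1 there.\<close>
    show "- (K + 1) < K" using K by linarith
    fix n
    have "measure (distr M borel (X n)) {- (K + 1)<..K} = prob {x \<in> space M. X n x \<in> {- (K + 1)<..K}}"
      by (subst measure_distr) (auto intro!: arg_cong[where f=prob])
    also have "\<dots> \<ge> prob (space M - {x \<in> space M. K < \<bar>X n x\<bar>})"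
      by (intro finite_measure_mono) auto
    moreover have "prob (space M - {x \<in> space M. K < \<bar>X n x\<bar>}) = 1 - prob {x \<in> space M. K < \<bar>X n x\<bar>}"
      by (rule prob_compl) simp
    ultimately show "1 - \<epsilon> < measure (distr M borel (X n)) {- (K + 1)<..K}" using p[of n] by linarith
  qed
qed

lemma (in prob_space) bounded_in_prob_add:
  assumes [measurable]: "\<And>n. X n \<in> borel_measurable M" "\<And>n. Y n \<in> borel_measurable M"
    and b: "bounded_in_prob M X" "bounded_in_prob M Y"
  shows "bounded_in_prob M (\<lambda>n x. X n x + Y n x)"
  unfolding bounded_in_prob_def
proof (intro allI impI)
  fix \<epsilon> :: real assume \<epsilon>: "0 < \<epsilon>"
  obtain B where B: "\<forall>\<^sub>F n in sequentially. prob {x \<in> space M. B < \<bar>X n x\<bar>} \<le> \<epsilon> / 2"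
    using b(1) \<epsilon> unfolding bounded_in_prob_def by (meson half_gt_zero)
  obtain C where C: "\<forall>\<^sub>F n in sequentially. prob {x \<in> space M. C < \<bar>Y n x\<bar>} \<le> \<epsilon> / 2"
    using b(2) \<epsilon> unfolding bounded_in_prob_def by (meson half_gt_zero)
  have "\<forall>\<^sub>F n in sequentially. prob {x \<in> space M. B + C < \<bar>X n x + Y n x\<bar>} \<le> \<epsilon>"
    using B C
  proof eventually_elim
    case (elim n)
    have "prob {x \<in> space M. B + C < \<bar>X n x + Y n x\<bar>}
        \<le> prob ({x \<in> space M. B < \<bar>X n x\<bar>} \<union> {x \<in> space M. C < \<bar>Y n x\<bar>})"
      by (intro finite_measure_mono) auto
    also have "\<dots> \<le> prob {x \<in> space M. B < \<bar>X n x\<bar>} + prob {x \<in> space M. C < \<bar>Y n x\<bar>}"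
      by (intro measure_Un_le) auto
    finally show ?case using elim by linarith
  qed
  then show "\<exists>B. \<forall>\<^sub>F n in sequentially. prob {x \<in> space M. B < \<bar>X n x + Y n x\<bar>} \<le> \<epsilon>" ..
qed

text \<open>\<open>V n (U x)\<close> is the quantile transform of \<open>S n\<close> driven by the
  same Gaussian variable as the limit, and \<open>W n (U x)\<close> carries \<open>E n\<close>
  along. Over a distance \<open>b / s\<close> inside a compact set the Gaussian distribution
  function gains at least \<open>d * (b / s)\<close>, which beats the error \<open>C / s\<close>; on
  the scale of \<open>S n\<close> this distance is \<open>\<sigma> * b\<close>, independently of
  \<open>n\<close>.\<close>

theorem (in prob_space) gaussian_coupling:
  fixes S E :: "nat \<Rightarrow> 'a \<Rightarrow> real" and c :: "nat \<Rightarrow> real"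
  assumes U: "distributed M lborel U std_normal_density"
    and [measurable]: "\<And>n. S n \<in> borel_measurable M" "\<And>n. E n \<in> borel_measurable M"
    and fin: "\<And>n. finite (S n ` space M)"
    and \<sigma>: "0 < \<sigma>"
    and be: "\<And>n z. 1 \<le> n \<Longrightarrow>
      \<bar>prob {x \<in> space M. S n x \<le> z * (\<sigma> * sqrt (real n))} - cdf std_normal_distribution z\<bar> \<le> C / sqrt (real n)"
    and E: "bounded_in_prob M E"
  obtains R where "\<And>n. R n \<in> borel_measurable M" "tight (\<lambda>n. distr M borel (R n))"
    "\<And>n. distr M borel (\<lambda>x. c n + S n x + E n x) = distr M borel (\<lambda>x. c n + \<sigma> * U x * sqrt (real n) + R n x)"
proof -
  let ?\<Phi> = "cdf std_normal_distribution"
  have mU[measurable]: "U \<in> borel_measurable M"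
    using distributed_measurable[OF U] by (simp cong: measurable_cong_sets)
  have dU: "distr M borel U = std_normal_distribution"
    using distributed_distr_eq_density[OF U] by (metis distr_cong sets_lborel)
  define Q where "Q n V W \<longleftrightarrow> V \<in> borel_measurable borel \<and> W \<in> borel_measurable borel \<and>
    (\<forall>f. f \<in> borel_measurable (borel \<Otimes>\<^sub>M borel) \<longrightarrow>
       distr std_normal_distribution borel (\<lambda>u. f (V u, W u)) = distr M borel (\<lambda>x. f (S n x, E n x) :: real)) \<and>
    (\<forall>u y. V u \<le> y \<longleftrightarrow> ?\<Phi> u \<le> prob {x \<in> space M. S n x \<le> y})" for n V W
  have "\<exists>V W. Q n V W" for n
    unfolding Q_def by (rule joint_quantile_coupling[OF assms(2,3) fin, of n]) blast
  then obtain V W where "\<And>n. Q n (V n) (W n)" by metis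
  then have VW[measurable]: "\<And>n. V n \<in> borel_measurable borel" "\<And>n. W n \<in> borel_measurable borel"
    and dist: "\<And>n f. f \<in> borel_measurable (borel \<Otimes>\<^sub>M borel) \<Longrightarrow>
       distr std_normal_distribution borel (\<lambda>u. f (V n u, W n u)) = distr M borel (\<lambda>x. f (S n x, E n x) :: real)"
    and Viff: "\<And>n u y. V n u \<le> y \<longleftrightarrow> ?\<Phi> u \<le> prob {x \<in> space M. S n x \<le> y}"
    unfolding Q_def by blast+
  have law: "distr M borel (\<lambda>x. f (V n (U x), W n (U x))) = distr M borel (\<lambda>x. f (S n x, E n x) :: real)"
    if f: "f \<in> borel_measurable (borel \<Otimes>\<^sub>M borel)" for f n
  proof -
    have mg: "(\<lambda>u. f (V n u, W n u)) \<in> borel_measurable borel" using f by measurable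
    have "distr M borel (\<lambda>x. f (V n (U x), W n (U x))) = distr (distr M borel U) borel (\<lambda>u. f (V n u, W n u))"
      by (subst distr_distr[OF mg]) (auto simp: comp_def)
    then show ?thesis unfolding dU using dist[OF f] by simp
  qed
  \<comment> \<open>A function of \<open>U\<close> alone: the quantile mismatch plus the transported
    error.\<close>
  define R where "R n x = (V n (U x) - \<sigma> * U x * sqrt (real n)) + W n (U x)" for n x
  have mR: "R n \<in> borel_measurable M" for n unfolding R_def[abs_def] by measurable
  have eqd: "distr M borel (\<lambda>x. c n + S n x + E n x) = distr M borel (\<lambda>x. c n + \<sigma> * U x * sqrt (real n) + R n x)" for n
    using law[of "\<lambda>p. c n + fst p + snd p" n] by (simp add: R_def algebra_simps)
  \<comment> \<open>The second component of the coupling keeps the law of \<open>E n\<close>, and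
    boundedness in probability depends on laws only.\<close>
  have bW: "bounded_in_prob M (\<lambda>n x. W n (U x))"
  proof -
    have "prob {x \<in> space M. B < \<bar>W n (U x)\<bar>} = prob {x \<in> space M. B < \<bar>E n x\<bar>}" for B n
    proof -
      have "measure (distr M borel (\<lambda>x. W n (U x))) {e. B < \<bar>e\<bar>} = measure (distr M borel (E n)) {e. B < \<bar>e\<bar>}"
        using law[of snd n] by simp
      then show ?thesis by (subst (asm) (1 2) measure_distr) (auto simp: vimage_def Int_def conj_commute)
    qed
    then show ?thesis using E unfolding bounded_in_prob_def by simp
  qed
  have bV: "bounded_in_prob M (\<lambda>n x. V n (U x) - \<sigma> * U x * sqrt (real n))"
    unfolding bounded_in_prob_def
  proof (intro allI impI)
    fix \<epsilon> :: real assume \<epsilon>: "0 < \<epsilon>"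
    obtain K where K: "prob {x \<in> space M. K < \<bar>U x\<bar>} < \<epsilon>" using tight_singleton[OF mU \<epsilon>] .
    \<comment> \<open>The extra 1 leaves room for the shift \<open>b / s\<close>, which is at most 1
      for large \<open>n\<close>.\<close>
    define d where "d = std_normal_density (K + 1)"
    have d: "0 < d" by (simp add: d_def normal_density_pos)
    define b where "b = (\<bar>C\<bar> + 1) / d"
    have b: "0 < b" "C < d * b" using d by (auto simp: b_def)
    have "\<forall>\<^sub>F n in sequentially. b \<le> sqrt (real n)" by real_asymp
    then have "\<forall>\<^sub>F n in sequentially. prob {x \<in> space M. \<sigma> * b < \<bar>V n (U x) - \<sigma> * U x * sqrt (real n)\<bar>} \<le> \<epsilon>"
      using eventually_ge_at_top[of 1]
    proof eventually_elim
      case (elim n)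
      define s where "s = sqrt (real n)"
      have s: "0 < s" "b \<le> s" using elim by (auto simp: s_def)
      have bs: "0 < b / s" "b / s \<le> 1" using b s by auto
      have Cs: "C / s < d * (b / s)" using b s by (simp add: divide_strict_right_mono)
      \<comment> \<open>Both sides follow from the equivalence \<open>Viff\<close>, applied at the
        two points where the Gaussian argument is moved by \<open>b / s\<close> up and down.\<close>
      have "\<bar>V n u - \<sigma> * u * s\<bar> \<le> \<sigma> * b" if u: "\<bar>u\<bar> \<le> K" for u
      proof -
        have up: "V n u \<le> \<sigma> * u * s + \<sigma> * b"
        proof -
          have eq: "\<sigma> * u * s + \<sigma> * b = (u + b / s) * (\<sigma> * sqrt (real n))" using s by (simp add: s_def[symmetric] field_simps)
          have "d * (b / s) \<le> ?\<Phi> (u + b / s) - ?\<Phi> u"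
            using std_normal_cdf_growth[of "K + 1" u "u + b / s"] u bs unfolding d_def by (auto simp: abs_le_iff)
          moreover have "?\<Phi> (u + b / s) - C / s \<le> prob {x \<in> space M. S n x \<le> (u + b / s) * (\<sigma> * sqrt (real n))}"
            using be[OF elim(2), of "u + b / s"] unfolding s_def by (simp add: abs_le_iff)
          ultimately show ?thesis unfolding Viff eq using Cs by linarith
        qed
        have lo: "\<not> V n u \<le> \<sigma> * u * s - \<sigma> * b"
        proof -
          have eq: "\<sigma> * u * s - \<sigma> * b = (u - b / s) * (\<sigma> * sqrt (real n))" using s by (simp add: s_def[symmetric] field_simps)
          have "d * (b / s) \<le> ?\<Phi> u - ?\<Phi> (u - b / s)"
            using std_normal_cdf_growth[of "K + 1" "u - b / s" u] u bs unfolding d_def by (auto simp: abs_le_iff)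
          moreover have "prob {x \<in> space M. S n x \<le> (u - b / s) * (\<sigma> * sqrt (real n))} \<le> ?\<Phi> (u - b / s) + C / s"
            using be[OF elim(2), of "u - b / s"] unfolding s_def by (simp add: abs_le_iff)
          ultimately show ?thesis unfolding Viff eq using Cs by linarith
        qed
        show ?thesis using up lo by linarith
      qed
      then have "prob {x \<in> space M. \<sigma> * b < \<bar>V n (U x) - \<sigma> * U x * s\<bar>} \<le> prob {x \<in> space M. K < \<bar>U x\<bar>}"
        by (intro finite_measure_mono) (auto simp: not_le[symmetric])
      then show ?case using K unfolding s_def by linarith
    qed
    then show "\<exists>B. \<forall>\<^sub>F n in sequentially. prob {x \<in> space M. B < \<bar>V n (U x) - \<sigma> * U x * sqrt (real n)\<bar>} \<le> \<epsilon>" ..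
  qed
  have "bounded_in_prob M R"
    unfolding R_def[abs_def] by (intro bounded_in_prob_add bV bW) measurable
  then show thesis using that mR eqd tight_distr by blast
qed

section \<open>The free energy on the grid\<close>

text \<open>By the midpoint bound for \<open>ln (n + 1) - ln n\<close> the sequence \<open>d\<close>
  decreases from \<open>d 1 = 1\<close>. By the trapezoidal bound its decrements are at most those
  of \<open>1 / (4 * n)\<close>, so \<open>d n - 1 / (4 * n)\<close> increases from 3/4.\<close>

lemma ln_fact_stirling:
  assumes "1 \<le> n"
  shows "ln (fact n) - (real n + 1 / 2) * ln (real n) + real n \<in> {3/4..1}"
proof -
  define d where "d n = ln (fact n) - (real n + 1 / 2) * ln (real n) + real n" for n :: nat
  have step: "d n - d (Suc n) = (real n + 1 / 2) * (ln (real n + 1) - ln (real n)) - 1" if "1 \<le> n" for n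
  proof -
    have "ln (fact (Suc n)) = ln (real n + 1) + ln (fact n :: real)"
      using that by (simp add: ln_mult add_ac)
    then show ?thesis unfolding d_def by (simp add: algebra_simps)
  qed
  have lo: "0 \<le> d n - d (Suc n)" if "1 \<le> n" for n
  proof -
    have "2 * 1 / (2 * real n + 1) \<le> ln (real n + 1) - ln (real n)"
      using ln_inverse_approx_ge[of "real n" "real n + 1"] that by (simp add: field_simps)
    then have "(real n + 1 / 2) * (2 / (2 * real n + 1)) \<le> (real n + 1 / 2) * (ln (real n + 1) - ln (real n))"
      by (intro mult_left_mono) auto
    then show ?thesis unfolding step[OF that] by (simp add: field_simps)
  qed
  have up: "d n - d (Suc n) \<le> 1 / (4 * real n) - 1 / (4 * real (Suc n))" if "1 \<le> n" for n
  proof -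
    have "ln (real n + 1) - ln (real n) \<le> 1 * (inverse (real n) + inverse (real n + 1)) / 2"
      using ln_inverse_approx_le[of "real n" 1] that by simp
    then have "(real n + 1 / 2) * (ln (real n + 1) - ln (real n))
        \<le> (real n + 1 / 2) * ((inverse (real n) + inverse (real n + 1)) / 2)"
      by (intro mult_left_mono) auto
    also have "\<dots> = 1 + (1 / (4 * real n) - 1 / (4 * real (Suc n)))"
      using that by (simp add: divide_simps) (simp add: algebra_simps)
    finally show ?thesis unfolding step[OF that] by simp
  qed
  have d1: "d 1 = 1" by (simp add: d_def)
  have "d n \<le> 1 \<and> 3/4 + 1 / (4 * real n) \<le> d n"
    using assms
  proof (induction n rule: dec_induct)
    case base then show ?case using d1 by simp
  next
    case (step n) then show ?case using lo[of n] up[of n] by auto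
  qed
  moreover have "0 \<le> 1 / (4 * real n)" by simp
  ultimately show ?thesis unfolding d_def atLeastAtMost_iff by linarith
qed

text \<open>Three Stirling remainders in \<open>{3/4..1}\<close> combine to a number of modulus
  below 2; the two logarithmic terms come from the square root factors of Stirling's
  formula.\<close>

lemma ln_binomial_stirling:
  assumes "0 < i" "i < N"
  defines "x \<equiv> - 1 + 2 * real i / real N"
  shows "\<bar>ln (real (N choose i)) + real N * cramer_entropy x + ln (real N) / 2
     + ln ((1 - x) / 2 * ((1 + x) / 2)) / 2\<bar> \<le> 2"
proof -
  let ?p = "real i" and ?q = "real (N - i)"
  have N: "0 < real N" "?p + ?q = real N" "0 < ?p" "0 < ?q" using assms by auto
  have x: "(1 + x) / 2 = ?p / real N" "(1 - x) / 2 = ?q / real N"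
    using N unfolding x_def by (simp_all add: field_simps)
  have "real (N choose i) = fact N / (fact i * fact (N - i))"
    using assms binomial_fact[of i N, where 'a=real] by simp
  then have b: "ln (real (N choose i)) = ln (fact N) - ln (fact i) - ln (fact (N - i))"
    by (simp add: ln_div ln_mult)
  have e: "real N * cramer_entropy x = ?q * (ln ?q - ln (real N)) + ?p * (ln ?p - ln (real N))"
    unfolding cramer_entropy_def x using N by (simp add: ln_div field_simps)
  have l: "ln ((1 - x) / 2 * ((1 + x) / 2)) = ln ?q + ln ?p - 2 * ln (real N)"
    unfolding x using N by (simp add: ln_div ln_mult)
  \<comment> \<open>Algebra that turns the left side into the Stirling remainder of \<open>N\<close>
    minus those of \<open>i\<close> and \<open>N - i\<close>.\<close>
  have alg: "lN - li - lq + (q * (Lq - LN) + p * (Li - LN)) + LN / 2 + (Lq + Li - 2 * LN) / 2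
      = (lN - (r + 1 / 2) * LN + r) - (li - (p + 1 / 2) * Li + p) - (lq - (q + 1 / 2) * Lq + q)"
    if "p + q = r" for lN li lq LN Li Lq p q r :: real
    using that by (auto simp: field_simps)
  have "1 \<le> N" "1 \<le> i" "1 \<le> N - i" using assms by auto
  then show ?thesis unfolding b e l alg[OF N(2)]
    using ln_fact_stirling[of N] ln_fact_stirling[of i] ln_fact_stirling[of "N - i"]
    unfolding atLeastAtMost_iff by linarith
qed

section \<open>Energy differences under single steps on the grid\<close>

definition shift :: "real^'k \<Rightarrow> 'k \<Rightarrow> real \<Rightarrow> real^'k" where
  "shift x l u = (\<chi> i. if i = l then x $ l + u else x $ i)"

lemma shift_nth[simp]: "shift x l u $ l = x $ l + u" "i \<noteq> l \<Longrightarrow> shift x l u $ i = x $ i"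
  by (auto simp: shift_def)

locale finite_volume =
  fixes a :: "'k::finite \<Rightarrow> real" and \<beta> h :: real and j :: "nat \<Rightarrow> real" and n :: nat
  assumes n_pos: "0 < n" and size_pos: "\<And>l. 0 < class_size a j n l" and beta_pos: "0 < \<beta>"
begin

abbreviation "N \<equiv> class_size a j n"
abbreviation "F \<equiv> free_energy_n a \<beta> h j n"

definition mag :: "real^'k \<Rightarrow> real" where
  "mag x = (\<Sum>l\<in>UNIV. a l * freq a j n l * x $ l)"

text \<open>The share of one class in \<open>n\<close> times the free energy, apart from the
  quadratic term: different classes interact through \<open>mag\<close> only.\<close>

definition site :: "'k \<Rightarrow> real \<Rightarrow> real" where
  "site l u = - h * real (N l) * u - 1 / \<beta> * ln (real (N l choose nat \<lfloor>(1 + u) / 2 * real (N l)\<rfloor>))"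

lemma floor_coordinate:
  "nat \<lfloor>(1 + (- 1 + 2 * real i / real (N l))) / 2 * real (N l)\<rfloor> = i"
proof -
  have "(1 + (- 1 + 2 * real i / real (N l))) / 2 * real (N l) = real i"
    using size_pos[of l] by simp
  then show ?thesis by simp
qed

lemma gridE:
  assumes "x \<in> grid a j n"
  obtains i where "i \<le> N l" "x $ l = - 1 + 2 * real i / real (N l)"
  using assms unfolding grid_def by auto

text \<open>On the grid no binomial coefficient vanishes, so the logarithm of the product splits
  over the classes.\<close>

lemma free_energy_n_eq:
  assumes x: "x \<in> grid a j n"
  shows "real n * F x = - (real n / 2) * (mag x)\<^sup>2 + (\<Sum>l\<in>UNIV. site l (x $ l))"
proof -
  have pos: "0 < real (N l choose nat \<lfloor>(1 + x $ l) / 2 * real (N l)\<rfloor>)" for l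
  proof -
    obtain i where i: "i \<le> N l" "x $ l = - 1 + 2 * real i / real (N l)" using gridE[OF x] .
    show ?thesis unfolding i(2) floor_coordinate using i(1) by simp
  qed
  have P: "ln (\<Prod>l\<in>UNIV. real (N l choose nat \<lfloor>(1 + x $ l) / 2 * real (N l)\<rfloor>))
     = (\<Sum>l\<in>UNIV. ln (real (N l choose nat \<lfloor>(1 + x $ l) / 2 * real (N l)\<rfloor>)))"
    by (intro ln_prod finite less_imp_neq[OF pos, symmetric])
  have S: "(\<Sum>l\<in>UNIV. site l (x $ l)) = - h * (\<Sum>l\<in>UNIV. real (N l) * x $ l)
      - 1 / \<beta> * (\<Sum>l\<in>UNIV. ln (real (N l choose nat \<lfloor>(1 + x $ l) / 2 * real (N l)\<rfloor>)))"
    by (simp only: site_def sum_subtractf sum_distrib_left mult.assoc)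
  have Q: "(\<Sum>l\<in>UNIV. freq a j n l * x $ l) = (\<Sum>l\<in>UNIV. real (N l) * x $ l) / real n"
    by (simp add: freq_def sum_divide_distrib)
  have alg: "r * (- (1 / 2) * g\<^sup>2 - h * (u / r) - 1 / (\<beta> * r) * v) = - (r / 2) * g\<^sup>2 + (- h * u - 1 / \<beta> * v)"
    if "0 < r" for r g u v :: real
    using that beta_pos by (simp add: field_simps)
  show ?thesis
    unfolding free_energy_n_def mag_def[symmetric] P Q S by (rule alg) (use n_pos in simp)
qed

lemma mag_shift: "mag (shift x l (s * 2 / real (N l))) = mag x + s * (2 * a l / real n)"
proof -
  have "mag (shift x l (s * 2 / real (N l)))
      = (\<Sum>i\<in>UNIV. a i * freq a j n i * x $ i + (if i = l then s * (2 * a l / real n) else 0))"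
    unfolding mag_def
  proof (intro sum.cong refl)
    fix i show "a i * freq a j n i * shift x l (s * 2 / real (N l)) $ i
       = a i * freq a j n i * x $ i + (if i = l then s * (2 * a l / real n) else 0)"
      using size_pos[of l] n_pos by (cases "i = l") (auto simp: freq_def field_simps)
  qed
  then show ?thesis by (simp add: sum.distrib mag_def)
qed

lemma sum_site_shift:
  "(\<Sum>i\<in>UNIV. site i (shift x l u $ i)) = (\<Sum>i\<in>UNIV. site i (x $ i)) + (site l (x $ l + u) - site l (x $ l))"
proof -
  have "(\<Sum>i\<in>UNIV. site i (shift x l u $ i))
      = (\<Sum>i\<in>UNIV. site i (x $ i) + (if i = l then site l (x $ l + u) - site l (x $ l) else 0))"
    by (intro sum.cong refl) auto
  then show ?thesis by (simp add: sum.distrib)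
qed

lemma nn_iff:
  "nn a j n x y \<longleftrightarrow> (\<exists>l s. (s = 1 \<or> s = - 1) \<and> y = shift x l (s * 2 / real (N l)))" (is "?L \<longleftrightarrow> ?R")
proof
  assume ?L
  then obtain l where l: "y $ l = x $ l + 2 / real (N l) \<or> y $ l = x $ l - 2 / real (N l)"
    "\<And>l'. l' \<noteq> l \<Longrightarrow> y $ l' = x $ l'" unfolding nn_def by auto
  then have "y = shift x l (1 * 2 / real (N l)) \<or> y = shift x l (- 1 * 2 / real (N l))"
    by (auto simp: vec_eq_iff shift_def)
  then show ?R by blast
next
  assume ?R
  then show ?L unfolding nn_def by (metis shift_nth mult_1 mult_minus_left minus_divide_left uminus_add_conv_diff add.commute)
qed

lemma free_energy_step:
  assumes "x \<in> grid a j n" "shift x l (s * 2 / real (N l)) \<in> grid a j n" "s = 1 \<or> s = - 1"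
  shows "real n * F (shift x l (s * 2 / real (N l))) - real n * F x
    = - 2 * s * a l * mag x - 2 * (a l)\<^sup>2 / real n + (site l (x $ l + s * 2 / real (N l)) - site l (x $ l))"
proof -
  have "s * s = 1" using assms by auto
  have "(mag x + s * (2 * a l / real n))\<^sup>2 = (mag x)\<^sup>2 + 4 * s * a l * mag x / real n + (s * s) * (4 * (a l)\<^sup>2 / (real n)\<^sup>2)"
    using n_pos by (simp add: power2_eq_square field_simps)
  then show ?thesis
    unfolding free_energy_n_eq[OF assms(1)] free_energy_n_eq[OF assms(2)] mag_shift sum_site_shift \<open>s * s = 1\<close>
    using n_pos by (simp add: field_simps power2_eq_square)
qed

text \<open>Steps in two different classes interact through the square of \<open>mag\<close> only.
  The mixed second difference is therefore explicit and of order \<open>1 / n\<close>, whatever the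
  entropy does.\<close>

lemma free_energy_mixed:
  assumes "i \<noteq> l" "x \<in> grid a j n" "shift x i (s * 2 / real (N i)) \<in> grid a j n"
    "shift x l (r * 2 / real (N l)) \<in> grid a j n"
  shows "shift (shift x i (s * 2 / real (N i))) l (r * 2 / real (N l)) \<in> grid a j n"
    and "real n * F (shift (shift x i (s * 2 / real (N i))) l (r * 2 / real (N l))) + real n * F x
       = real n * F (shift x i (s * 2 / real (N i))) + real n * F (shift x l (r * 2 / real (N l)))
         - 4 * s * r * a i * a l / real n"
proof -
  let ?p = "shift x i (s * 2 / real (N i))"
  show g: "shift ?p l (r * 2 / real (N l)) \<in> grid a j n"
    unfolding grid_def
  proof (intro CollectI allI)
    fix k
    show "\<exists>i\<le>N k. shift ?p l (r * 2 / real (N l)) $ k = - 1 + 2 * real i / real (N k)"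
    proof (cases "k = l")
      case True
      then show ?thesis using assms(1,4) unfolding grid_def by (auto dest!: spec[of _ l])
    next
      case False
      then show ?thesis using assms(3) unfolding grid_def by (auto dest!: spec[of _ k])
    qed
  qed
  show "real n * F (shift ?p l (r * 2 / real (N l))) + real n * F x
       = real n * F ?p + real n * F (shift x l (r * 2 / real (N l))) - 4 * s * r * a i * a l / real n"
    unfolding free_energy_n_eq[OF g] free_energy_n_eq[OF assms(2)] free_energy_n_eq[OF assms(3)]
      free_energy_n_eq[OF assms(4)] mag_shift sum_site_shift
    using assms(1) n_pos by (simp add: field_simps power2_eq_square)
qed

lemma binomial_log_concave:
  assumes "0 < i" "i < M"
  shows "real (M choose (i + 1)) * real (M choose (i - 1)) \<le> (real (M choose i))\<^sup>2"
proof -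
  obtain k where k: "i = Suc k" using assms(1) by (cases i) auto
  have 1: "real (Suc (Suc k)) * real (M choose Suc (Suc k)) = real (M - Suc k) * real (M choose Suc k)"
    by (metis binomial_absorb_comp binomial_absorption of_nat_mult mult.commute)
  have 2: "real (Suc k) * real (M choose Suc k) = real (M - k) * real (M choose k)"
    by (metis binomial_absorb_comp binomial_absorption of_nat_mult mult.commute)
  have M: "0 < real (M - k)" "real (M - Suc k) \<le> real (M - k)" using assms k by auto
  have r: "real (M choose Suc (Suc k)) = real (M - Suc k) * real (M choose Suc k) / real (Suc (Suc k))"
    using 1 by (simp add: field_simps)
  have p: "real (M choose k) = real (Suc k) * real (M choose Suc k) / real (M - k)"
    using 2 M by (simp add: field_simps)
  have "real (M choose Suc (Suc k)) * real (M choose k)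
      = (real (M choose Suc k))\<^sup>2 * ((real (M - Suc k) * real (Suc k)) / (real (M - k) * real (Suc (Suc k))))"
    unfolding r p by (simp only: power2_eq_square times_divide_times_eq times_divide_eq_right times_divide_eq_left divide_divide_eq_left mult_ac)
  also have "\<dots> \<le> (real (M choose Suc k))\<^sup>2 * 1"
  proof (intro mult_left_mono)
    have "real (M - Suc k) * real (Suc k) \<le> real (M - k) * real (Suc (Suc k))"
      using M by (intro mult_mono) auto
    then show "(real (M - Suc k) * real (Suc k)) / (real (M - k) * real (Suc (Suc k))) \<le> 1"
      using M by (simp add: divide_le_eq)
  qed simp
  finally show ?thesis unfolding k by simp
qed

end

lemma tanh_lipschitz: "\<bar>tanh x - tanh y\<bar> \<le> \<bar>x - y\<bar>" for x y :: real
proof -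
  have *: "tanh v - tanh u \<le> v - u \<and> tanh u \<le> tanh v" if "u \<le> v" for u v :: real
  proof -
    have "(\<lambda>x::real. x - tanh x) u \<le> (\<lambda>x. x - tanh x) v"
      by (rule DERIV_nonneg_imp_nondecreasing[OF that])
        (auto intro!: derivative_eq_intros exI)
    then show ?thesis using that by simp
  qed
  show ?thesis using *[of x y] *[of y x] by (cases "x \<le> y") auto
qed

text \<open>One notion for the minimum and the gate point, so that the same expansion serves both.
  The slack \<open>\<kappa> / n\<close> has the order of the second differences of \<open>n\<close>
  times the free energy and changes the mean-field equation by order \<open>1 / n\<close>
  only.\<close>

definition almost_local_min ::
  "('k::finite \<Rightarrow> real) \<Rightarrow> real \<Rightarrow> real \<Rightarrow> (nat \<Rightarrow> real) \<Rightarrow> nat \<Rightarrow> real \<Rightarrow> real^'k \<Rightarrow> bool" where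
  "almost_local_min a \<beta> h j n \<kappa> x \<longleftrightarrow> x \<in> grid a j n \<and>
     (\<forall>y \<in> grid a j n. nn a j n x y \<longrightarrow>
       real n * free_energy_n a \<beta> h j n x \<le> real n * free_energy_n a \<beta> h j n y + \<kappa> / real n)"

lemma local_minima_almost_local_min:
  "x \<in> local_minima a \<beta> h j n \<Longrightarrow> 0 \<le> \<kappa> \<Longrightarrow> almost_local_min a \<beta> h j n \<kappa> x"
  unfolding local_minima_def almost_local_min_def by (auto intro!: add_increasing2 mult_left_mono)

text \<open>Makes the minimum in \<open>comm_height\<close> range over finitely many
  heights.\<close>

lemma finite_grid: "finite (grid a j n)"
proof -
  have "grid a j n \<subseteq> (\<lambda>i. \<chi> l. - 1 + 2 * real (i l) / real (class_size a j n l)) ` (UNIV \<rightarrow>\<^sub>E {..n})"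
  proof
    fix x assume "x \<in> grid a j n"
    then obtain i where i: "\<And>l. i l \<le> class_size a j n l" "\<And>l. x $ l = - 1 + 2 * real (i l) / real (class_size a j n l)"
      unfolding grid_def by (auto simp: choice_iff)
    have "class_size a j n l \<le> n" for l
    proof -
      have "class_size a j n l \<le> card {1..n}"
        unfolding class_size_def level_set_def by (rule card_mono) auto
      then show ?thesis by simp
    qed
    then have "i \<in> UNIV \<rightarrow>\<^sub>E {..n}" by (auto simp: PiE_def intro: order_trans[OF i(1)])
    then show "x \<in> (\<lambda>i. \<chi> l. - 1 + 2 * real (i l) / real (class_size a j n l)) ` (UNIV \<rightarrow>\<^sub>E {..n})"
      by (intro image_eqI[of _ _ i]) (auto simp: vec_eq_iff i(2))
  qed
  then show ?thesis by (rule finite_subset) (intro finite_imageI finite_PiE, auto)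
qed

context finite_volume
begin

lemma nn_sym: "nn a j n x y \<Longrightarrow> nn a j n y x"
  unfolding nn_def by (metis add_diff_cancel_right' diff_add_cancel)

lemma nn_neq: "nn a j n x y \<Longrightarrow> x \<noteq> y"
  unfolding nn_def using size_pos by (auto simp: algebra_simps) (metis of_nat_0_less_iff order_less_irrefl)+

text \<open>The field term is affine and the logarithm of the binomial coefficients concave; as
  \<open>site\<close> carries the latter with a minus sign, it is convex along its
  coordinate.\<close>

lemma site_concave:
  assumes "x \<in> grid a j n" "shift x l (2 / real (N l)) \<in> grid a j n" "shift x l (- 2 / real (N l)) \<in> grid a j n"
  shows "2 * site l (x $ l) \<le> site l (x $ l + 2 / real (N l)) + site l (x $ l - 2 / real (N l))"
proof -
  note Np = size_pos[of l]
  obtain i where i: "i \<le> N l" "x $ l = - 1 + 2 * real i / real (N l)" using gridE[OF assms(1)] .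
  obtain i1 where i1: "i1 \<le> N l" "x $ l + 2 / real (N l) = - 1 + 2 * real i1 / real (N l)"
    using gridE[OF assms(2), of l] by auto
  obtain i2 where i2: "i2 \<le> N l" "x $ l - 2 / real (N l) = - 1 + 2 * real i2 / real (N l)"
    using gridE[OF assms(3), of l] by auto
  have "real i1 = real i + 1"
    using arg_cong[OF i1(2)[unfolded i(2)], of "\<lambda>z. z * real (N l)"] Np by (simp add: ring_distribs)
  then have e1: "i1 = i + 1" by linarith
  have "real i2 + 1 = real i"
    using arg_cong[OF i2(2)[unfolded i(2)], of "\<lambda>z. z * real (N l)"] Np by (simp add: ring_distribs left_diff_distrib)
  then have e2: "0 < i" "i2 = i - 1" by linarith+
  have "ln (real (N l choose (i + 1)) * real (N l choose (i - 1))) \<le> ln ((real (N l choose i))\<^sup>2)"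
    using binomial_log_concave[of i "N l"] i1 e1 e2 by (subst ln_le_cancel_iff) auto
  then have "ln (real (N l choose (i + 1))) + ln (real (N l choose (i - 1))) \<le> 2 * ln (real (N l choose i))"
    using i i1 e1 e2 by (simp add: ln_mult ln_realpow split: if_splits)
  then have "1 / \<beta> * (ln (real (N l choose i1)) + ln (real (N l choose i2))) \<le> 1 / \<beta> * (2 * ln (real (N l choose i)))"
    unfolding e1 e2 using beta_pos by (intro mult_left_mono) auto
  moreover have "site l (x $ l + 2 / real (N l)) = - h * real (N l) * (x $ l + 2 / real (N l)) - 1 / \<beta> * ln (real (N l choose i1))"
    unfolding i1(2) site_def floor_coordinate ..
  moreover have "site l (x $ l - 2 / real (N l)) = - h * real (N l) * (x $ l - 2 / real (N l)) - 1 / \<beta> * ln (real (N l choose i2))"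
    unfolding i2(2) site_def floor_coordinate ..
  moreover have "site l (x $ l) = - h * real (N l) * (x $ l) - 1 / \<beta> * ln (real (N l choose i))"
    unfolding i(2) site_def floor_coordinate ..
  ultimately show ?thesis by (simp add: algebra_simps)
qed

text \<open>The detour that avoids a steep gate point \<open>t\<close>: in the direction of a step \<open>t \<rightarrow> y\<close> that lowers
  the energy by more than the mixed second differences, every neighbour of \<open>t\<close> on an optimal path
  can be shifted along without exceeding the height of \<open>t\<close>.\<close>

lemma detour:
  assumes A: "\<And>l. \<bar>a l\<bar> \<le> A" and t: "t \<in> grid a j n" and y: "y \<in> grid a j n" "nn a j n t y"
    and steep: "real n * F y + 4 * A\<^sup>2 / real n < real n * F t"
    and p: "p \<in> grid a j n" "nn a j n t p" "F p \<le> F t"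
  obtains q where "q \<noteq> []" "hd q = p" "last q = y" "successively (nn a j n) q"
    "set q \<subseteq> grid a j n - {t}" "\<And>z. z \<in> set q \<Longrightarrow> F z \<le> F t"
proof -
  obtain l s where s: "s = 1 \<or> s = - 1" and yl: "y = shift t l (s * 2 / real (N l))"
    using y(2) unfolding nn_iff by blast
  obtain i r where r: "r = 1 \<or> r = - 1" and pi: "p = shift t i (r * 2 / real (N i))"
    using p(2) unfolding nn_iff by blast
  have "0 \<le> A" using A[of l] by linarith
  have Fy: "F y \<le> F t"
  proof -
    have "0 \<le> 4 * A\<^sup>2 / real n" by simp
    then have "real n * F y \<le> real n * F t" using steep by linarith
    then show ?thesis using n_pos by simp
  qed
  \<comment> \<open>The second differences of the interaction are of this size, which fixes the
    threshold of steepness.\<close>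
  have aa: "\<bar>4 * e * a i * a l / real n\<bar> \<le> 4 * A\<^sup>2 / real n" if "e = 1 \<or> e = - 1" for e i l
  proof -
    have "\<bar>a i\<bar> * \<bar>a l\<bar> \<le> A * A" using A \<open>0 \<le> A\<close> by (intro mult_mono) auto
    then show ?thesis using that n_pos by (auto simp: abs_mult power2_eq_square intro!: divide_right_mono)
  qed
  show thesis
  proof (cases "i = l")
    case True
    \<comment> \<open>A step opposite to the steep descent would rise above \<open>t\<close>: by
      convexity of \<open>site\<close> only the interaction could prevent this, and the threshold
      outweighs it.\<close>
    have "r = s"
    proof (rule ccontr)
      assume "r \<noteq> s"
      then have rs: "r = - s" using s r by auto
      have pe: "p = shift t l (- s * 2 / real (N l))" unfolding pi True rs ..
      have m: "2 * site l (t $ l) \<le> site l (t $ l + s * 2 / real (N l)) + site l (t $ l + - s * 2 / real (N l))"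
        using site_concave[of t l] t y(1) p(1) s unfolding yl pe by auto
      have "real n * F y - real n * F t + (real n * F p - real n * F t)
         = - 4 * (a l)\<^sup>2 / real n + (site l (t $ l + s * 2 / real (N l)) + site l (t $ l + - s * 2 / real (N l)) - 2 * site l (t $ l))"
        unfolding yl pe
        using free_energy_step[of t l s] free_energy_step[of t l "- s"] t y(1) p(1) s unfolding yl pe
        by (elim disjE) simp_all
      then have "- 4 * (a l)\<^sup>2 / real n \<le> real n * F y - real n * F t + (real n * F p - real n * F t)"
        using m by linarith
      moreover have "4 * (a l)\<^sup>2 / real n \<le> 4 * A\<^sup>2 / real n"
        using aa[of 1 l l] by (simp add: power2_eq_square abs_le_iff mult.assoc)
      ultimately have "real n * F t < real n * F p" using steep by linarith
      then show False using p(3) n_pos by simp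
    qed
    then have "p = y" unfolding pi yl True by simp
    then show thesis using nn_neq[OF y(2)] y Fy by (intro that[of "[y]"]) auto
  next
    case False
    \<comment> \<open>The fourth corner of the square spanned by the two steps. Its energy exceeds
      that of \<open>p\<close> by the steep difference, which is negative, and a mixed term that is
      smaller in modulus.\<close>
    let ?z = "shift p l (s * 2 / real (N l))"
    have z: "?z \<in> grid a j n"
      and Fz: "real n * F ?z + real n * F t = real n * F p + real n * F y - 4 * r * s * a i * a l / real n"
      using free_energy_mixed[OF False t p(1)[unfolded pi] y(1)[unfolded yl]] unfolding pi yl by simp_all
    have rs: "r * s = 1 \<or> r * s = - 1" using r s by auto
    have "4 * r * s * a i * a l / real n = 4 * (r * s) * a i * a l / real n" by simp
    then have "real n * F ?z \<le> real n * F p" using aa[OF rs, of i l] Fz steep by linarith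
    then have Fz': "F ?z \<le> F t" using n_pos p(3) by simp
    have pz: "nn a j n p ?z" unfolding nn_iff using s by blast
    have zy: "?z = shift y i (r * 2 / real (N i))"
      unfolding pi yl using False by (auto simp: vec_eq_iff shift_def)
    have "nn a j n y ?z" unfolding zy nn_iff using r by blast
    then have "nn a j n ?z y" by (rule nn_sym)
    moreover have "?z \<noteq> t"
    proof
      assume "?z = t"
      then have "t $ l + s * 2 / real (N l) = t $ l" using False unfolding pi by (metis shift_nth)
      then show False using s size_pos[of l] by auto
    qed
    ultimately show thesis
      using that[of "[p, ?z, y]"] pz z p y Fy Fz' nn_neq[OF y(2)] nn_neq[OF p(2)] by auto
  qed
qed

end

section \<open>Paths, communication height and gates\<close>

lemma successively_imp_rtranclp:
  assumes "p \<noteq> []" "successively E p" "set p \<subseteq> S"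
  shows "(\<lambda>x y. E x y \<and> x \<in> S \<and> y \<in> S)\<^sup>*\<^sup>* (hd p) (last p)"
  using assms
proof (induction p rule: induct_list012)
  case (3 x y zs)
  then show ?case by (auto intro: converse_rtranclp_into_rtranclp)
qed auto

text \<open>Paths are joined and reversed as reachability inside a set of states and then turned
  back into lists.\<close>

lemma rtranclp_imp_successively:
  assumes "(\<lambda>x y. E x y \<and> x \<in> S \<and> y \<in> S)\<^sup>*\<^sup>* x y" "x \<in> S"
  shows "\<exists>p. p \<noteq> [] \<and> hd p = x \<and> last p = y \<and> successively E p \<and> set p \<subseteq> S"
  using assms
proof (induction rule: converse_rtranclp_induct)
  case base
  then show ?case by (intro exI[of _ "[y]"]) auto
next
  case (step x z)
  then obtain p where p: "p \<noteq> []" "hd p = z" "last p = y" "successively E p" "set p \<subseteq> S" by auto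
  then show ?case using step by (intro exI[of _ "x # p"]) (auto simp: successively_Cons)
qed

text \<open>If all values exceeded \<open>d\<close> in modulus, no step of size at most
  \<open>d\<close> could change the sign.\<close>

lemma discrete_crossing:
  fixes f :: "'a \<Rightarrow> real"
  assumes p: "successively (\<lambda>x y. \<bar>f x - f y\<bar> \<le> d) p" and "0 \<le> d"
    and "x \<in> set p" "0 \<le> f x" "y \<in> set p" "f y \<le> 0"
  shows "\<exists>z\<in>set p. \<bar>f z\<bar> \<le> d"
proof (rule ccontr)
  assume "\<not> ?thesis"
  then have far: "\<And>z. z \<in> set p \<Longrightarrow> d < \<bar>f z\<bar>" by auto
  have "(\<forall>z\<in>set p. 0 < f z) \<or> (\<forall>z\<in>set p. f z < 0)"
    using p far
  proof (induction p rule: induct_list012)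
    case (3 x y zs)
    have "d < \<bar>f x\<bar>" "d < \<bar>f y\<bar>" "\<bar>f x - f y\<bar> \<le> d" using 3 by auto
    then have "0 < f x \<longleftrightarrow> 0 < f y" "f x < 0 \<longleftrightarrow> f y < 0" by linarith+
    moreover have "(\<forall>z\<in>set (y # zs). 0 < f z) \<or> (\<forall>z\<in>set (y # zs). f z < 0)" using 3 by auto
    ultimately show ?case by auto
  next
    case (2 x)
    then show ?case using \<open>0 \<le> d\<close> by (cases "0 < f x") auto
  qed auto
  then show False using assms far[of x] far[of y] by fastforce
qed

context finite_volume
begin

lemma comm_height_le:
  assumes "is_path a j n A B p"
  shows "comm_height a \<beta> h j n A B \<le> path_height a \<beta> h j n p"
  unfolding comm_height_def
proof (rule Min_le)
  have "{path_height a \<beta> h j n p |p. is_path a j n A B p} \<subseteq> F ` grid a j n"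
  proof safe
    fix p assume "is_path a j n A B p"
    then have "p \<noteq> []" "set p \<subseteq> grid a j n" by (auto simp: is_path_def)
    moreover from this have "Max (F ` set p) \<in> F ` set p" by (intro Max_in) auto
    ultimately show "path_height a \<beta> h j n p \<in> F ` grid a j n"
      unfolding path_height_def by blast
  qed
  then show "finite {path_height a \<beta> h j n p |p. is_path a j n A B p}"
    by (rule finite_subset) (intro finite_imageI finite_grid)
qed (use assms in auto)

text \<open>Minimality of the gate means that the empty set is not met by all optimal paths, so an
  optimal path exists; its height is the energy of \<open>t\<close>.\<close>

lemma gate_singletonE:
  assumes "is_gate a \<beta> h j n {m} B {t}"
  obtains p where "is_path a j n {m} B p" "t \<in> set p" "\<And>z. z \<in> set p \<Longrightarrow> F z \<le> F t"
    "t \<in> grid a j n" "F t = comm_height a \<beta> h j n {m} B"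
    "\<And>p. optimal_path a \<beta> h j n {m} B p \<Longrightarrow> t \<in> set p"
proof -
  have t: "t \<in> grid a j n" "F t = comm_height a \<beta> h j n {m} B"
    and cr: "\<And>p. optimal_path a \<beta> h j n {m} B p \<Longrightarrow> t \<in> set p"
    using assms unfolding is_gate_def crossed_by_optimal_paths_def by auto
  have "\<not> crossed_by_optimal_paths a \<beta> h j n {m} B {}" using assms unfolding is_gate_def by auto
  then obtain p where p: "optimal_path a \<beta> h j n {m} B p"
    unfolding crossed_by_optimal_paths_def by auto
  have "F z \<le> F t" if "z \<in> set p" for z
  proof -
    have "F z \<le> Max (F ` set p)" using that by (intro Max_ge) auto
    then show ?thesis using p t(2) unfolding optimal_path_def path_height_def by simp
  qed
  then show thesis using that[of p] t cr p cr[OF p] unfolding optimal_path_def by auto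
qed

text \<open>If \<open>t\<close> had a steep neighbour \<open>y\<close>, the part of an optimal path
  from its first to its last visit to \<open>t\<close> could be replaced by detours through
  \<open>y\<close>, giving an optimal path that misses \<open>t\<close>. If \<open>t\<close> itself
  belongs to \<open>B\<close>, it is a local minimum.\<close>

theorem gate_point_almost_local_min:
  assumes A: "\<And>l. \<bar>a l\<bar> \<le> A" and gate: "is_gate a \<beta> h j n {m} B {t}"
    and B: "B \<subseteq> local_minima a \<beta> h j n" and "t \<noteq> m"
  shows "almost_local_min a \<beta> h j n (4 * A\<^sup>2) t"
proof (cases "t \<in> B")
  case True
  then show ?thesis using B by (intro local_minima_almost_local_min) auto
next
  case False
  obtain p where p: "is_path a j n {m} B p" "t \<in> set p" "\<And>z. z \<in> set p \<Longrightarrow> F z \<le> F t"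
    and t: "t \<in> grid a j n" "F t = comm_height a \<beta> h j n {m} B"
    and cr: "\<And>p. optimal_path a \<beta> h j n {m} B p \<Longrightarrow> t \<in> set p"
    using gate_singletonE[OF gate] by metis
  have pne: "p \<noteq> []" "set p \<subseteq> grid a j n" "successively (nn a j n) p" "hd p = m" "last p \<in> B"
    using p(1) unfolding is_path_def by auto
  show ?thesis
    unfolding almost_local_min_def
  proof (intro conjI ballI impI t(1) leI notI)
    fix y assume y: "y \<in> grid a j n" "nn a j n t y"
      and steep: "real n * F y + 4 * A\<^sup>2 / real n < real n * F t"
    define S where "S = {z \<in> grid a j n. F z \<le> F t \<and> z \<noteq> t}"
    let ?R = "\<lambda>x y. nn a j n x y \<and> x \<in> S \<and> y \<in> S"
    \<comment> \<open>The first and the last visit are taken, so that the outer pieces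
      \<open>p1\<close> and \<open>p4\<close> avoid \<open>t\<close>.\<close>
    obtain p1 p2 where p12: "p = p1 @ t # p2" "t \<notin> set p1" using split_list_first[OF p(2)] by auto
    obtain p3 p4 where p34: "p = p3 @ t # p4" "t \<notin> set p4" using split_list_last[OF p(2)] by auto
    have p1: "p1 \<noteq> []" using p12 pne \<open>t \<noteq> m\<close> by (cases p1) auto
    have p4: "p4 \<noteq> []" using p34 pne False by (cases p4) auto
    have s1: "successively (nn a j n) p1" "nn a j n (last p1) t"
      using pne(3) p1 unfolding p12(1) by (auto simp: successively_append_iff)
    have s4: "successively (nn a j n) p4" "nn a j n t (hd p4)"
      using pne(3) p4 unfolding p34(1) by (auto simp: successively_append_iff successively_Cons)
    have S1: "set p1 \<subseteq> S" using p12 p(3) pne(2) unfolding S_def by auto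
    have S4: "set p4 \<subseteq> S" using p34 p(3) pne(2) unfolding S_def by auto
    have m1: "?R\<^sup>*\<^sup>* m (last p1)"
      using successively_imp_rtranclp[OF p1 s1(1) S1] pne(4) p1 unfolding p12(1) by simp
    have m4: "?R\<^sup>*\<^sup>* (hd p4) (last p)"
      using successively_imp_rtranclp[OF p4 s4(1) S4] p4 unfolding p34(1) by simp
    have det: "?R\<^sup>*\<^sup>* u y" if u: "u \<in> S" "nn a j n t u" for u
    proof -
      obtain q where q: "q \<noteq> []" "hd q = u" "last q = y" "successively (nn a j n) q"
        "set q \<subseteq> grid a j n - {t}" "\<And>z. z \<in> set q \<Longrightarrow> F z \<le> F t"
        using detour[OF A t(1) y steep _ u(2)] u(1) unfolding S_def by blast
      have "set q \<subseteq> S" using q(5,6) unfolding S_def by auto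
      then show ?thesis using successively_imp_rtranclp[OF q(1,4)] q(2,3) by simp
    qed
    \<comment> \<open>Both neighbours of \<open>t\<close> on the path reach \<open>y\<close> by
      \<open>det\<close>; the second of these detours is traversed backwards.\<close>
    have sym: "?R\<^sup>*\<^sup>* v u" if "?R\<^sup>*\<^sup>* u v" for u v
      using that by (induction) (auto intro: converse_rtranclp_into_rtranclp nn_sym)
    have "last p1 \<in> S" "hd p4 \<in> S" using S1 S4 p1 p4 by auto
    then have conn: "?R\<^sup>*\<^sup>* m (last p)"
      using m1 det[OF _ nn_sym[OF s1(2)]] sym[OF det[OF _ s4(2)]] m4
      by (meson rtranclp_trans)
    have "m \<in> S" using S1 p1 pne(4) unfolding p12(1) by (cases p1) auto
    from rtranclp_imp_successively[OF conn this]
    obtain q where q: "q \<noteq> []" "hd q = m" "last q = last p" "successively (nn a j n) q" "set q \<subseteq> S"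
      by (elim exE conjE)
    then have path: "is_path a j n {m} B q"
      using pne(5) unfolding is_path_def S_def by auto
    have "path_height a \<beta> h j n q \<le> F t"
      unfolding path_height_def using q(1,5) by (intro Max.boundedI) (auto simp: S_def)
    then have "optimal_path a \<beta> h j n {m} B q"
      using comm_height_le[OF path] path t(2) unfolding optimal_path_def by simp
    then show False using cr q(5) unfolding S_def by auto
  qed
qed

lemma mag_nn:
  assumes A: "\<And>l. \<bar>a l\<bar> \<le> A" and "nn a j n x y"
  shows "\<bar>mag x - mag y\<bar> \<le> 2 * A / real n"
proof -
  obtain l s where "s = 1 \<or> s = - 1" and y: "y = shift x l (s * 2 / real (N l))"
    using assms(2) unfolding nn_iff by blast
  then have "\<bar>mag x - mag y\<bar> = 2 * \<bar>a l\<bar> / real n" unfolding y mag_shift by (auto simp: abs_mult)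
  also have "\<dots> \<le> 2 * A / real n" using A by (intro divide_right_mono) auto
  finally show ?thesis .
qed

lemma sum_size_le:
  assumes "inj a" shows "(\<Sum>l\<in>UNIV. N l) \<le> n"
proof -
  have "(\<Sum>l\<in>UNIV. N l) = card (\<Union>l\<in>UNIV. level_set a j n l)"
    unfolding class_size_def
    by (rule card_UN_disjoint[symmetric]) (use assms in \<open>auto simp: level_set_def inj_def\<close>)
  also have "\<dots> \<le> card {1..n}" by (rule card_mono) (auto simp: level_set_def)
  finally show ?thesis by simp
qed

text \<open>The magnetisation moves by at most \<open>2 * A / n\<close> per step, so a path between
  opposite signs visits a state where the interaction is of order \<open>1 / n\<close>. There the
  energy is bounded below by the maximal entropy, \<open>ln 2\<close> per site.\<close>

lemma gate_barrier:
  assumes A: "\<And>l. \<bar>a l\<bar> \<le> A" and "inj a" and h: "h = 0" and gate: "is_gate a \<beta> h j n {m} B {t}"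
    and opp: "mag m \<ge> 0 \<and> mag t \<le> 0 \<or> mag m \<le> 0 \<and> mag t \<ge> 0"
  shows "- 2 * A\<^sup>2 / real n - real n / \<beta> * ln 2 \<le> real n * F t"
proof -
  obtain p where p: "is_path a j n {m} B p" "t \<in> set p" "\<And>z. z \<in> set p \<Longrightarrow> F z \<le> F t"
    using gate_singletonE[OF gate] by metis
  have pm: "m \<in> set p" "set p \<subseteq> grid a j n" using p(1) unfolding is_path_def by auto
  have "successively (\<lambda>x y. \<bar>mag x - mag y\<bar> \<le> 2 * A / real n) p"
    using p(1) unfolding is_path_def by (auto elim!: successively_mono intro: mag_nn[OF A])
  moreover have "0 \<le> A" using A[of undefined] by linarith
  ultimately obtain z where z: "z \<in> set p" "\<bar>mag z\<bar> \<le> 2 * A / real n"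
    using discrete_crossing[of mag "2 * A / real n" p m t] discrete_crossing[of mag "2 * A / real n" p t m]
      opp p(2) pm(1) by auto
  have zg: "z \<in> grid a j n" using z pm by auto
  have "(mag z)\<^sup>2 \<le> (2 * A / real n)\<^sup>2" using z(2) by (metis abs_ge_zero power2_abs power_mono)
  then have "real n / 2 * (mag z)\<^sup>2 \<le> real n / 2 * (2 * A / real n)\<^sup>2" by (intro mult_left_mono) auto
  also have "\<dots> = 2 * A\<^sup>2 / real n" using n_pos by (simp add: power2_eq_square field_simps)
  finally have 1: "real n / 2 * (mag z)\<^sup>2 \<le> 2 * A\<^sup>2 / real n" .
  have site: "- (real (N l) * ln 2 / \<beta>) \<le> site l (z $ l)" for l
  proof -
    obtain i where i: "i \<le> N l" "z $ l = - 1 + 2 * real i / real (N l)" using gridE[OF zg] .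
    have "real (N l choose i) \<le> 2 ^ N l"
      using choose_row_sum[of "N l"] member_le_sum[of i "{..N l}" "\<lambda>i. N l choose i"] i(1)
      by (metis atMost_iff finite_atMost of_nat_le_iff of_nat_numeral of_nat_power zero_le)
    then have "ln (real (N l choose i)) \<le> real (N l) * ln 2"
      using i(1) by (subst ln_realpow[symmetric]) (auto simp: ln_le_cancel_iff)
    moreover have "site l (z $ l) = - h * real (N l) * (z $ l) - 1 / \<beta> * ln (real (N l choose i))"
      unfolding site_def i(2) floor_coordinate ..
    ultimately show ?thesis using beta_pos by (simp add: h divide_right_mono)
  qed
  have "(\<Sum>l\<in>UNIV. - (real (N l) * ln 2 / \<beta>)) \<le> (\<Sum>l\<in>UNIV. site l (z $ l))" by (intro sum_mono site)
  moreover have "(\<Sum>l\<in>UNIV. - (real (N l) * ln 2 / \<beta>)) = - (real (\<Sum>l\<in>UNIV. N l) * (ln 2 / \<beta>))"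
    by (simp add: sum_negf sum_distrib_right sum_divide_distrib)
  moreover have "real (\<Sum>l\<in>UNIV. N l) * (ln 2 / \<beta>) \<le> real n * (ln 2 / \<beta>)"
    using sum_size_le[OF \<open>inj a\<close>] beta_pos by (intro mult_right_mono) (auto simp del: of_nat_sum)
  ultimately have "- (2 * A\<^sup>2 / real n) - real n * (ln 2 / \<beta>) \<le> real n * F z"
    unfolding free_energy_n_eq[OF zg] using 1 by linarith
  also have "\<dots> \<le> real n * F t" using p(3)[OF z(1)] by (intro mult_left_mono) auto
  finally show ?thesis by simp
qed

section \<open>Mean-field equation at almost local minima\<close>

lemma shift_grid:
  assumes x: "x \<in> grid a j n" and i: "x $ l = - 1 + 2 * real i / real (N l)"
    and k: "k \<le> N l" "real k = real i + s"
  shows "shift x l (s * 2 / real (N l)) \<in> grid a j n"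
  unfolding grid_def
proof (intro CollectI allI)
  fix l'
  show "\<exists>i\<le>N l'. shift x l (s * 2 / real (N l)) $ l' = - 1 + 2 * real i / real (N l')"
  proof (cases "l' = l")
    case True
    then show ?thesis using k i by (intro exI[of _ k]) (auto simp: add_divide_distrib ring_distribs)
  next
    case False
    then show ?thesis using x unfolding grid_def by auto
  qed
qed

lemma ln_binomial_Suc:
  assumes "i < M"
  shows "ln (real (M choose Suc i)) = ln (real (M choose i)) + ln (real (M - i)) - ln (real (Suc i))"
proof -
  have "real (Suc i) * real (M choose Suc i) = real (M - i) * real (M choose i)"
    by (metis binomial_absorb_comp binomial_absorption of_nat_mult mult.commute)
  then have "ln (real (Suc i) * real (M choose Suc i)) = ln (real (M - i) * real (M choose i))" by simp
  then show ?thesis using assms by (subst (asm) (1 2) ln_mult_pos) auto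
qed

text \<open>Comparison with the neighbours above and below in coordinate \<open>l\<close> traps
  \<open>ln i - ln k\<close>, which is twice the inverse hyperbolic tangent of \<open>x $ l\<close>,
  within order \<open>1 / n\<close> of \<open>2 * \<beta> * (a l * mag x + h)\<close>. The distance
  \<delta> from the faces of the cube keeps both counts \<open>i\<close> and \<open>k\<close> of
  order \<open>n\<close>.\<close>

lemma almost_local_min_tanh:
  assumes x: "almost_local_min a \<beta> h j n \<kappa> x" and \<delta>: "0 < \<delta>" "\<bar>x $ l\<bar> \<le> 1 - \<delta>"
    and w: "0 < v" "v * real n \<le> real (N l)"
  shows "\<bar>x $ l - tanh (\<beta> * (a l * mag x + h))\<bar> \<le> (\<beta> * \<kappa> / 2 + 1 / (v * \<delta>)) / real n"
proof -
  let ?M = "real (N l)"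
  have xg: "x \<in> grid a j n" using x unfolding almost_local_min_def by auto
  obtain i where i: "i \<le> N l" "x $ l = - 1 + 2 * real i / ?M" using gridE[OF xg] .
  have M: "0 < ?M" using size_pos by simp
  have nr: "0 < real n" using n_pos by simp
  define k where "k = N l - i"
  have k: "real k = ?M - real i" using i(1) unfolding k_def by simp
  have ib: "\<delta> * ?M / 2 \<le> real i" "\<delta> * ?M / 2 \<le> real k"
  proof -
    have "- 1 + \<delta> \<le> x $ l" "x $ l \<le> 1 - \<delta>" using \<delta> by auto
    then have "\<delta> * ?M \<le> 2 * real i / ?M * ?M" "2 * real i / ?M * ?M \<le> (2 - \<delta>) * ?M"
      unfolding i(2) using M by (intro mult_right_mono; simp)+
    then show "\<delta> * ?M / 2 \<le> real i" "\<delta> * ?M / 2 \<le> real k" unfolding k using M by (auto simp: algebra_simps)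
  qed
  have dM: "0 < \<delta> * ?M / 2" using \<delta> M by simp
  have ip: "0 < real i" "0 < real k" using ib dM by linarith+
  have inv: "1 / real i \<le> 2 / (v * \<delta>) / real n" "1 / real k \<le> 2 / (v * \<delta>) / real n"
  proof -
    have "v * \<delta> * real n / 2 \<le> \<delta> * ?M / 2" using mult_left_mono[OF w(2), of "\<delta>"] \<delta> by (simp add: mult_ac)
    then have b: "v * \<delta> * real n / 2 \<le> real i" "v * \<delta> * real n / 2 \<le> real k" using ib by linarith+
    have p: "0 < v * \<delta> * real n / 2" using w \<delta> nr by simp
    have "1 / real i \<le> 1 / (v * \<delta> * real n / 2)" "1 / real k \<le> 1 / (v * \<delta> * real n / 2)"
      by (intro divide_left_mono b mult_pos_pos p ip; simp)+
    then show "1 / real i \<le> 2 / (v * \<delta>) / real n" "1 / real k \<le> 2 / (v * \<delta>) / real n" by simp_all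
  qed
  define c where "c = a l * mag x + h"
  define z where "z = ln (real i) - ln (real k)"
  have sx: "site l (x $ l) = - h * ?M * (x $ l) - 1 / \<beta> * ln (real (N l choose i))"
    unfolding site_def i(2) floor_coordinate ..
  \<comment> \<open>The self-interaction \<open>q\<close> of size
    \<open>2 * (a l)\<^sup>2 / n\<close> has the favourable sign in both comparisons.\<close>
  have alg: "- r \<le> - 2 * c - q - b * (y - y') \<Longrightarrow> 0 \<le> q \<Longrightarrow> 2 * c - r \<le> b * (y' - y)"
    "- r \<le> 2 * c - q + b * (y - y') \<Longrightarrow> 0 \<le> q \<Longrightarrow> b * (y' - y) \<le> 2 * c + r" for r q b y y' :: real
    by (simp_all add: algebra_simps)
  have up: "2 * \<beta> * c - \<beta> * \<kappa> / real n - 1 / real i \<le> z"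
  proof -
    have lt: "i < N l" using ip k by linarith
    let ?y = "shift x l (1 * 2 / ?M)"
    have yg: "?y \<in> grid a j n" by (rule shift_grid[OF xg i(2), of "Suc i"]) (use lt in auto)
    have yl: "x $ l + 1 * 2 / ?M = - 1 + 2 * real (Suc i) / ?M" unfolding i(2) by (simp add: add_divide_distrib)
    have "real n * F x \<le> real n * F ?y + \<kappa> / real n"
      using x yg unfolding almost_local_min_def nn_iff by blast
    then have "- (\<kappa> / real n) \<le> - 2 * a l * mag x - 2 * (a l)\<^sup>2 / real n + (site l (x $ l + 1 * 2 / ?M) - site l (x $ l))"
      using free_energy_step[OF xg yg] by simp
    also have "site l (x $ l + 1 * 2 / ?M) = - h * ?M * (x $ l + 1 * 2 / ?M) - 1 / \<beta> * ln (real (N l choose Suc i))"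
      unfolding site_def yl floor_coordinate ..
    finally have "- (\<kappa> / real n) \<le> - 2 * c - 2 * (a l)\<^sup>2 / real n - 1 / \<beta> * (ln (real k) - ln (real (Suc i)))"
      unfolding sx ln_binomial_Suc[OF lt] k_def c_def using M by (simp add: algebra_simps)
    then have "2 * c - \<kappa> / real n \<le> 1 / \<beta> * (ln (real (Suc i)) - ln (real k))" by (rule alg(1)) simp
    then have "\<beta> * (2 * c - \<kappa> / real n) \<le> ln (real (Suc i)) - ln (real k)"
      using beta_pos by (simp add: field_simps)
    moreover have "ln (real (Suc i)) \<le> ln (real i) + 1 / real i"
    proof -
      have "ln (real (Suc i)) = ln (real i * (1 + 1 / real i))" using ip by (simp add: algebra_simps)
      also have "\<dots> = ln (real i) + ln (1 + 1 / real i)" using ip by (intro ln_mult_pos) (auto intro: add_pos_pos)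
      also have "ln (1 + 1 / real i) \<le> 1 / real i" by (rule ln_add_one_self_le_self) simp
      finally show ?thesis by simp
    qed
    ultimately show ?thesis unfolding z_def by (simp add: algebra_simps)
  qed
  have lo: "z \<le> 2 * \<beta> * c + \<beta> * \<kappa> / real n + 1 / real k"
  proof -
    obtain i' where i': "i = Suc i'" using ip by (cases i) auto
    have lt: "i' < N l" using i(1) i' by simp
    have k': "N l - i' = Suc k" using i(1) i' unfolding k_def by simp
    let ?y = "shift x l (- 1 * 2 / ?M)"
    have yg: "?y \<in> grid a j n" by (rule shift_grid[OF xg i(2), of i']) (use lt i' in auto)
    have yl: "x $ l + - 1 * 2 / ?M = - 1 + 2 * real i' / ?M" unfolding i(2) i' by (simp add: add_divide_distrib)
    have "real n * F x \<le> real n * F ?y + \<kappa> / real n"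
      using x yg unfolding almost_local_min_def nn_iff by blast
    then have "- (\<kappa> / real n) \<le> 2 * a l * mag x - 2 * (a l)\<^sup>2 / real n + (site l (x $ l + - 1 * 2 / ?M) - site l (x $ l))"
      using free_energy_step[OF xg yg] by simp
    also have "site l (x $ l + - 1 * 2 / ?M) = - h * ?M * (x $ l + - 1 * 2 / ?M) - 1 / \<beta> * ln (real (N l choose i'))"
      unfolding site_def yl floor_coordinate ..
    finally have "- (\<kappa> / real n) \<le> 2 * c - 2 * (a l)\<^sup>2 / real n + 1 / \<beta> * (ln (real (Suc k)) - ln (real i))"
      unfolding sx i' ln_binomial_Suc[OF lt] k' c_def using M by (simp add: algebra_simps)
    then have "1 / \<beta> * (ln (real i) - ln (real (Suc k))) \<le> 2 * c + \<kappa> / real n" by (rule alg(2)) simp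
    then have "ln (real i) - ln (real (Suc k)) \<le> \<beta> * (2 * c + \<kappa> / real n)"
      using beta_pos by (simp add: field_simps)
    moreover have "ln (real (Suc k)) \<le> ln (real k) + 1 / real k"
    proof -
      have "ln (real (Suc k)) = ln (real k * (1 + 1 / real k))" using ip by (simp add: algebra_simps)
      also have "\<dots> = ln (real k) + ln (1 + 1 / real k)" using ip by (intro ln_mult_pos) (auto intro: add_pos_pos)
      also have "ln (1 + 1 / real k) \<le> 1 / real k" by (rule ln_add_one_self_le_self) simp
      finally show ?thesis by simp
    qed
    ultimately show ?thesis unfolding z_def by (simp add: algebra_simps)
  qed
  have "tanh (z / 2) = x $ l"
  proof -
    have "- 2 * (z / 2) = ln (real k) - ln (real i)" by (simp add: z_def)
    then have "exp (- 2 * (z / 2)) = real k / real i" using ip by (simp only: exp_diff exp_ln)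
    then have "tanh (z / 2) = (1 - real k / real i) / (1 + real k / real i)"
      unfolding tanh_real_altdef by simp
    also have "\<dots> = ((real i - real k) / real i) / ((real i + real k) / real i)"
      using ip by (simp add: diff_divide_distrib add_divide_distrib)
    also have "\<dots> = (real i - real k) / (real i + real k)" using ip by simp
    also have "\<dots> = x $ l" unfolding i(2) k using M by (simp add: field_simps)
    finally show ?thesis .
  qed
  then have "\<bar>x $ l - tanh (\<beta> * c)\<bar> \<le> \<bar>z / 2 - \<beta> * c\<bar>" using tanh_lipschitz[of "z / 2" "\<beta> * c"] by simp
  also have "\<dots> \<le> \<beta> * \<kappa> / 2 / real n + 1 / (v * \<delta>) / real n"
    using up lo inv by (simp add: abs_le_iff)
  also have "\<dots> = (\<beta> * \<kappa> / 2 + 1 / (v * \<delta>)) / real n" by (simp add: add_divide_distrib)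
  finally show ?thesis unfolding c_def .
qed

end

section \<open>Critical points of the limiting free energy\<close>

lemma tanh_half_ln:
  fixes x :: real
  assumes "\<bar>x\<bar> < 1"
  shows "tanh ((ln (1 + x) - ln (1 - x)) / 2) = x"
proof -
  have p: "0 < 1 + x" "0 < 1 - x" using assms by auto
  have "- 2 * ((ln (1 + x) - ln (1 - x)) / 2) = ln (1 - x) - ln (1 + x)" by simp
  then have "exp (- 2 * ((ln (1 + x) - ln (1 - x)) / 2)) = (1 - x) / (1 + x)"
    using p by (simp only: exp_diff exp_ln)
  then have "tanh ((ln (1 + x) - ln (1 - x)) / 2) = (1 - (1 - x) / (1 + x)) / (1 + (1 - x) / (1 + x))"
    unfolding tanh_real_altdef by (simp only:)
  also have "\<dots> = ((2 * x) / (1 + x)) / (2 / (1 + x))" using p by (simp add: field_simps)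
  also have "\<dots> = x" using p by simp
  finally show ?thesis .
qed

lemma has_derivative_cramer_entropy:
  assumes "\<bar>x\<bar> < 1"
  shows "(cramer_entropy has_real_derivative (ln (1 + x) - ln (1 - x)) / 2) (at x)"
proof -
  have p: "0 < 1 + x" "0 < 1 - x" using assms by auto
  have k: "((\<lambda>y. y * ln y) has_real_derivative ln y + 1) (at y)" if "0 < y" for y :: real
    using that by (auto intro!: derivative_eq_intros)
  have "((\<lambda>x. (1 - x) / 2 * ln ((1 - x) / 2)) has_real_derivative (ln ((1 - x) / 2) + 1) * (- 1 / 2)) (at x)"
    by (rule DERIV_chain2[OF k]) (use p in \<open>auto intro!: derivative_eq_intros\<close>)
  moreover have "((\<lambda>x. (1 + x) / 2 * ln ((1 + x) / 2)) has_real_derivative (ln ((1 + x) / 2) + 1) * (1 / 2)) (at x)"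
    by (rule DERIV_chain2[OF k]) (use p in \<open>auto intro!: derivative_eq_intros\<close>)
  ultimately have "(cramer_entropy has_real_derivative
      (ln ((1 - x) / 2) + 1) * (- 1 / 2) + (ln ((1 + x) / 2) + 1) * (1 / 2)) (at x)"
    unfolding cramer_entropy_def[abs_def] by (rule DERIV_add)
  also have "(ln ((1 - x) / 2) + 1) * (- 1 / 2) + (ln ((1 + x) / 2) + 1) * (1 / 2) = (ln (1 + x) - ln (1 - x)) / 2"
  proof -
    have "ln ((1 - x) / 2) = ln (1 - x) - ln 2" "ln ((1 + x) / 2) = ln (1 + x) - ln 2"
      using p ln_div[of "1 - x" 2] ln_div[of "1 + x" 2] by auto
    then show ?thesis by (simp only:) (simp add: field_simps)
  qed
  finally show ?thesis .
qed

text \<open>Legendre duality between the entropy and \<open>ln (2 * cosh u)\<close>, whose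
  derivative \<open>tanh\<close> links the dual variables.\<close>

lemma cramer_entropy_tanh: "cramer_entropy (tanh u) = u * tanh u - ln (2 * cosh u)"
proof -
  have c: "0 < cosh u" by simp
  have e: "(1 - tanh u) / 2 = exp (- u) / (2 * cosh u)" "(1 + tanh u) / 2 = exp u / (2 * cosh u)"
    using c unfolding tanh_def by (simp_all add: field_simps cosh_minus_sinh cosh_plus_sinh flip: cosh_minus_sinh cosh_plus_sinh)
  have l: "ln ((1 - tanh u) / 2) = - u - ln (2 * cosh u)" "ln ((1 + tanh u) / 2) = u - ln (2 * cosh u)"
    unfolding e using c by (simp_all add: ln_div)
  show ?thesis unfolding cramer_entropy_def l by (simp add: diff_divide_distrib add_divide_distrib algebra_simps)
qed

text \<open>The derivative along a coordinate axis, with the positive weight \<open>w l\<close>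
  cancelled. The second form is kept as well because its left side is the slope of the
  entropy.\<close>

lemma critical_point_tanh:
  fixes a w :: "'k::finite \<Rightarrow> real"
  assumes m: "m \<in> critical_points a w \<beta> h" and \<beta>: "0 < \<beta>" and w: "0 < w l"
  shows "m $ l = tanh (\<beta> * (a l * (\<Sum>i\<in>UNIV. a i * w i * m $ i) + h))"
    and "(ln (1 + m $ l) - ln (1 - m $ l)) / 2 = \<beta> * (a l * (\<Sum>i\<in>UNIV. a i * w i * m $ i) + h)"
proof -
  define K where "K = (\<Sum>i\<in>UNIV. a i * w i * m $ i)"
  define S where "S = (\<Sum>i\<in>UNIV. w i * m $ i)"
  define E where "E = (\<Sum>i\<in>UNIV. w i * cramer_entropy (m $ i))"
  have ml: "\<bar>m $ l\<bar> < 1" using m by (auto simp: critical_points_def)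
  define g where "g s = m + s *\<^sub>R axis l 1" for s :: real
  have gi: "g s $ i = (if i = l then m $ l + s else m $ i)" for s i
    by (auto simp: g_def axis_def)
  \<comment> \<open>Along the axis only the summand of class \<open>l\<close> varies.\<close>
  have sums: "(\<Sum>i\<in>UNIV. f i (g s $ i)) = (\<Sum>i\<in>UNIV. f i (m $ i)) + (f l (m $ l + s) - f l (m $ l))"
    for f :: "'k \<Rightarrow> real \<Rightarrow> real" and s
  proof -
    have "(\<Sum>i\<in>UNIV. f i (g s $ i)) = (\<Sum>i\<in>UNIV. f i (m $ i) + (if i = l then f l (m $ l + s) - f l (m $ l) else 0))"
      by (intro sum.cong refl) (auto simp: gi)
    then show ?thesis by (simp add: sum.distrib)
  qed
  have eq: "free_energy a w \<beta> h (g s) = - (1 / 2) * (K + a l * w l * s)\<^sup>2 - h * (S + w l * s)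
      + 1 / \<beta> * (E + w l * (cramer_entropy (m $ l + s) - cramer_entropy (m $ l)))" for s
    unfolding free_energy_def sums[of "\<lambda>i y. a i * w i * y"] sums[of "\<lambda>i y. w i * y"]
      sums[of "\<lambda>i y. w i * cramer_entropy y"] K_def[symmetric] S_def[symmetric] E_def[symmetric]
    by (simp add: algebra_simps)
  have "(free_energy a w \<beta> h has_derivative (\<lambda>_. 0)) (at (g 0))"
    using m by (simp add: critical_points_def g_def)
  moreover have "(g has_derivative (\<lambda>s. s *\<^sub>R axis l 1)) (at 0)"
    unfolding g_def[abs_def] by (auto intro!: derivative_eq_intros)
  ultimately have "((\<lambda>s. free_energy a w \<beta> h (g s)) has_derivative (\<lambda>_. 0)) (at 0)"
    using has_derivative_compose[of g "\<lambda>s. s *\<^sub>R axis l 1" 0 UNIV "free_energy a w \<beta> h" "\<lambda>_. 0"] by simp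
  then have d0: "((\<lambda>s. free_energy a w \<beta> h (g s)) has_real_derivative 0) (at 0)"
    unfolding has_field_derivative_def by (rule has_derivative_eq_rhs) auto
  have dI: "((\<lambda>s. cramer_entropy (m $ l + s)) has_real_derivative (ln (1 + m $ l) - ln (1 - m $ l)) / 2) (at 0)"
    using has_derivative_cramer_entropy[OF ml] DERIV_shift[of cramer_entropy _ 0 "m $ l"] by (simp add: add.commute)
  have "((\<lambda>s. free_energy a w \<beta> h (g s)) has_real_derivative
      (- (K * (a l * w l)) - h * w l + 1 / \<beta> * (w l * ((ln (1 + m $ l) - ln (1 - m $ l)) / 2)))) (at 0)"
    unfolding eq using \<beta> by (auto intro!: derivative_eq_intros dI simp: mult_ac)
  from DERIV_unique[OF d0 this]
  have "w l * (1 / \<beta> * ((ln (1 + m $ l) - ln (1 - m $ l)) / 2) - (a l * K + h)) = 0"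
    by (simp add: algebra_simps)
  then have "(ln (1 + m $ l) - ln (1 - m $ l)) / 2 = \<beta> * (a l * K + h)"
  proof -
    assume "w l * (1 / \<beta> * ((ln (1 + m $ l) - ln (1 - m $ l)) / 2) - (a l * K + h)) = 0"
    then have "1 / \<beta> * ((ln (1 + m $ l) - ln (1 - m $ l)) / 2) = a l * K + h" using w by simp
    then show ?thesis using \<beta> by (simp add: field_simps)
  qed
  then show "(ln (1 + m $ l) - ln (1 - m $ l)) / 2 = \<beta> * (a l * (\<Sum>i\<in>UNIV. a i * w i * m $ i) + h)"
    and "m $ l = tanh (\<beta> * (a l * (\<Sum>i\<in>UNIV. a i * w i * m $ i) + h))"
    using tanh_half_ln[OF ml] unfolding K_def by simp_all
qed

section \<open>Inequalities for \<open>tanh\<close> and \<open>ln cosh\<close>, and the positions of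
  fixed points\<close>

lemma tanh_gt_slope:
  fixes u :: real assumes "0 < u" shows "u * (1 - (tanh u)\<^sup>2) < tanh u"
proof -
  have "(\<lambda>u::real. tanh u - u * (1 - (tanh u)\<^sup>2)) 0 < (\<lambda>u. tanh u - u * (1 - (tanh u)\<^sup>2)) u"
  proof (rule DERIV_pos_imp_increasing_open[OF assms])
    fix x :: real assume x: "0 < x"
    have "\<bar>tanh x\<bar> < 1" using tanh_real_bounds[of x] by auto
    then have "0 < 1 - (tanh x)\<^sup>2" using abs_square_less_1 by auto
    then have "0 < x * (2 * (tanh x * (1 - (tanh x)\<^sup>2)))" using x by simp
    moreover have "((\<lambda>u. tanh u - u * (1 - (tanh u)\<^sup>2)) has_real_derivative x * (2 * (tanh x * (1 - (tanh x)\<^sup>2)))) (at x)"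
      by (auto intro!: derivative_eq_intros)
    ultimately show "\<exists>y. ((\<lambda>u. tanh u - u * (1 - (tanh u)\<^sup>2)) has_real_derivative y) (at x) \<and> 0 < y" by blast
  qed (intro continuous_intros; simp)
  then show ?thesis by simp
qed

text \<open>Strict concavity of \<open>tanh\<close> on the positive half line: the slope of the
  chord from the origin decreases.\<close>

lemma tanh_ratio_decreasing:
  fixes u v :: real assumes "0 < u" "u < v" shows "u * tanh v < v * tanh u"
proof -
  have "(\<lambda>v. v * tanh u - u * tanh v) u < (\<lambda>v. v * tanh u - u * tanh v) v"
  proof (rule DERIV_pos_imp_increasing_open[OF assms(2)])
    fix x :: real assume x: "u < x"
    have "(tanh u)\<^sup>2 \<le> (tanh x)\<^sup>2" using x assms by (intro power_mono) auto
    then have "u * (1 - (tanh x)\<^sup>2) \<le> u * (1 - (tanh u)\<^sup>2)" using assms by (intro mult_left_mono) auto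
    then have "0 < tanh u - u * (1 - (tanh x)\<^sup>2)" using tanh_gt_slope[OF assms(1)] by linarith
    moreover have "((\<lambda>v. v * tanh u - u * tanh v) has_real_derivative tanh u - u * (1 - (tanh x)\<^sup>2)) (at x)"
      by (auto intro!: derivative_eq_intros)
    ultimately show "\<exists>y. ((\<lambda>v. v * tanh u - u * tanh v) has_real_derivative y) (at x) \<and> 0 < y" by blast
  qed (intro continuous_intros; simp)
  then show ?thesis by simp
qed

lemma has_derivative_ln_cosh: "((\<lambda>x. ln (cosh x)) has_real_derivative tanh x) (at x)" for x :: real
  by (auto intro!: derivative_eq_intros simp: tanh_def)

lemma ln_cosh_abs: "ln (cosh \<bar>x\<bar>) = ln (cosh x)" for x :: real
  by (cases "0 \<le> x") auto

lemma ln_cosh_less: "\<bar>x\<bar> < \<bar>y\<bar> \<Longrightarrow> ln (cosh x) < ln (cosh y)" for x y :: real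
proof -
  assume "\<bar>x\<bar> < \<bar>y\<bar>"
  then have "cosh \<bar>x\<bar> < cosh \<bar>y\<bar>" by (intro cosh_real_strict_mono) auto
  then show ?thesis by simp
qed

text \<open>The difference has the derivative
  \<open>(tanh y - y * (1 - (tanh y)\<^sup>2)) / 2\<close>, positive by concavity of
  \<open>tanh\<close>; evenness covers negative arguments. It decides the energy comparison at zero
  field.\<close>

lemma ln_cosh_gt_half:
  fixes x :: real assumes "x \<noteq> 0" shows "x * tanh x / 2 < ln (cosh x)"
proof -
  have *: "x * tanh x / 2 < ln (cosh x)" if x: "0 < x" for x :: real
  proof -
    have "(\<lambda>x::real. ln (cosh x) - x * tanh x / 2) 0 < (\<lambda>x. ln (cosh x) - x * tanh x / 2) x"
    proof (rule DERIV_pos_imp_increasing_open[OF x])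
      fix y :: real assume y: "0 < y"
      have "((\<lambda>x. ln (cosh x) - x * tanh x / 2) has_real_derivative (tanh y - y * (1 - (tanh y)\<^sup>2)) / 2) (at y)"
      proof -
        have "((\<lambda>x. x * tanh x) has_real_derivative (tanh y + y * (1 - (tanh y)\<^sup>2))) (at y)"
          by (auto intro!: derivative_eq_intros)
        from DERIV_diff[OF has_derivative_ln_cosh DERIV_cdivide[OF this]] show ?thesis
          by (rule DERIV_cong) (simp add: field_simps)
      qed
      then show "\<exists>d. ((\<lambda>x. ln (cosh x) - x * tanh x / 2) has_real_derivative d) (at y) \<and> 0 < d"
        using tanh_gt_slope[OF y] by (intro exI conjI) auto
    qed (intro continuous_intros; simp)
    then show ?thesis by simp
  qed
  show ?thesis using *[of "\<bar>x\<bar>"] assms by (simp add: abs_mult[symmetric] ln_cosh_abs)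
qed

text \<open>Cross-multiplied monotonicity: \<open>tanh (\<beta> * (c * p + h)) / p\<close> decreases
  strictly in \<open>p\<close>, to which a non-negative field only contributes. Summed over the
  classes it forbids two positive fixed points of \<open>T_map\<close>.\<close>

lemma fixed_point_ratio:
  fixes p q c h \<beta> :: real
  assumes "0 < p" "p < q" "0 < c" "0 \<le> h" "0 < \<beta>"
  shows "p * tanh (\<beta> * (c * q + h)) < q * tanh (\<beta> * (c * p + h))"
proof -
  define u v where "u = \<beta> * (c * p + h)" and "v = \<beta> * (c * q + h)"
  have u: "0 < u" unfolding u_def using assms by (intro mult_pos_pos add_pos_nonneg) auto
  have uv: "u < v" unfolding u_def v_def using assms by simp
  have "p * h \<le> q * h" using assms by (intro mult_right_mono) auto
  then have "p * (c * q + h) \<le> q * (c * p + h)" by (simp add: algebra_simps)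
  then have "\<beta> * (p * (c * q + h)) \<le> \<beta> * (q * (c * p + h))" using assms by (intro mult_left_mono) auto
  then have pq: "p * v \<le> q * u" unfolding u_def v_def by (simp add: algebra_simps)
  have "u * (p * tanh v) = p * (u * tanh v)" by simp
  also have "\<dots> < p * (v * tanh u)" using tanh_ratio_decreasing[OF u uv] assms by (intro mult_strict_left_mono) auto
  also have "\<dots> = (p * v) * tanh u" by simp
  also have "\<dots> \<le> (q * u) * tanh u" using pq u by (intro mult_right_mono) auto
  also have "\<dots> = u * (q * tanh u)" by simp
  finally show ?thesis using u unfolding u_def[symmetric] v_def[symmetric] by simp
qed

lemma T_map_minus:
  "T_map a w \<beta> h (- s) = - (\<Sum>l\<in>UNIV. a l * w l * tanh (\<beta> * (a l * s - h)))"
proof -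
  have "tanh (\<beta> * (a l * (- s) + h)) = - tanh (\<beta> * (a l * s - h))" for l
    by (metis (no_types, lifting) add.commute minus_diff_eq mult_minus_right tanh_minus uminus_add_conv_diff)
  then show ?thesis unfolding T_map_def by (simp add: sum_negf)
qed

text \<open>The variance of the Gaussian fluctuations vanishes iff this difference, the derivative of
  \<open>F(t) - F(m)\<close> in the direction of \<open>\<omega>\<^sub>l\<close> up to a factor, does not depend on the class.\<close>

definition profile :: "real \<Rightarrow> real \<Rightarrow> real \<Rightarrow> real \<Rightarrow> real \<Rightarrow> real" where
  "profile \<beta> h x y c = ln (cosh (\<beta> * (c * y + h))) - ln (cosh (\<beta> * (c * x + h)))"

lemma has_derivative_profile:
  "(profile \<beta> h x y has_real_derivative
     \<beta> * (y * tanh (\<beta> * (c * y + h)) - x * tanh (\<beta> * (c * x + h)))) (at c)"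
proof -
  have d: "((\<lambda>c. ln (cosh (\<beta> * (c * z + h)))) has_real_derivative tanh (\<beta> * (c * z + h)) * (\<beta> * z)) (at c)" for z
    by (rule DERIV_chain2[OF has_derivative_ln_cosh]) (auto intro!: derivative_eq_intros)
  show ?thesis
    unfolding profile_def[abs_def] by (rule DERIV_cong[OF DERIV_diff[OF d d]]) (simp add: algebra_simps)
qed

lemma continuous_profile: "continuous_on A (profile \<beta> h x y)"
  using has_derivative_profile DERIV_isCont by (blast intro: continuous_at_imp_continuous_on)

text \<open>The derivative in the coupling compares the values of
  \<open>z * tanh (\<beta> * (c * z + h))\<close> at \<open>y\<close> and \<open>x\<close>. With a
  non-negative field the positive point, being farther from zero, wins.\<close>

lemma profile_strict_mono:
  fixes \<beta> h x y b c :: real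
  assumes \<beta>: "0 < \<beta>" and h: "0 \<le> h" and y: "0 < y" and xy: "x \<le> 0" "- x < y" and bc: "0 \<le> b" "b < c"
  shows "profile \<beta> h x y b < profile \<beta> h x y c"
proof (rule DERIV_pos_imp_increasing_open[OF bc(2) _ continuous_profile])
  fix e assume "b < e"
  then have e: "0 < e" using bc by simp
  define s where "s = - x"
  have s: "0 \<le> s" "s < y" using xy by (auto simp: s_def)
  have arg: "0 < \<beta> * (e * y + h)" using \<beta> e y h by (intro mult_pos_pos add_pos_nonneg) auto
  have ey: "0 < tanh (\<beta> * (e * y + h))" using arg by simp
  have le: "\<beta> * (e * s - h) \<le> \<beta> * (e * y + h)"
  proof (rule mult_left_mono)
    have "e * s \<le> e * y" using e s by (intro mult_left_mono) auto
    then show "e * s - h \<le> e * y + h" using h by linarith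
  qed (use \<beta> in simp)
  have "s * tanh (\<beta> * (e * s - h)) \<le> s * tanh (\<beta> * (e * y + h))"
    using le s by (intro mult_left_mono) auto
  also have "\<dots> < y * tanh (\<beta> * (e * y + h))" using ey s by (intro mult_strict_right_mono) auto
  finally have 1: "s * tanh (\<beta> * (e * s - h)) < y * tanh (\<beta> * (e * y + h))" .
  have "x * tanh (\<beta> * (e * x + h)) = s * tanh (\<beta> * (e * s - h))"
  proof -
    have "\<beta> * (e * x + h) = - (\<beta> * (e * s - h))" by (simp add: s_def algebra_simps)
    then show ?thesis by (simp only: tanh_minus) (simp add: s_def)
  qed
  then have "0 < \<beta> * (y * tanh (\<beta> * (e * y + h)) - x * tanh (\<beta> * (e * x + h)))" using 1 \<beta> by simp
  then show "\<exists>d. (profile \<beta> h x y has_real_derivative d) (at e) \<and> 0 < d"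
    using has_derivative_profile by blast
qed

text \<open>Sign analysis of the two fixed points. If the larger one is positive, the other is
  non-positive and closer to zero, and the profile increases strictly. If both are non-positive and
  the field is positive, it decreases strictly from the smallest class on. At zero field oddness
  reduces the latter case to the former. In the excluded symmetric case the profile vanishes
  identically.\<close>

lemma profile_nonconstant:
  fixes a w :: "'k::finite \<Rightarrow> real"
  assumes \<beta>: "0 < \<beta>" and h: "0 \<le> h" and a: "inj a" "\<And>l. 0 \<le> a l" and w: "\<And>l. 0 < w l"
    and two: "l1 \<noteq> (l2 :: 'k)"
    and x: "T_map a w \<beta> h x = x" and y: "T_map a w \<beta> h y = y" and neq: "x \<noteq> y"
    and sym: "\<not> (h = 0 \<and> x = - y)"
  shows "\<not> (\<forall>l. profile \<beta> h x y (a l) = c)"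
proof -
  obtain l0 where l0: "0 < a l0"
  proof -
    have "a l1 \<noteq> a l2" using a(1) two by (auto dest: injD)
    then have "0 < a l1 \<or> 0 < a l2" using a(2)[of l1] a(2)[of l2] by auto
    then show thesis using that by auto
  qed
  have sum_less: "(\<Sum>l\<in>UNIV. a l * w l * f l) < (\<Sum>l\<in>UNIV. a l * w l * g l)"
    if "\<And>l. 0 < a l \<Longrightarrow> f l < g l" for f g :: "'k \<Rightarrow> real"
  proof (rule sum_strict_mono_ex1)
    show "\<forall>l\<in>UNIV. a l * w l * f l \<le> a l * w l * g l"
    proof
      fix l show "a l * w l * f l \<le> a l * w l * g l"
        using that[of l] a(2)[of l] w[of l] by (cases "a l = 0") (auto intro!: mult_left_mono less_imp_le)
    qed
    show "\<exists>l\<in>UNIV. a l * w l * f l < a l * w l * g l"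
      using that[OF l0] l0 w[of l0] by (intro bexI[of _ l0] mult_strict_left_mono) auto
  qed simp
  \<comment> \<open>Each fixed point equation is multiplied by the other point, and the sums are
    compared class by class.\<close>
  have pos_unique: False if "0 < p" "p < q" "T_map a w \<beta> h p = p" "T_map a w \<beta> h q = q" for p q
  proof -
    have "(\<Sum>l\<in>UNIV. a l * w l * (p * tanh (\<beta> * (a l * q + h)))) < (\<Sum>l\<in>UNIV. a l * w l * (q * tanh (\<beta> * (a l * p + h))))"
      using that by (intro sum_less fixed_point_ratio \<beta> h) auto
    then have "p * T_map a w \<beta> h q < q * T_map a w \<beta> h p"
      unfolding T_map_def sum_distrib_left by (simp add: mult_ac)
    then show False using that by simp
  qed
  \<comment> \<open>The field pushes upwards, so a non-positive fixed point \<open>- s\<close> is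
    closer to zero than the positive one; equality would need the symmetric case at zero
    field.\<close>
  have neg_le: "s < y" if y: "0 < y" "T_map a w \<beta> h y = y" and s: "0 \<le> s" "T_map a w \<beta> h (- s) = - s"
    and ns: "\<not> (h = 0 \<and> s = y)" for s y
  proof (rule ccontr)
    assume "\<not> s < y"
    then have sy: "y \<le> s" by simp
    have es: "(\<Sum>l\<in>UNIV. a l * w l * tanh (\<beta> * (a l * s - h))) = s" using s(2) unfolding T_map_minus by simp
    have ey: "(\<Sum>l\<in>UNIV. a l * w l * tanh (\<beta> * (a l * y + h))) = y" using y(2) unfolding T_map_def .
    have "(\<Sum>l\<in>UNIV. a l * w l * (y * tanh (\<beta> * (a l * s - h)))) < (\<Sum>l\<in>UNIV. a l * w l * (s * tanh (\<beta> * (a l * y + h))))"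
    proof (rule sum_less)
      fix l assume al: "0 < a l"
      have le: "tanh (\<beta> * (a l * s - h)) \<le> tanh (\<beta> * (a l * s + h))" using \<beta> h by simp
      then have le': "y * tanh (\<beta> * (a l * s - h)) \<le> y * tanh (\<beta> * (a l * s + h))" using y by simp
      show "y * tanh (\<beta> * (a l * s - h)) < s * tanh (\<beta> * (a l * y + h))"
      proof (cases "y = s")
        case True
        then have "0 < h" using ns h by auto
        then show ?thesis using True \<beta> y by simp
      next
        case False
        then show ?thesis using fixed_point_ratio[OF y(1) _ al h \<beta>, of s] sy le' by simp
      qed
    qed
    then have "y * (\<Sum>l\<in>UNIV. a l * w l * tanh (\<beta> * (a l * s - h))) < s * (\<Sum>l\<in>UNIV. a l * w l * tanh (\<beta> * (a l * y + h)))"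
      unfolding sum_distrib_left by (simp add: mult_ac)
    then show False unfolding es ey by simp
  qed
  have an: "a l1 \<noteq> a l2" using a(1) two by (auto dest: injD)
  have caseP: "\<not> (\<forall>l. profile \<beta> h x y (a l) = c)"
    if x: "T_map a w \<beta> h x = x" and y: "T_map a w \<beta> h y = y" and xy: "x < y" and y0: "0 < y"
      and sym: "\<not> (h = 0 \<and> x = - y)" for x y c
  proof -
    have x0: "x \<le> 0" using pos_unique[OF _ xy x y] by force
    then have "- x < y" using neg_le[OF y0 y, of "- x"] x sym by auto
    then have mono: "profile \<beta> h x y b < profile \<beta> h x y d" if "0 \<le> b" "b < d" for b d
      using profile_strict_mono[OF \<beta> h y0 x0 _ that] by simp
    show ?thesis
      using an mono[OF a(2), of l1 "a l2"] mono[OF a(2), of l2 "a l1"] by (metis linorder_neqE_linordered_idom order_less_irrefl)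
  qed
  have caseN: "\<not> (\<forall>l. profile \<beta> h x y (a l) = c)"
    if x: "T_map a w \<beta> h x = x" and y: "T_map a w \<beta> h y = y" and xy: "x < y" and y0: "y \<le> 0" and hp: "0 < h" for x y c
  proof
    assume const: "\<forall>l. profile \<beta> h x y (a l) = c"
    define r s where "r = - x" and "s = - y"
    have rs: "0 \<le> s" "s < r" using xy y0 by (auto simp: r_def s_def)
    have es: "(\<Sum>l\<in>UNIV. a l * w l * tanh (\<beta> * (a l * s - h))) = s" using y T_map_minus[of a w \<beta> h s] unfolding s_def by simp
    have prof: "profile \<beta> h x y b = ln (cosh (\<beta> * (b * s - h))) - ln (cosh (\<beta> * (b * r - h)))" for b
    proof -
      have "\<beta> * (b * y + h) = - (\<beta> * (b * s - h))" "\<beta> * (b * x + h) = - (\<beta> * (b * r - h))"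
        by (auto simp: r_def s_def algebra_simps)
      then show ?thesis unfolding profile_def by (simp only: cosh_minus)
    qed
    \<comment> \<open>Otherwise no term of the fixed point equation for \<open>s\<close> would be
      positive and its sum would be negative, whereas \<open>s\<close> is not.\<close>
    obtain l where l: "h \<le> a l * s"
    proof (rule ccontr)
      assume nt: "\<not> thesis"
      have lt: "a l * s < h" for l
      proof (rule ccontr)
        assume "\<not> a l * s < h"
        then have "h \<le> a l * s" by simp
        from that[OF this] nt show False by simp
      qed
      have "(\<Sum>l\<in>UNIV. a l * w l * tanh (\<beta> * (a l * s - h))) < (\<Sum>l\<in>UNIV. a l * w l * 0)"
        using lt \<beta> by (intro sum_less) (simp add: mult_pos_neg)
      then show False using es rs by simp
    qed
    have al: "0 < a l" using l hp rs a(2)[of l] by (cases "a l = 0") auto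
    have "a l * s < a l * r" using al rs by simp
    then have "\<bar>\<beta> * (a l * s - h)\<bar> < \<bar>\<beta> * (a l * r - h)\<bar>" using l \<beta> by (simp add: abs_mult)
    \<comment> \<open>This single class reveals the sign of the constant, and the sign then forces
      the strict inequality \<open>big\<close> at every class.\<close>
    then have c: "c < 0" using ln_cosh_less const prof[of "a l"] by (metis diff_less_0_iff_less)
    have big: "0 < a i \<and> \<bar>a i * s - h\<bar> < a i * r - h" for i
    proof -
      have "ln (cosh (\<beta> * (a i * s - h))) < ln (cosh (\<beta> * (a i * r - h)))"
        using const c prof[of "a i"] by (metis diff_less_0_iff_less)
      then have "\<not> \<bar>\<beta> * (a i * r - h)\<bar> \<le> \<bar>\<beta> * (a i * s - h)\<bar>"
        using ln_cosh_less[of "\<beta> * (a i * r - h)" "\<beta> * (a i * s - h)"] ln_cosh_abs[of "\<beta> * (a i * r - h)"] ln_cosh_abs[of "\<beta> * (a i * s - h)"]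
        by (metis less_eq_real_def order_less_asym order_less_irrefl)
      then have lt: "\<bar>a i * s - h\<bar> < \<bar>a i * r - h\<bar>" using \<beta> by (simp add: abs_mult)
      then have "a i \<noteq> 0" by auto
      then have ai: "0 < a i" using a(2)[of i] by simp
      then have "a i * s < a i * r" using rs by simp
      then show ?thesis using lt ai by linarith
    qed
    have dec: "profile \<beta> h x y d < profile \<beta> h x y b" if bd: "b < d" and b: "0 < b" "\<bar>b * s - h\<bar> < b * r - h" for b d
    proof (rule DERIV_neg_imp_decreasing_open[OF bd _ continuous_profile])
      fix e assume e: "b < e"
      have er: "b * r < e * r" "b * s \<le> e * s" using e rs by (auto intro!: mult_strict_right_mono mult_right_mono)
      have "(e - b) * s \<le> (e - b) * r" using e rs by (intro mult_left_mono) auto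
      then have big: "\<bar>e * s - h\<bar> \<le> e * r - h" "0 < e * r - h" using b er by (auto simp: abs_le_iff algebra_simps)
      have "s * tanh (\<beta> * (e * s - h)) \<le> s * tanh (\<beta> * (e * r - h))"
        using big rs \<beta> by (intro mult_left_mono) auto
      also have "\<dots> < r * tanh (\<beta> * (e * r - h))" using big rs \<beta> by (intro mult_strict_right_mono) auto
      finally have 1: "s * tanh (\<beta> * (e * s - h)) < r * tanh (\<beta> * (e * r - h))" .
      have "\<beta> * (e * y + h) = - (\<beta> * (e * s - h))" "\<beta> * (e * x + h) = - (\<beta> * (e * r - h))"
        by (auto simp: r_def s_def algebra_simps)
      then have "y * tanh (\<beta> * (e * y + h)) - x * tanh (\<beta> * (e * x + h)) = s * tanh (\<beta> * (e * s - h)) - r * tanh (\<beta> * (e * r - h))"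
        by (simp only: tanh_minus) (simp add: r_def s_def)
      then have "\<beta> * (y * tanh (\<beta> * (e * y + h)) - x * tanh (\<beta> * (e * x + h))) < 0" using 1 \<beta> by (simp add: mult_pos_neg)
      then show "\<exists>d. (profile \<beta> h x y has_real_derivative d) (at e) \<and> d < 0"
        using has_derivative_profile by blast
    qed
    show False
      using an dec[of "a l1" "a l2"] dec[of "a l2" "a l1"] big[of l1] big[of l2] const
      by (metis linorder_neqE_linordered_idom order_less_irrefl)
  qed
  have main: "\<not> (\<forall>l. profile \<beta> h x y (a l) = c)"
    if x: "T_map a w \<beta> h x = x" and y: "T_map a w \<beta> h y = y" and xy: "x < y"
      and sym: "\<not> (h = 0 \<and> x = - y)" for x y c
  proof (cases "0 < y")
    case True
    then show ?thesis using caseP[OF x y xy _ sym] by blast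
  next
    case False
    show ?thesis
    proof (cases "0 < h")
      case True
      then show ?thesis using caseN[OF x y xy] False by simp
    next
      case h0: False
      then have h0: "h = 0" using h by simp
      have odd: "T_map a w \<beta> h (- z) = - z" if "T_map a w \<beta> h z = z" for z
        using that T_map_minus[of a w \<beta> h z] unfolding h0 T_map_def by simp
      have "profile \<beta> h (- y) (- x) b = - profile \<beta> h x y b" for b unfolding profile_def h0 by simp
      then show ?thesis using caseP[OF odd[OF y] odd[OF x], of "- c"] xy False sym by auto
    qed
  qed
  show ?thesis
  proof (cases "x < y")
    case True then show ?thesis using main[OF x y] sym by blast
  next
    case False
    have "profile \<beta> h y x b = - profile \<beta> h x y b" for b unfolding profile_def by simp
    then show ?thesis using main[OF y x, of "- c"] False neq sym by auto
  qed
qed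

section \<open>Degenerate critical points and small eigenvalues of the Hessian\<close>

definition hess :: "('k::finite \<Rightarrow> real) \<Rightarrow> real \<Rightarrow> real^'k \<Rightarrow> real^'k \<Rightarrow> real^'k^'k" where
  "hess a \<beta> v y = (\<chi> l l'. if l = l' then v $ l / (\<beta> * (1 - (y $ l)\<^sup>2)) - (a l)\<^sup>2 * (v $ l)\<^sup>2
     else - (a l * v $ l * a l' * v $ l'))"

text \<open>With the frequencies as a free vector the matrix can be studied by continuity near the
  limit.\<close>

lemma hessian_n_eq_hess: "hessian_n a \<beta> j n y = hess a \<beta> (\<chi> l. freq a j n l) y"
  by (simp add: vec_eq_iff hessian_n_def hess_def)

text \<open>\<^const>\<open>hess\<close> is a diagonal matrix minus the rank one matrix of \<open>u\<^sub>l = a\<^sub>l v\<^sub>l\<close>, so its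
  eigenvalues away from the diagonal entries solve the secular equation \<open>\<Sum> u\<^sub>l\<^sup>2 / (d\<^sub>l - c) = 1\<close>.\<close>

lemma secular_eigenvalue:
  fixes a :: "'k::finite \<Rightarrow> real" and v y :: "real^'k" and \<beta> c :: real
  defines "d \<equiv> \<lambda>l. v $ l / (\<beta> * (1 - (y $ l)\<^sup>2))"
  assumes d: "\<And>l. d l \<noteq> c" and sec: "(\<Sum>l\<in>UNIV. (a l * v $ l)\<^sup>2 / (d l - c)) = 1"
  shows "is_eigenvalue (hess a \<beta> v y) c"
proof -
  \<comment> \<open>The candidate eigenvector: the diagonal part minus \<open>c\<close>, inverted
    and applied to the vector of the rank one part.\<close>
  define x where "x = (\<chi> l. a l * v $ l / (d l - c))"
  have ux: "(\<Sum>l\<in>UNIV. a l * v $ l * x $ l) = 1"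
    using sec by (simp add: x_def power2_eq_square)
  have "x \<noteq> 0"
  proof
    assume "x = 0" then show False using ux by simp
  qed
  moreover have "hess a \<beta> v y *v x = c *s x"
  proof (subst vec_eq_iff, intro allI)
    fix l
    have "(hess a \<beta> v y *v x) $ l = (\<Sum>i\<in>UNIV. (if i = l then d l * x $ l else 0) - a l * v $ l * (a i * v $ i * x $ i))"
      unfolding matrix_vector_mult_def vec_lambda_beta
      by (intro sum.cong refl) (auto simp: hess_def d_def algebra_simps power2_eq_square)
    also have "\<dots> = d l * x $ l - a l * v $ l * (\<Sum>i\<in>UNIV. a i * v $ i * x $ i)"
      by (simp add: sum_subtractf sum_distrib_left)
    also have "\<dots> = d l * x $ l - (d l - c) * x $ l" using d[of l] unfolding ux by (simp add: x_def)
    finally show "(hess a \<beta> v y *v x) $ l = (c *s x) $ l" by (simp add: algebra_simps)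
  qed
  ultimately show ?thesis unfolding is_eigenvalue_def by blast
qed

lemma nhds_prod_components:
  fixes v0 y0 :: "real^'k::finite"
  shows "((\<lambda>p. fst p $ l) \<longlongrightarrow> v0 $ l) (nhds (v0, y0))" "((\<lambda>p. snd p $ l) \<longlongrightarrow> y0 $ l) (nhds (v0, y0))"
proof -
  have id: "filterlim (\<lambda>p. p) (nhds (v0, y0)) (nhds (v0, y0))" by (rule filterlim_ident)
  show "((\<lambda>p. fst p $ l) \<longlongrightarrow> v0 $ l) (nhds (v0, y0))" "((\<lambda>p. snd p $ l) \<longlongrightarrow> y0 $ l) (nhds (v0, y0))"
    using tendsto_vec_nth[OF tendsto_fst[OF id], of l] tendsto_vec_nth[OF tendsto_snd[OF id], of l] by auto
qed

text \<open>At a critical point the assumed sum is the slope of \<open>T_map\<close>; slope one says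
  that \<open>c = 0\<close> solves the secular equation. Below the diagonal entries the secular
  function increases strictly in \<open>c\<close>, so it lies on different sides of 1 at
  \<open>- c0\<close> and \<open>c0\<close>. This persists nearby, and the intermediate value
  theorem yields an eigenvalue in between.\<close>

lemma small_eigenvalue:
  fixes a w :: "'k::finite \<Rightarrow> real" and m :: "real^'k"
  assumes \<beta>: "0 < \<beta>" and w: "\<And>l. 0 < w l" and m: "\<And>l. \<bar>m $ l\<bar> < 1"
    and T1: "(\<Sum>l\<in>UNIV. (a l)\<^sup>2 * w l * (\<beta> * (1 - (m $ l)\<^sup>2))) = 1" and \<epsilon>: "0 < \<epsilon>"
  shows "\<forall>\<^sub>F p in nhds (\<chi> l. w l, m). \<exists>c. \<bar>c\<bar> < \<epsilon> \<and> is_eigenvalue (hess a \<beta> (fst p) (snd p)) c"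
proof -
  let ?p0 = "(\<chi> l. w l, m)"
  define d where "d p l = fst p $ l / (\<beta> * (1 - (snd p $ l)\<^sup>2))" for p :: "(real^'k) \<times> (real^'k)" and l
  define G where "G c p = (\<Sum>l\<in>UNIV. (a l * fst p $ l)\<^sup>2 / (d p l - c))" for c and p :: "(real^'k) \<times> (real^'k)"
  have m2: "0 < 1 - (m $ l)\<^sup>2" for l using m[of l] by (simp add: abs_square_less_1)
  have dpos: "0 < d ?p0 l" for l unfolding d_def using w \<beta> m2 by simp
  \<comment> \<open>At most half of every diagonal entry, so that no pole lies in
    \<open>{- c0..c0}\<close>.\<close>
  define c0 where "c0 = min (\<epsilon> / 2) (Min (range (\<lambda>l. d ?p0 l / 2)))"
  have c0: "0 < c0" "c0 < \<epsilon>" "c0 < d ?p0 l" for l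
  proof -
    show "0 < c0" unfolding c0_def using \<epsilon> dpos by (auto simp: Min_gr_iff)
    show "c0 < \<epsilon>" unfolding c0_def using \<epsilon> by auto
    have "c0 \<le> Min (range (\<lambda>l. d ?p0 l / 2))" unfolding c0_def by simp
    also have "\<dots> \<le> d ?p0 l / 2" by (rule Min_le) auto
    finally show "c0 < d ?p0 l" using dpos[of l] by linarith
  qed
  have G0: "(\<Sum>l\<in>UNIV. (a l * w l)\<^sup>2 / d ?p0 l) = 1"
  proof -
    have "(a l * w l)\<^sup>2 / d ?p0 l = (a l)\<^sup>2 * w l * (\<beta> * (1 - (m $ l)\<^sup>2))" for l
      unfolding d_def using w[of l] by (simp add: power2_eq_square)
    then show ?thesis using T1 by simp
  qed
  obtain l0 where l0: "a l0 \<noteq> 0" using T1 by (metis (mono_tags, lifting) mult_zero_left power_zero_numeral sum.neutral zero_neq_one)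
  have gr: "1 < G c0 ?p0"
    unfolding G_def G0[symmetric]
  proof (rule sum_strict_mono_ex1)
    show "\<forall>l\<in>UNIV. (a l * w l)\<^sup>2 / d ?p0 l \<le> (a l * fst ?p0 $ l)\<^sup>2 / (d ?p0 l - c0)"
      using c0 dpos by (auto intro!: divide_left_mono mult_pos_pos)
    show "\<exists>l\<in>UNIV. (a l * w l)\<^sup>2 / d ?p0 l < (a l * fst ?p0 $ l)\<^sup>2 / (d ?p0 l - c0)"
      using c0 dpos l0 w[of l0] by (intro bexI[of _ l0]) (auto intro!: divide_strict_left_mono mult_pos_pos)
  qed simp
  have ls: "G (- c0) ?p0 < 1"
    unfolding G_def G0[symmetric]
  proof (rule sum_strict_mono_ex1)
    show "\<forall>l\<in>UNIV. (a l * fst ?p0 $ l)\<^sup>2 / (d ?p0 l - - c0) \<le> (a l * w l)\<^sup>2 / d ?p0 l"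
    proof
      fix l
      have "(a l * w l)\<^sup>2 / (d ?p0 l + c0) \<le> (a l * w l)\<^sup>2 / d ?p0 l"
        by (rule divide_left_mono) (use dpos[of l] c0(1) in \<open>auto intro!: mult_pos_pos add_pos_pos\<close>)
      then show "(a l * fst ?p0 $ l)\<^sup>2 / (d ?p0 l - - c0) \<le> (a l * w l)\<^sup>2 / d ?p0 l" by simp
    qed
    have "(a l0 * w l0)\<^sup>2 / (d ?p0 l0 + c0) < (a l0 * w l0)\<^sup>2 / d ?p0 l0"
      by (rule divide_strict_left_mono) (use dpos[of l0] c0(1) l0 w[of l0] in \<open>auto intro!: mult_pos_pos add_pos_pos\<close>)
    then show "\<exists>l\<in>UNIV. (a l * fst ?p0 $ l)\<^sup>2 / (d ?p0 l - - c0) < (a l * w l)\<^sup>2 / d ?p0 l"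
      by (intro bexI[of _ l0]) simp_all
  qed simp
  have lf: "((\<lambda>p. fst p $ l) \<longlongrightarrow> w l) (nhds ?p0)" "((\<lambda>p. snd p $ l) \<longlongrightarrow> m $ l) (nhds ?p0)" for l
    using nhds_prod_components[where l=l and ?v0.0="\<chi> l. w l" and ?y0.0=m] by simp_all
  have ld: "((\<lambda>p. d p l) \<longlongrightarrow> d ?p0 l) (nhds ?p0)" for l
    unfolding d_def using m2[of l] \<beta> by (auto intro!: tendsto_intros lf)
  have lG: "((\<lambda>p. G c p) \<longlongrightarrow> G c ?p0) (nhds ?p0)" if "\<And>l. d ?p0 l \<noteq> c" for c
    unfolding G_def using that by (auto intro!: tendsto_intros lf ld)
  have ne: "d ?p0 l \<noteq> c0" "d ?p0 l \<noteq> - c0" for l using c0(3)[of l] c0(1) dpos[of l] by simp_all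
  have e1: "\<forall>\<^sub>F p in nhds ?p0. 1 < G c0 p" by (rule order_tendstoD(1)[OF lG[OF ne(1)] gr])
  have e2: "\<forall>\<^sub>F p in nhds ?p0. G (- c0) p < 1" by (rule order_tendstoD(2)[OF lG[OF ne(2)] ls])
  have e3: "\<forall>\<^sub>F p in nhds ?p0. \<forall>l\<in>UNIV. c0 < d p l"
    by (rule eventually_ball_finite) (use order_tendstoD(1)[OF ld c0(3)] in auto)
  show ?thesis
    using e1 e2 e3
  proof eventually_elim
    case (elim p)
    have "continuous_on {- c0..c0} (\<lambda>c. G c p)"
      unfolding G_def using elim(3) by (intro continuous_intros) (auto, metis UNIV_I not_less)
    then obtain c where c: "- c0 \<le> c" "c \<le> c0" "G c p = 1"
      using IVT'[of "\<lambda>c. G c p" "- c0" 1 c0] elim(1,2) c0(1) by force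
    have "d p l \<noteq> c" for l using elim(3) c(2) by (metis UNIV_I not_less)
    then have "is_eigenvalue (hess a \<beta> (fst p) (snd p)) c"
      using c(3) unfolding G_def d_def by (intro secular_eigenvalue) auto
    then show ?case using c c0(2) by (intro exI[of _ c]) (auto simp: abs_less_iff)
  qed
qed

section \<open>Stability and second order expansion near a critical point\<close>

lemma T_map_has_derivative:
  "(T_map a w \<beta> h has_real_derivative
     (\<Sum>l\<in>UNIV. (a l)\<^sup>2 * w l * (\<beta> * (1 - (tanh (\<beta> * (a l * K + h)))\<^sup>2)))) (at K)"
  unfolding T_map_def[abs_def]
  by (auto intro!: derivative_eq_intros sum.cong simp: power2_eq_square algebra_simps)

text \<open>Turns a small residual in the scalar fixed point equation into a small distance to its
  solution.\<close>

lemma near_fixed_point: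
  fixes f :: "real \<Rightarrow> real"
  assumes "(f has_real_derivative D) (at x)" "D \<noteq> 0" "f x = 0"
  shows "\<forall>\<^sub>F k in nhds x. \<bar>D\<bar> / 2 * \<bar>k - x\<bar> \<le> \<bar>f k\<bar>"
proof -
  have "((\<lambda>k. (f k - f x) / (k - x)) \<longlongrightarrow> D) (at x)"
    using assms(1) by (simp add: has_field_derivative_iff)
  then have "((\<lambda>k. \<bar>(f k - f x) / (k - x)\<bar>) \<longlongrightarrow> \<bar>D\<bar>) (at x)" by (rule tendsto_rabs)
  then have "\<forall>\<^sub>F k in at x. \<bar>D\<bar> / 2 < \<bar>(f k - f x) / (k - x)\<bar>"
    by (rule order_tendstoD(1)) (use assms in auto)
  then have "\<forall>\<^sub>F k in nhds x. k \<noteq> x \<longrightarrow> \<bar>D\<bar> / 2 < \<bar>(f k - f x) / (k - x)\<bar>"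
    by (simp add: eventually_at_filter)
  then show ?thesis
  proof eventually_elim
    case (elim k)
    show ?case
    proof (cases "k = x")
      case False
      then have "\<bar>D\<bar> / 2 < \<bar>f k\<bar> / \<bar>k - x\<bar>" using elim assms(3) by (simp add: abs_divide)
      then show ?thesis using False by (simp add: pos_less_divide_eq)
    qed simp
  qed
qed

text \<open>The mean-field system reduces to the scalar equation
  \<open>k = T_map a w \<beta> h k\<close> for the magnetisation, which has a simple solution at
  \<open>K\<close> as the slope there is not one. The coordinates follow since \<open>tanh\<close>
  is 1-Lipschitz. The error \<eta> is quantified inside the neighbourhood because it will depend on
  \<open>n\<close>.\<close>

lemma stability_of_critical_point:
  fixes a w :: "'k::finite \<Rightarrow> real" and m :: "real^'k"
  assumes \<beta>: "0 < \<beta>" and w: "\<And>l. 0 < w l" "(\<Sum>l\<in>UNIV. w l) = 1" and A: "\<And>l. \<bar>a l\<bar> \<le> A"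
    and m: "\<And>l. m $ l = tanh (\<beta> * (a l * K + h))" and K: "K = (\<Sum>l\<in>UNIV. a l * w l * m $ l)"
    and T1: "(\<Sum>l\<in>UNIV. (a l)\<^sup>2 * w l * (\<beta> * (1 - (m $ l)\<^sup>2))) \<noteq> 1"
  shows "\<exists>C\<ge>0. \<forall>\<^sub>F p in nhds (\<chi> l. w l, m). \<forall>\<eta>.
     (\<forall>l. \<bar>snd p $ l - tanh (\<beta> * (a l * (\<Sum>i\<in>UNIV. a i * fst p $ i * snd p $ i) + h))\<bar> \<le> \<eta>) \<longrightarrow>
     (\<forall>l. \<bar>snd p $ l - m $ l\<bar> \<le> C * ((\<Sum>i\<in>UNIV. \<bar>fst p $ i - w i\<bar>) + \<eta>))"
proof -
  let ?p0 = "(\<chi> l. w l, m)"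
  define D where "D = 1 - (\<Sum>l\<in>UNIV. (a l)\<^sup>2 * w l * (\<beta> * (1 - (m $ l)\<^sup>2)))"
  have D: "D \<noteq> 0" using T1 by (simp add: D_def)
  define f where "f k = k - T_map a w \<beta> h k" for k
  have fK: "f K = 0" by (simp only: f_def T_map_def m[symmetric] K[symmetric] diff_self)
  have df: "(f has_real_derivative D) (at K)"
    unfolding f_def[abs_def] D_def m by (auto intro!: derivative_eq_intros T_map_has_derivative)
  define mg where "mg p = (\<Sum>i\<in>UNIV. a i * fst p $ i * snd p $ i)" for p :: "(real^'k) \<times> (real^'k)"
  have "(mg \<longlongrightarrow> (\<Sum>i\<in>UNIV. a i * (\<chi> l. w l) $ i * m $ i)) (nhds ?p0)"
    unfolding mg_def[abs_def] by (intro tendsto_intros nhds_prod_components)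
  then have lm: "(mg \<longlongrightarrow> K) (nhds ?p0)" unfolding K by simp
  have ev1: "\<forall>\<^sub>F p in nhds ?p0. \<bar>D\<bar> / 2 * \<bar>mg p - K\<bar> \<le> \<bar>f (mg p)\<bar>"
    using near_fixed_point[OF df D fK] lm by (rule eventually_compose_filterlim)
  have ev2: "\<forall>\<^sub>F p in nhds ?p0. \<forall>l\<in>UNIV. \<bar>snd p $ l\<bar> < 1"
  proof (rule eventually_ball_finite)
    show "\<forall>l\<in>UNIV. \<forall>\<^sub>F p in nhds ?p0. \<bar>snd p $ l\<bar> < 1"
    proof
      fix l
      have "\<bar>m $ l\<bar> < 1" unfolding m using tanh_real_bounds[of "\<beta> * (a l * K + h)"] by auto
      then show "\<forall>\<^sub>F p in nhds ?p0. \<bar>snd p $ l\<bar> < 1"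
        by (rule order_tendstoD(2)[OF tendsto_rabs[OF nhds_prod_components(2)]])
    qed
  qed simp
  define C1 where "C1 = 2 * A / \<bar>D\<bar>"
  have A0: "0 \<le> A" using A[of undefined] by linarith
  have C1: "0 \<le> C1" unfolding C1_def using A0 by simp
  show ?thesis
  proof (intro exI[of _ "1 + \<beta> * A * C1"] conjI)
    show "0 \<le> 1 + \<beta> * A * C1" using \<beta> A0 C1 by simp
    show "\<forall>\<^sub>F p in nhds ?p0. \<forall>\<eta>.
     (\<forall>l. \<bar>snd p $ l - tanh (\<beta> * (a l * (\<Sum>i\<in>UNIV. a i * fst p $ i * snd p $ i) + h))\<bar> \<le> \<eta>) \<longrightarrow>
     (\<forall>l. \<bar>snd p $ l - m $ l\<bar> \<le> (1 + \<beta> * A * C1) * ((\<Sum>i\<in>UNIV. \<bar>fst p $ i - w i\<bar>) + \<eta>))"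
      using ev1 ev2
    proof eventually_elim
      case (elim p)
      show ?case
      proof (intro allI impI)
        fix \<eta> l
        assume \<eta>: "\<forall>l. \<bar>snd p $ l - tanh (\<beta> * (a l * (\<Sum>i\<in>UNIV. a i * fst p $ i * snd p $ i) + h))\<bar> \<le> \<eta>"
        let ?W = "\<Sum>i\<in>UNIV. \<bar>fst p $ i - w i\<bar>"
        have W0: "0 \<le> ?W" by (intro sum_nonneg) auto
        have \<eta>0: "0 \<le> \<eta>" using \<eta> by (meson abs_ge_zero order_trans)
        \<comment> \<open>The residual splits into the change of the frequencies and the errors of
          the approximate equations.\<close>
        have "f (mg p) = (\<Sum>i\<in>UNIV. a i * snd p $ i * (fst p $ i - w i))
            + (\<Sum>i\<in>UNIV. a i * w i * (snd p $ i - tanh (\<beta> * (a i * mg p + h))))"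
          unfolding f_def T_map_def mg_def by (simp add: sum.distrib[symmetric] sum_subtractf[symmetric] algebra_simps)
        also have "\<bar>\<dots>\<bar> \<le> (\<Sum>i\<in>UNIV. A * 1 * \<bar>fst p $ i - w i\<bar>) + (\<Sum>i\<in>UNIV. A * w i * \<eta>)"
        proof (rule order_trans[OF abs_triangle_ineq add_mono])
          show "\<bar>\<Sum>i\<in>UNIV. a i * snd p $ i * (fst p $ i - w i)\<bar> \<le> (\<Sum>i\<in>UNIV. A * 1 * \<bar>fst p $ i - w i\<bar>)"
          proof (intro order_trans[OF sum_abs] sum_mono)
            fix i
            have "\<bar>a i\<bar> * \<bar>snd p $ i\<bar> \<le> A * 1"
              using A[of i] elim(2) A0 by (intro mult_mono) (auto intro: less_imp_le)
            then show "\<bar>a i * snd p $ i * (fst p $ i - w i)\<bar> \<le> A * 1 * \<bar>fst p $ i - w i\<bar>"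
              unfolding abs_mult by (rule mult_right_mono) simp
          qed
          show "\<bar>\<Sum>i\<in>UNIV. a i * w i * (snd p $ i - tanh (\<beta> * (a i * mg p + h)))\<bar> \<le> (\<Sum>i\<in>UNIV. A * w i * \<eta>)"
            using A \<eta> A0 w(1) unfolding mg_def
            by (intro order_trans[OF sum_abs] sum_mono) (auto simp: abs_mult less_imp_le intro!: mult_mono)
        qed
        also have "\<dots> = A * (?W + \<eta>)"
          using w(2) by (simp add: sum_distrib_left[symmetric] sum_distrib_right[symmetric] algebra_simps)
        finally have "\<bar>D\<bar> / 2 * \<bar>mg p - K\<bar> \<le> A * (?W + \<eta>)" using elim(1) by linarith
        then have k: "\<bar>mg p - K\<bar> \<le> C1 * (?W + \<eta>)" unfolding C1_def using D by (simp add: field_simps)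
        have "\<bar>tanh (\<beta> * (a l * mg p + h)) - m $ l\<bar> \<le> \<bar>\<beta> * (a l * mg p + h) - \<beta> * (a l * K + h)\<bar>"
          unfolding m by (rule tanh_lipschitz)
        also have "\<dots> = \<bar>\<beta> * a l * (mg p - K)\<bar>" by (simp add: algebra_simps)
        also have "\<dots> \<le> \<beta> * A * (C1 * (?W + \<eta>))"
          using \<beta> A[of l] A0 k unfolding abs_mult by (intro mult_mono) auto
        finally have "\<bar>snd p $ l - m $ l\<bar> \<le> \<eta> + \<beta> * A * (C1 * (?W + \<eta>))"
          using \<eta>[rule_format, of l] unfolding mg_def by linarith
        also have "\<dots> \<le> (1 + \<beta> * A * C1) * (?W + \<eta>)" using W0 by (simp add: algebra_simps)
        finally show "\<bar>snd p $ l - m $ l\<bar> \<le> (1 + \<beta> * A * C1) * (?W + \<eta>)" .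
      qed
    qed
  qed
qed

text \<open>The increment of \<open>f\<close> is \<open>f'\<close> at an intermediate point, and
  differentiability of \<open>f'\<close> at the single point \<open>c\<close> controls that
  value.\<close>

lemma second_order_bound:
  fixes f f' :: "real \<Rightarrow> real"
  assumes df: "\<forall>\<^sub>F x in nhds c. (f has_real_derivative f' x) (at x)"
    and df': "(f' has_real_derivative D) (at c)"
  shows "\<exists>C\<ge>0. \<forall>\<^sub>F x in nhds c. \<bar>f x - f c - f' c * (x - c)\<bar> \<le> C * (x - c)\<^sup>2 \<and> \<bar>f x - f c\<bar> \<le> C * \<bar>x - c\<bar>"
proof -
  have "((\<lambda>x. (f' x - f' c) / (x - c)) \<longlongrightarrow> D) (at c)"
    using df' by (simp add: has_field_derivative_iff)
  then have "((\<lambda>x. \<bar>(f' x - f' c) / (x - c)\<bar>) \<longlongrightarrow> \<bar>D\<bar>) (at c)" by (rule tendsto_rabs)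
  then have "\<forall>\<^sub>F x in at c. \<bar>(f' x - f' c) / (x - c)\<bar> < \<bar>D\<bar> + 1" by (rule order_tendstoD(2)) simp
  then have "\<forall>\<^sub>F x in nhds c. x \<noteq> c \<longrightarrow> \<bar>(f' x - f' c) / (x - c)\<bar> < \<bar>D\<bar> + 1"
    by (simp add: eventually_at_filter)
  with df have "\<forall>\<^sub>F x in nhds c. (f has_real_derivative f' x) (at x) \<and> (x \<noteq> c \<longrightarrow> \<bar>(f' x - f' c) / (x - c)\<bar> < \<bar>D\<bar> + 1)"
    by eventually_elim auto
  then obtain e where e: "0 < e" "\<And>x. dist x c < e \<Longrightarrow> (f has_real_derivative f' x) (at x)"
    "\<And>x. dist x c < e \<Longrightarrow> x \<noteq> c \<Longrightarrow> \<bar>(f' x - f' c) / (x - c)\<bar> < \<bar>D\<bar> + 1"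
    unfolding eventually_nhds_metric by blast
  define B where "B = \<bar>D\<bar> + 1"
  have B: "\<bar>f' x - f' c\<bar> \<le> B * \<bar>x - c\<bar>" if "dist x c < e" for x
    using e(3)[OF that] unfolding B_def by (cases "x = c") (auto simp: abs_divide pos_divide_less_eq)
  have mvt: "\<exists>z. \<bar>z - c\<bar> \<le> \<bar>x - c\<bar> \<and> f x - f c = f' z * (x - c)" if x: "dist x c < e" for x
  proof (cases x c rule: linorder_cases)
    case less
    have "\<exists>z>x. z < c \<and> f c - f x = (c - x) * f' z"
      by (rule MVT2[OF less e(2)]) (use less x in \<open>auto simp: dist_real_def\<close>)
    then obtain z where "x < z" "z < c" "f c - f x = (c - x) * f' z" by auto
    then show ?thesis by (intro exI[of _ z]) (auto simp: algebra_simps)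
  next
    case greater
    have "\<exists>z>c. z < x \<and> f x - f c = (x - c) * f' z"
      by (rule MVT2[OF greater e(2)]) (use greater x in \<open>auto simp: dist_real_def\<close>)
    then obtain z where "c < z" "z < x" "f x - f c = (x - c) * f' z" by auto
    then show ?thesis by (intro exI[of _ z]) (auto simp: algebra_simps)
  qed auto
  define C where "C = B * e + \<bar>f' c\<bar> + B"
  have C: "0 \<le> C" "B \<le> C" unfolding C_def B_def using e(1) by auto
  have "\<bar>f x - f c - f' c * (x - c)\<bar> \<le> C * (x - c)\<^sup>2 \<and> \<bar>f x - f c\<bar> \<le> C * \<bar>x - c\<bar>" if x: "dist x c < e" for x
  proof -
    obtain z where z: "\<bar>z - c\<bar> \<le> \<bar>x - c\<bar>" "f x - f c = f' z * (x - c)" using mvt[OF x] by blast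
    have "dist z c < e" using z x by (simp add: dist_real_def)
    then have "\<bar>f' z - f' c\<bar> \<le> B * \<bar>z - c\<bar>" by (rule B)
    also have "\<dots> \<le> B * \<bar>x - c\<bar>" using z(1) by (intro mult_left_mono) (auto simp: B_def)
    finally have d: "\<bar>f' z - f' c\<bar> \<le> B * \<bar>x - c\<bar>" .
    have "f x - f c - f' c * (x - c) = (f' z - f' c) * (x - c)" using z(2) by (simp add: algebra_simps)
    also have "\<bar>\<dots>\<bar> \<le> B * \<bar>x - c\<bar> * \<bar>x - c\<bar>" unfolding abs_mult using d by (intro mult_right_mono) auto
    also have "\<dots> = B * (x - c)\<^sup>2" by (simp add: power2_eq_square)
    also have "\<dots> \<le> C * (x - c)\<^sup>2" using C by (intro mult_right_mono) auto
    finally have 1: "\<bar>f x - f c - f' c * (x - c)\<bar> \<le> C * (x - c)\<^sup>2" .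
    have "B * \<bar>x - c\<bar> \<le> B * e" using x by (intro mult_left_mono) (auto simp: dist_real_def B_def)
    moreover have "0 \<le> B" by (simp add: B_def)
    ultimately have "\<bar>f' z\<bar> \<le> C" using d unfolding C_def by linarith
    then have "\<bar>f x - f c\<bar> \<le> C * \<bar>x - c\<bar>" unfolding z(2) abs_mult by (intro mult_right_mono) auto
    with 1 show ?thesis by blast
  qed
  then show ?thesis using C e(1) unfolding eventually_nhds_metric by blast
qed

lemma cramer_entropy_second_order:
  fixes c :: real assumes c: "\<bar>c\<bar> < 1"
  shows "\<exists>C\<ge>0. \<forall>\<^sub>F x in nhds c.
     \<bar>cramer_entropy x - cramer_entropy c - (ln (1 + c) - ln (1 - c)) / 2 * (x - c)\<bar> \<le> C * (x - c)\<^sup>2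
     \<and> \<bar>cramer_entropy x - cramer_entropy c\<bar> \<le> C * \<bar>x - c\<bar>"
proof (rule second_order_bound[where f'="\<lambda>x. (ln (1 + x) - ln (1 - x)) / 2"])
  have "\<forall>\<^sub>F x in nhds c. \<bar>x\<bar> < 1"
    by (rule order_tendstoD(2)[OF tendsto_rabs[OF filterlim_ident] c])
  then show "\<forall>\<^sub>F x in nhds c. (cramer_entropy has_real_derivative (ln (1 + x) - ln (1 - x)) / 2) (at x)"
    by eventually_elim (rule has_derivative_cramer_entropy)
  have "((\<lambda>x. ln (1 + x)) has_real_derivative 1 / (1 + c)) (at c)"
    "((\<lambda>x. ln (1 - x)) has_real_derivative - 1 / (1 - c)) (at c)"
    using c by (auto intro!: derivative_eq_intros)
  from DERIV_cdivide[OF DERIV_diff[OF this]]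
  show "((\<lambda>x. (ln (1 + x) - ln (1 - x)) / 2) has_real_derivative (1 / (1 + c) - - 1 / (1 - c)) / 2) (at c)" .
qed

lemma sum_square_le:
  fixes f :: "'k::finite \<Rightarrow> real"
  shows "(\<Sum>i\<in>UNIV. \<bar>f i\<bar>)\<^sup>2 \<le> real CARD('k) * (\<Sum>i\<in>UNIV. (f i)\<^sup>2)"
  using Cauchy_Schwarz_ineq_sum[of "\<lambda>_. 1" "\<lambda>i. \<bar>f i\<bar>" "UNIV :: 'k set"] by simp

text \<open>Criticality removes the first order in the displacement of the point, so to first order
  the free energy reacts to the frequencies only, and \<open>g l\<close> is its partial derivative
  in \<open>w l\<close>.\<close>

lemma free_energy_expansion:
  fixes a w :: "'k::finite \<Rightarrow> real" and m :: "real^'k"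
  assumes \<beta>: "0 < \<beta>" and w: "\<And>l. 0 < w l" and A: "\<And>l. \<bar>a l\<bar> \<le> A"
    and m1: "\<And>l. \<bar>m $ l\<bar> < 1" and K: "K = (\<Sum>l\<in>UNIV. a l * w l * m $ l)"
    and crit: "\<And>l. (ln (1 + m $ l) - ln (1 - m $ l)) / 2 = \<beta> * (a l * K + h)"
  defines "g \<equiv> \<lambda>l. - K * a l * m $ l - h * m $ l + cramer_entropy (m $ l) / \<beta>"
  shows "\<exists>C\<ge>0. \<forall>\<^sub>F p in nhds (\<chi> l. w l, m).
     \<bar>free_energy a (\<lambda>l. fst p $ l) \<beta> h (snd p) - free_energy a w \<beta> h m - (\<Sum>l\<in>UNIV. g l * (fst p $ l - w l))\<bar>
     \<le> C * ((\<Sum>l\<in>UNIV. (fst p $ l - w l)\<^sup>2) + (\<Sum>l\<in>UNIV. (snd p $ l - m $ l)\<^sup>2))"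
proof -
  let ?p0 = "(\<chi> l. w l, m)"
  define near where "near l C x \<longleftrightarrow>
     \<bar>cramer_entropy x - cramer_entropy (m $ l) - (\<beta> * (a l * K + h)) * (x - m $ l)\<bar> \<le> C * (x - m $ l)\<^sup>2
     \<and> \<bar>cramer_entropy x - cramer_entropy (m $ l)\<bar> \<le> C * \<bar>x - m $ l\<bar>" for l C x
  have "\<exists>C\<ge>0. \<forall>\<^sub>F x in nhds (m $ l). near l C x" for l
    using cramer_entropy_second_order[OF m1[of l]] unfolding crit near_def .
  then obtain Cl where Cl: "\<And>l. 0 \<le> Cl l" "\<And>l. \<forall>\<^sub>F x in nhds (m $ l). near l (Cl l) x"
    by metis
  define C where "C = Max (range Cl)"
  have C: "Cl l \<le> C" for l unfolding C_def by (rule Max_ge) auto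
  have C0: "0 \<le> C" using Cl(1) C by (meson order_trans)
  have evI: "\<forall>\<^sub>F p in nhds ?p0. \<forall>l\<in>UNIV.
     \<bar>cramer_entropy (snd p $ l) - cramer_entropy (m $ l) - (\<beta> * (a l * K + h)) * (snd p $ l - m $ l)\<bar> \<le> C * (snd p $ l - m $ l)\<^sup>2
     \<and> \<bar>cramer_entropy (snd p $ l) - cramer_entropy (m $ l)\<bar> \<le> C * \<bar>snd p $ l - m $ l\<bar>"
  proof (intro eventually_ball_finite ballI)
    fix l
    have "\<forall>\<^sub>F p in nhds ?p0. near l (Cl l) (snd p $ l)"
      using Cl(2) nhds_prod_components(2) by (rule eventually_compose_filterlim)
    then show "\<forall>\<^sub>F p in nhds ?p0.
       \<bar>cramer_entropy (snd p $ l) - cramer_entropy (m $ l) - (\<beta> * (a l * K + h)) * (snd p $ l - m $ l)\<bar> \<le> C * (snd p $ l - m $ l)\<^sup>2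
       \<and> \<bar>cramer_entropy (snd p $ l) - cramer_entropy (m $ l)\<bar> \<le> C * \<bar>snd p $ l - m $ l\<bar>"
    proof eventually_elim
      case (elim p)
      have "Cl l * (snd p $ l - m $ l)\<^sup>2 \<le> C * (snd p $ l - m $ l)\<^sup>2" "Cl l * \<bar>snd p $ l - m $ l\<bar> \<le> C * \<bar>snd p $ l - m $ l\<bar>"
        using C by (intro mult_right_mono; simp)+
      then show ?case using elim unfolding near_def by linarith
    qed
  qed simp
  have evm: "\<forall>\<^sub>F p in nhds ?p0. \<forall>l\<in>UNIV. \<bar>snd p $ l\<bar> < 1"
    by (intro eventually_ball_finite ballI order_tendstoD(2)[OF tendsto_rabs[OF nhds_prod_components(2)]] m1) simp
  define W where "W = Max (range w)"
  have W: "w l \<le> W" for l unfolding W_def by (rule Max_ge) auto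
  have W0: "0 \<le> W" using w W by (meson less_imp_le order_trans)
  have A0: "0 \<le> A" using A[of undefined] by linarith
  define k where "k = real CARD('k)"
  have k0: "0 \<le> k" by (simp add: k_def)
  \<comment> \<open>One part for each remainder: the squared change of the magnetisation, the cross
    terms with \<open>K\<close> and \<open>h\<close>, and the entropy.\<close>
  define C' where "C' = (A + A * W)\<^sup>2 * k + \<bar>K\<bar> * A + \<bar>h\<bar> + (W * C + C) / \<beta>"
  have C'0: "0 \<le> C'" unfolding C'_def using A0 W0 C0 k0 \<beta> by simp
  show ?thesis
  proof (intro exI[of _ C'] conjI C'0)
    show "\<forall>\<^sub>F p in nhds ?p0.
     \<bar>free_energy a (\<lambda>l. fst p $ l) \<beta> h (snd p) - free_energy a w \<beta> h m - (\<Sum>l\<in>UNIV. g l * (fst p $ l - w l))\<bar>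
     \<le> C' * ((\<Sum>l\<in>UNIV. (fst p $ l - w l)\<^sup>2) + (\<Sum>l\<in>UNIV. (snd p $ l - m $ l)\<^sup>2))"
      using evI evm
    proof eventually_elim
      case (elim p)
      define v where "v l = fst p $ l - w l" for l
      define y where "y l = snd p $ l - m $ l" for l
      define e where "e l = cramer_entropy (snd p $ l) - cramer_entropy (m $ l)" for l
      let ?Q = "(\<Sum>l\<in>UNIV. (v l)\<^sup>2) + (\<Sum>l\<in>UNIV. (y l)\<^sup>2)"
      have fv: "fst p $ l = w l + v l" "snd p $ l = m $ l + y l" for l by (auto simp: v_def y_def)
      have e1': "\<bar>e l - (\<beta> * (a l * K + h)) * y l\<bar> \<le> C * (y l)\<^sup>2 \<and> \<bar>e l\<bar> \<le> C * \<bar>y l\<bar>" for l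
        unfolding e_def y_def using elim(1) by (rule bspec) simp
      note e1 = conjunct1[OF e1'] conjunct2[OF e1']
      have pq: "\<bar>v l\<bar> * \<bar>y l\<bar> \<le> (v l)\<^sup>2 + (y l)\<^sup>2" for l
      proof -
        have "0 \<le> \<bar>v l\<bar> * \<bar>y l\<bar>" by simp
        then show ?thesis using sum_squares_bound[of "\<bar>v l\<bar>" "\<bar>y l\<bar>"] unfolding power2_abs by linarith
      qed
      have Q: "(\<Sum>l\<in>UNIV. \<bar>v l\<bar> * \<bar>y l\<bar>) \<le> ?Q" "(\<Sum>l\<in>UNIV. (y l)\<^sup>2) \<le> ?Q"
      proof -
        have "(\<Sum>l\<in>UNIV. \<bar>v l\<bar> * \<bar>y l\<bar>) \<le> (\<Sum>l\<in>UNIV. (v l)\<^sup>2 + (y l)\<^sup>2)" by (intro sum_mono pq)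
        then show "(\<Sum>l\<in>UNIV. \<bar>v l\<bar> * \<bar>y l\<bar>) \<le> ?Q" by (simp add: sum.distrib)
        have "0 \<le> (\<Sum>l\<in>UNIV. (v l)\<^sup>2)" by (intro sum_nonneg) auto
        then show "(\<Sum>l\<in>UNIV. (y l)\<^sup>2) \<le> ?Q" by simp
      qed
      have Q0: "0 \<le> ?Q" by (intro add_nonneg_nonneg sum_nonneg) auto
      define dK where "dK = (\<Sum>l\<in>UNIV. a l * fst p $ l * snd p $ l) - K"
      have dK: "dK = (\<Sum>l\<in>UNIV. a l * v l * m $ l) + (\<Sum>l\<in>UNIV. a l * w l * y l) + (\<Sum>l\<in>UNIV. a l * v l * y l)"
        unfolding dK_def K fv by (simp add: sum.distrib[symmetric] sum_subtractf[symmetric] algebra_simps)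
      have dKb: "\<bar>dK\<bar> \<le> (A + A * W) * (\<Sum>l\<in>UNIV. \<bar>v l\<bar> + \<bar>y l\<bar>)"
      proof -
        have "dK = (\<Sum>l\<in>UNIV. a l * v l * snd p $ l + a l * w l * y l)"
          unfolding dK fv by (simp add: sum.distrib[symmetric] algebra_simps)
        also have "\<bar>\<dots>\<bar> \<le> (\<Sum>l\<in>UNIV. (A + A * W) * (\<bar>v l\<bar> + \<bar>y l\<bar>))"
        proof (intro order_trans[OF sum_abs] sum_mono)
          fix l
          have "\<bar>a l * v l * snd p $ l\<bar> \<le> A * \<bar>v l\<bar> * 1"
            unfolding abs_mult using A[of l] A0 elim(2) by (intro mult_mono) (auto intro: less_imp_le)
          moreover have "\<bar>a l * w l * y l\<bar> \<le> A * W * \<bar>y l\<bar>"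
            unfolding abs_mult using A[of l] A0 W[of l] w[of l] W0 by (intro mult_mono) auto
          ultimately have "\<bar>a l * v l * snd p $ l + a l * w l * y l\<bar> \<le> A * \<bar>v l\<bar> + A * W * \<bar>y l\<bar>" by linarith
          also have "\<dots> \<le> (A + A * W) * (\<bar>v l\<bar> + \<bar>y l\<bar>)" using A0 W0 by (simp add: algebra_simps)
          finally show "\<bar>a l * v l * snd p $ l + a l * w l * y l\<bar> \<le> (A + A * W) * (\<bar>v l\<bar> + \<bar>y l\<bar>)" .
        qed
        finally show ?thesis by (simp add: sum_distrib_left)
      qed
      have dK2: "dK\<^sup>2 / 2 \<le> (A + A * W)\<^sup>2 * k * ?Q"
      proof -
        have "dK\<^sup>2 \<le> ((A + A * W) * (\<Sum>l\<in>UNIV. \<bar>v l\<bar> + \<bar>y l\<bar>))\<^sup>2"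
          using dKb by (metis abs_ge_zero power2_abs power_mono)
        also have "\<dots> = (A + A * W)\<^sup>2 * (\<Sum>l\<in>UNIV. \<bar>\<bar>v l\<bar> + \<bar>y l\<bar>\<bar>)\<^sup>2" by (simp add: power_mult_distrib)
        also have "\<dots> \<le> (A + A * W)\<^sup>2 * (k * (\<Sum>l\<in>UNIV. (\<bar>v l\<bar> + \<bar>y l\<bar>)\<^sup>2))"
          unfolding k_def by (intro mult_left_mono sum_square_le) auto
        also have "\<dots> \<le> (A + A * W)\<^sup>2 * (k * (\<Sum>l\<in>UNIV. 2 * (v l)\<^sup>2 + 2 * (y l)\<^sup>2))"
        proof (intro mult_left_mono sum_mono k0)
          fix l show "(\<bar>v l\<bar> + \<bar>y l\<bar>)\<^sup>2 \<le> 2 * (v l)\<^sup>2 + 2 * (y l)\<^sup>2"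
            using sum_squares_bound[of "\<bar>v l\<bar>" "\<bar>y l\<bar>"] by (simp add: power2_sum)
        qed auto
        also have "\<dots> = 2 * ((A + A * W)\<^sup>2 * k * ?Q)" by (simp add: sum.distrib sum_distrib_left[symmetric] algebra_simps)
        finally show ?thesis by simp
      qed
      have e3: "\<bar>\<Sum>l\<in>UNIV. w l * (e l - (\<beta> * (a l * K + h)) * y l)\<bar> \<le> W * C * ?Q"
      proof -
        have "\<bar>\<Sum>l\<in>UNIV. w l * (e l - (\<beta> * (a l * K + h)) * y l)\<bar> \<le> (\<Sum>l\<in>UNIV. W * (C * (y l)\<^sup>2))"
        proof (intro order_trans[OF sum_abs] sum_mono)
          fix l show "\<bar>w l * (e l - (\<beta> * (a l * K + h)) * y l)\<bar> \<le> W * (C * (y l)\<^sup>2)"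
            unfolding abs_mult using e1(1)[of l] W[of l] w[of l] W0 by (intro mult_mono) auto
        qed
        also have "\<dots> = W * C * (\<Sum>l\<in>UNIV. (y l)\<^sup>2)" by (simp add: sum_distrib_left mult.assoc)
        also have "\<dots> \<le> W * C * ?Q" using Q(2) W0 C0 by (intro mult_left_mono) auto
        finally show ?thesis .
      qed
      have e4: "\<bar>\<Sum>l\<in>UNIV. v l * e l\<bar> \<le> C * ?Q"
      proof -
        have "\<bar>\<Sum>l\<in>UNIV. v l * e l\<bar> \<le> (\<Sum>l\<in>UNIV. C * (\<bar>v l\<bar> * \<bar>y l\<bar>))"
        proof (intro order_trans[OF sum_abs] sum_mono)
          fix l show "\<bar>v l * e l\<bar> \<le> C * (\<bar>v l\<bar> * \<bar>y l\<bar>)"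
            using mult_left_mono[OF e1(2)[of l], of "\<bar>v l\<bar>"] by (simp add: abs_mult mult_ac)
        qed
        also have "\<dots> \<le> C * ?Q" unfolding sum_distrib_left[symmetric] using Q(1) C0 by (intro mult_left_mono) auto
        finally show ?thesis .
      qed
      have e5: "\<bar>\<Sum>l\<in>UNIV. a l * v l * y l\<bar> \<le> A * ?Q"
      proof -
        have "\<bar>\<Sum>l\<in>UNIV. a l * v l * y l\<bar> \<le> (\<Sum>l\<in>UNIV. A * (\<bar>v l\<bar> * \<bar>y l\<bar>))"
        proof (intro order_trans[OF sum_abs] sum_mono)
          fix l show "\<bar>a l * v l * y l\<bar> \<le> A * (\<bar>v l\<bar> * \<bar>y l\<bar>)"
            using mult_right_mono[OF A[of l], of "\<bar>v l\<bar> * \<bar>y l\<bar>"] by (simp add: abs_mult mult_ac)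
        qed
        also have "\<dots> \<le> A * ?Q" unfolding sum_distrib_left[symmetric] using Q(1) A0 by (intro mult_left_mono) auto
        finally show ?thesis .
      qed
      have e6: "\<bar>\<Sum>l\<in>UNIV. v l * y l\<bar> \<le> ?Q"
        by (rule order_trans[OF sum_abs order_trans[OF _ Q(1)]]) (simp add: abs_mult)
      \<comment> \<open>An exact identity whose right side is of second order throughout: the part
        of the entropy that is linear in \<open>y\<close> has cancelled against the linear parts of
        interaction and field.\<close>
      have decomp: "free_energy a (\<lambda>l. fst p $ l) \<beta> h (snd p) - free_energy a w \<beta> h m - (\<Sum>l\<in>UNIV. g l * (fst p $ l - w l))
          = - (dK\<^sup>2 / 2) - K * (\<Sum>l\<in>UNIV. a l * v l * y l) - h * (\<Sum>l\<in>UNIV. v l * y l)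
            + 1 / \<beta> * ((\<Sum>l\<in>UNIV. w l * (e l - (\<beta> * (a l * K + h)) * y l)) + (\<Sum>l\<in>UNIV. v l * e l))"
      proof -
        have k1: "(\<Sum>l\<in>UNIV. a l * fst p $ l * snd p $ l) = K + dK" by (simp add: dK_def)
        have k2: "(\<Sum>l\<in>UNIV. fst p $ l * snd p $ l)
           = (\<Sum>l\<in>UNIV. w l * m $ l) + (\<Sum>l\<in>UNIV. v l * m $ l) + (\<Sum>l\<in>UNIV. w l * y l) + (\<Sum>l\<in>UNIV. v l * y l)"
          unfolding fv by (simp add: sum.distrib[symmetric] algebra_simps)
        have k3: "(\<Sum>l\<in>UNIV. fst p $ l * cramer_entropy (snd p $ l))
           = (\<Sum>l\<in>UNIV. w l * cramer_entropy (m $ l)) + (\<Sum>l\<in>UNIV. v l * cramer_entropy (m $ l))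
             + ((\<Sum>l\<in>UNIV. w l * (e l - (\<beta> * (a l * K + h)) * y l)) + (\<Sum>l\<in>UNIV. v l * e l))
             + \<beta> * (K * (\<Sum>l\<in>UNIV. a l * w l * y l) + h * (\<Sum>l\<in>UNIV. w l * y l))"
          unfolding sum_distrib_left sum.distrib[symmetric]
          by (intro sum.cong refl) (simp add: e_def v_def algebra_simps)
        have k4: "(\<Sum>l\<in>UNIV. g l * (fst p $ l - w l)) = - K * (\<Sum>l\<in>UNIV. a l * v l * m $ l) - h * (\<Sum>l\<in>UNIV. v l * m $ l)
            + 1 / \<beta> * (\<Sum>l\<in>UNIV. v l * cramer_entropy (m $ l))"
          unfolding sum_distrib_left sum.distrib[symmetric] sum_subtractf[symmetric]
          by (intro sum.cong refl) (simp add: g_def v_def algebra_simps)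
        have k5: "(\<Sum>l\<in>UNIV. a l * w l * m $ l) = K" by (simp add: K)
        have k6: "K * dK = K * (\<Sum>l\<in>UNIV. a l * v l * m $ l) + K * (\<Sum>l\<in>UNIV. a l * w l * y l) + K * (\<Sum>l\<in>UNIV. a l * v l * y l)"
          unfolding dK by (simp add: algebra_simps)
        have alg: "- (1 / 2) * (K + d)\<^sup>2 - h * (x0 + x1 + x2 + x3) + 1 / \<beta> * (z0 + z1 + z2 + \<beta> * (K * q2 + h * x2))
           - (- (1 / 2) * K\<^sup>2 - h * x0 + 1 / \<beta> * z0) - (- K * q1 - h * x1 + 1 / \<beta> * z1)
           = - (d\<^sup>2 / 2) - K * q3 - h * x3 + 1 / \<beta> * z2" if "K * d = K * q1 + K * q2 + K * q3"
          for d x0 x1 x2 x3 z0 z1 z2 q1 q2 q3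
        proof -
          have "1 / \<beta> * (z0 + z1 + z2 + \<beta> * (K * q2 + h * x2)) = 1 / \<beta> * z0 + 1 / \<beta> * z1 + 1 / \<beta> * z2 + (K * q2 + h * x2)"
            using \<beta> by (simp add: field_simps)
          moreover have "(K + d)\<^sup>2 = K\<^sup>2 + 2 * (K * d) + d\<^sup>2" by (simp add: power2_sum)
          ultimately show ?thesis using that by (simp add: algebra_simps)
        qed
        show ?thesis unfolding free_energy_def k1 k2 k3 k4 k5 by (rule alg[OF k6])
      qed
      have "\<bar>1 / \<beta> * ((\<Sum>l\<in>UNIV. w l * (e l - (\<beta> * (a l * K + h)) * y l)) + (\<Sum>l\<in>UNIV. v l * e l))\<bar>
         \<le> 1 / \<beta> * (W * C * ?Q + C * ?Q)"
        unfolding abs_mult using e3 e4 \<beta> by (intro mult_mono) auto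
      moreover have "\<bar>K * (\<Sum>l\<in>UNIV. a l * v l * y l)\<bar> \<le> \<bar>K\<bar> * (A * ?Q)"
        unfolding abs_mult using e5 by (intro mult_left_mono) auto
      moreover have "\<bar>h * (\<Sum>l\<in>UNIV. v l * y l)\<bar> \<le> \<bar>h\<bar> * ?Q"
        unfolding abs_mult using e6 by (intro mult_left_mono) auto
      moreover have "0 \<le> dK\<^sup>2 / 2" by simp
      ultimately have "\<bar>free_energy a (\<lambda>l. fst p $ l) \<beta> h (snd p) - free_energy a w \<beta> h m - (\<Sum>l\<in>UNIV. g l * (fst p $ l - w l))\<bar>
        \<le> (A + A * W)\<^sup>2 * k * ?Q + \<bar>K\<bar> * (A * ?Q) + \<bar>h\<bar> * ?Q + 1 / \<beta> * (W * C * ?Q + C * ?Q)"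
        unfolding decomp using dK2 by linarith
      also have "\<dots> = C' * ?Q" unfolding C'_def using \<beta> by (simp add: field_simps)
      finally show ?case unfolding v_def y_def .
    qed
  qed
qed

section \<open>Expansion of the free energy at almost local minima\<close>

context finite_volume
begin

text \<open>Away from the faces of the cube the Stirling terms in \<open>1 - x\<close> and
  \<open>1 + x\<close> are bounded. The remaining logarithms of the class sizes are unbounded but do
  not depend on \<open>x\<close>, so they drop out of energy differences.\<close>

lemma free_energy_n_stirling:
  assumes x: "x \<in> grid a j n" and \<delta>: "0 < \<delta>" and b: "\<And>l. \<bar>x $ l\<bar> \<le> 1 - \<delta>"
  shows "\<bar>real n * F x - real n * free_energy a (freq a j n) \<beta> h x - (\<Sum>l\<in>UNIV. ln (real (N l))) / (2 * \<beta>)\<bar>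
    \<le> real CARD('k) * ((2 + ln (4 / \<delta>)) / \<beta>)"
proof -
  define r where "r l = site l (x $ l) + h * real (N l) * x $ l - 1 / \<beta> * (real (N l) * cramer_entropy (x $ l))
     - ln (real (N l)) / (2 * \<beta>)" for l
  have r: "\<bar>r l\<bar> \<le> (2 + ln (4 / \<delta>)) / \<beta>" for l
  proof -
    obtain i where i: "i \<le> N l" "x $ l = - 1 + 2 * real i / real (N l)" using gridE[OF x] .
    have M: "0 < real (N l)" using size_pos by simp
    have bl: "- 1 < x $ l" "x $ l < 1" using b[of l] \<delta> by (auto simp: abs_le_iff)
    have ip: "0 < i" using bl(1) M unfolding i(2) by (auto simp: zero_less_divide_iff)
    have iN: "i < N l"
    proof (rule ccontr)
      assume "\<not> i < N l"
      then have "i = N l" using i(1) by simp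
      then show False using bl(2) M unfolding i(2) by simp
    qed
    have st: "\<bar>ln (real (N l choose i)) + real (N l) * cramer_entropy (x $ l) + ln (real (N l)) / 2
        + ln ((1 - x $ l) / 2 * ((1 + x $ l) / 2)) / 2\<bar> \<le> 2"
      using ln_binomial_stirling[OF ip iN] unfolding i(2) .
    have lo: "\<delta> / 4 \<le> (1 - x $ l) / 2 * ((1 + x $ l) / 2)"
    proof -
      have "\<delta> * 1 \<le> (1 - \<bar>x $ l\<bar>) * (1 + \<bar>x $ l\<bar>)" using b[of l] \<delta> by (intro mult_mono) auto
      also have "\<dots> = (1 - x $ l) * (1 + x $ l)" by (simp add: algebra_simps abs_mult_self_eq)
      finally show ?thesis by simp
    qed
    have up: "(1 - x $ l) / 2 * ((1 + x $ l) / 2) \<le> 1"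
      using bl mult_mono[of "(1 - x $ l) / 2" 1 "(1 + x $ l) / 2" 1] by simp
    have d4: "0 < \<delta> / 4" using \<delta> by simp
    have "ln (\<delta> / 4) \<le> ln ((1 - x $ l) / 2 * ((1 + x $ l) / 2))" using lo d4 by (subst ln_le_cancel_iff) auto
    moreover have "ln ((1 - x $ l) / 2 * ((1 + x $ l) / 2)) \<le> 0" using lo up d4 by (subst ln_le_zero_iff) linarith+
    moreover have "ln (\<delta> / 4) = - ln (4 / \<delta>)" using \<delta> by (simp add: ln_div)
    ultimately have st2: "\<bar>ln (real (N l choose i)) + real (N l) * cramer_entropy (x $ l) + ln (real (N l)) / 2\<bar> \<le> 2 + ln (4 / \<delta>)"
      using st by linarith
    have "site l (x $ l) = - h * real (N l) * x $ l - 1 / \<beta> * ln (real (N l choose i))"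
      unfolding site_def i(2) floor_coordinate ..
    then have "r l = - (1 / \<beta>) * (ln (real (N l choose i)) + real (N l) * cramer_entropy (x $ l) + ln (real (N l)) / 2)"
      unfolding r_def by (simp add: algebra_simps)
    then have "\<bar>r l\<bar> = 1 / \<beta> * \<bar>ln (real (N l choose i)) + real (N l) * cramer_entropy (x $ l) + ln (real (N l)) / 2\<bar>"
      using beta_pos by (simp add: abs_mult)
    also have "\<dots> \<le> 1 / \<beta> * (2 + ln (4 / \<delta>))" using st2 beta_pos by (intro mult_left_mono) auto
    finally show ?thesis by simp
  qed
  have "real n * free_energy a (freq a j n) \<beta> h x = - (real n / 2) * (mag x)\<^sup>2
     - (\<Sum>l\<in>UNIV. h * real (N l) * x $ l) + (\<Sum>l\<in>UNIV. 1 / \<beta> * (real (N l) * cramer_entropy (x $ l)))"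
  proof -
    have "(\<Sum>l\<in>UNIV. h * real (N l) * x $ l) = real n * (h * (\<Sum>l\<in>UNIV. freq a j n l * x $ l))"
      using n_pos unfolding sum_distrib_left by (intro sum.cong refl) (simp add: freq_def)
    moreover have "(\<Sum>l\<in>UNIV. 1 / \<beta> * (real (N l) * cramer_entropy (x $ l)))
        = real n * (1 / \<beta> * (\<Sum>l\<in>UNIV. freq a j n l * cramer_entropy (x $ l)))"
      using n_pos unfolding sum_distrib_left by (intro sum.cong refl) (simp add: freq_def)
    ultimately show ?thesis unfolding free_energy_def mag_def by (simp add: algebra_simps)
  qed
  then have "real n * F x - real n * free_energy a (freq a j n) \<beta> h x - (\<Sum>l\<in>UNIV. ln (real (N l))) / (2 * \<beta>) = (\<Sum>l\<in>UNIV. r l)"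
    unfolding free_energy_n_eq[OF x] r_def by (simp add: sum.distrib sum_subtractf sum_divide_distrib)
  also have "\<bar>\<dots>\<bar> \<le> (\<Sum>l\<in>(UNIV::'k set). (2 + ln (4 / \<delta>)) / \<beta>)" by (intro order_trans[OF sum_abs] sum_mono r)
  finally show ?thesis by simp
qed

end

text \<open>The partial derivative of \<open>free_energy a w \<beta> h m\<close> in
  \<open>w l\<close> at fixed \<open>m\<close>.\<close>

definition linear_response :: "('k::finite \<Rightarrow> real) \<Rightarrow> ('k \<Rightarrow> real) \<Rightarrow> real \<Rightarrow> real \<Rightarrow> real^'k \<Rightarrow> 'k \<Rightarrow> real" where
  "linear_response a w \<beta> h m l =
     - (\<Sum>i\<in>UNIV. a i * w i * m $ i) * a l * m $ l - h * m $ l + cramer_entropy (m $ l) / \<beta>"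

text \<open>By Legendre duality the terms that contain \<open>tanh\<close> cancel.\<close>

lemma linear_response_eq:
  assumes m: "m \<in> critical_points a w \<beta> h" and \<beta>: "0 < \<beta>" and w: "0 < w l"
  shows "linear_response a w \<beta> h m l = - ln (2 * cosh (\<beta> * (a l * (\<Sum>i\<in>UNIV. a i * w i * m $ i) + h))) / \<beta>"
proof -
  define K where "K = (\<Sum>i\<in>UNIV. a i * w i * m $ i)"
  define u where "u = \<beta> * (a l * K + h)"
  have ml: "m $ l = tanh u" unfolding u_def K_def by (rule critical_point_tanh(1)[OF m \<beta> w])
  have "linear_response a w \<beta> h m l = - (a l * K + h) * tanh u + (u * tanh u - ln (2 * cosh u)) / \<beta>"
    unfolding linear_response_def K_def[symmetric] ml cramer_entropy_tanh by (simp add: algebra_simps)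
  also have "\<dots> = - ln (2 * cosh u) / \<beta>" unfolding u_def using \<beta> by (simp add: field_simps)
  finally show ?thesis unfolding u_def K_def .
qed

text \<open>Deterministic and uniform in the realisation \<open>j\<close> and in \<open>n\<close>,
  so that probability enters only through the convergence of frequencies and points. For i.i.d.
  couplings the quantity that bounds the remainder has bounded mean.\<close>

lemma local_expansion:
  fixes a w :: "'k::finite \<Rightarrow> real" and m :: "real^'k"
  assumes \<beta>: "0 < \<beta>" and w: "\<And>l. 0 < w l" "(\<Sum>l\<in>UNIV. w l) = 1"
    and m: "m \<in> critical_points a w \<beta> h" and \<kappa>: "0 \<le> \<kappa>"
    and T1: "(\<Sum>l\<in>UNIV. (a l)\<^sup>2 * w l * (\<beta> * (1 - (m $ l)\<^sup>2))) \<noteq> 1"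
  shows "\<exists>C\<ge>0. \<forall>\<^sub>F p in nhds (\<chi> l. w l, m). \<forall>j n x. 0 < n \<and> p = (\<chi> l. freq a j n l, x) \<and> almost_local_min a \<beta> h j n \<kappa> x \<longrightarrow>
    \<bar>real n * free_energy_n a \<beta> h j n x - real n * free_energy a w \<beta> h m
      - real n * (\<Sum>l\<in>UNIV. linear_response a w \<beta> h m l * (freq a j n l - w l))
      - (\<Sum>l\<in>UNIV. ln (real (class_size a j n l))) / (2 * \<beta>)\<bar>
    \<le> C * (1 + real n * (\<Sum>l\<in>UNIV. (freq a j n l - w l)\<^sup>2))"
proof -
  let ?p0 = "(\<chi> l. w l, m)"
  define K where "K = (\<Sum>i\<in>UNIV. a i * w i * m $ i)"
  have m1: "\<bar>m $ l\<bar> < 1" for l using m by (auto simp: critical_points_def)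
  note mt = critical_point_tanh[OF m \<beta> w(1), folded K_def]
  define A where "A = Max (range (\<lambda>l. \<bar>a l\<bar>))"
  have A: "\<bar>a l\<bar> \<le> A" for l unfolding A_def by (rule Max_ge) auto
  obtain C1 where C1: "0 \<le> C1" and ev1: "\<forall>\<^sub>F p in nhds ?p0. \<forall>\<eta>.
     (\<forall>l. \<bar>snd p $ l - tanh (\<beta> * (a l * (\<Sum>i\<in>UNIV. a i * fst p $ i * snd p $ i) + h))\<bar> \<le> \<eta>) \<longrightarrow>
     (\<forall>l. \<bar>snd p $ l - m $ l\<bar> \<le> C1 * ((\<Sum>i\<in>UNIV. \<bar>fst p $ i - w i\<bar>) + \<eta>))"
    using stability_of_critical_point[OF \<beta> w A mt(1) K_def T1] by blast
  obtain C2 where C2: "0 \<le> C2" and ev2: "\<forall>\<^sub>F p in nhds ?p0.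
     \<bar>free_energy a (\<lambda>l. fst p $ l) \<beta> h (snd p) - free_energy a w \<beta> h m - (\<Sum>l\<in>UNIV. linear_response a w \<beta> h m l * (fst p $ l - w l))\<bar>
     \<le> C2 * ((\<Sum>l\<in>UNIV. (fst p $ l - w l)\<^sup>2) + (\<Sum>l\<in>UNIV. (snd p $ l - m $ l)\<^sup>2))"
    using free_energy_expansion[OF \<beta> w(1) A m1 K_def mt(2)] unfolding linear_response_def K_def by blast
  define \<delta> where "\<delta> = Min (range (\<lambda>l. (1 - \<bar>m $ l\<bar>) / 2))"
  have \<delta>: "0 < \<delta>" unfolding \<delta>_def using m1 by (subst Min_gr_iff) auto
  have \<delta>l: "\<bar>m $ l\<bar> < 1 - \<delta>" for l
  proof -
    have half: "d \<le> (1 - y) / 2 \<Longrightarrow> y < 1 \<Longrightarrow> y < 1 - d" for d y :: real by (simp add: field_simps)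
    have "\<delta> \<le> (1 - \<bar>m $ l\<bar>) / 2" unfolding \<delta>_def by (rule Min_le) auto
    then show ?thesis by (rule half) (rule m1)
  qed
  define v where "v = Min (range (\<lambda>l. w l / 2))"
  have v: "0 < v" unfolding v_def using w by (subst Min_gr_iff) auto
  have vl: "v < w l" for l
  proof -
    have "v \<le> w l / 2" unfolding v_def by (rule Min_le) auto
    then show ?thesis using w(1)[of l] by linarith
  qed
  have ev3: "\<forall>\<^sub>F p in nhds ?p0. \<forall>l\<in>UNIV. \<bar>snd p $ l\<bar> < 1 - \<delta>"
    by (intro eventually_ball_finite ballI order_tendstoD(2)[OF tendsto_rabs[OF nhds_prod_components(2)]] \<delta>l) simp
  have ev4: "\<forall>\<^sub>F p in nhds ?p0. \<forall>l\<in>UNIV. v < fst p $ l"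
    by (intro eventually_ball_finite ballI order_tendstoD(1)[OF nhds_prod_components(1)]) (use vl in auto)
  define k where "k = real CARD('k)"
  have k1: "1 \<le> k" by (simp add: k_def Suc_leI)
  define c where "c = \<beta> * \<kappa> / 2 + 1 / (v * \<delta>)"
  have c0: "0 \<le> c" unfolding c_def using \<beta> \<kappa> v \<delta> by simp
  define C3 where "C3 = k * ((2 + ln (4 / \<delta>)) / \<beta>)"
  define C where "C = \<bar>C3\<bar> + C2 * (1 + 2 * k * C1\<^sup>2 * k + 2 * k * C1\<^sup>2 * c\<^sup>2)"
  have C0: "0 \<le> C" unfolding C_def using C2 k1 by simp
  show ?thesis
  proof (intro exI[of _ C] conjI C0)
    show "\<forall>\<^sub>F p in nhds ?p0. \<forall>j n x. 0 < n \<and> p = (\<chi> l. freq a j n l, x) \<and> almost_local_min a \<beta> h j n \<kappa> x \<longrightarrow>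
    \<bar>real n * free_energy_n a \<beta> h j n x - real n * free_energy a w \<beta> h m
      - real n * (\<Sum>l\<in>UNIV. linear_response a w \<beta> h m l * (freq a j n l - w l))
      - (\<Sum>l\<in>UNIV. ln (real (class_size a j n l))) / (2 * \<beta>)\<bar>
    \<le> C * (1 + real n * (\<Sum>l\<in>UNIV. (freq a j n l - w l)\<^sup>2))"
      using ev1 ev2 ev3 ev4
    proof eventually_elim
      case (elim p)
      show ?case
      proof (intro allI impI, elim conjE)
        fix j n x
        assume n: "0 < n" and p: "p = (\<chi> l. freq a j n l, x)" and x: "almost_local_min a \<beta> h j n \<kappa> x"
        have fst: "fst p $ l = freq a j n l" and snd: "snd p $ l = x $ l" "snd p = x" for l unfolding p by simp_all
        have fr: "v < freq a j n l" for l using elim(4) unfolding fst by simp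
        \<comment> \<open>Frequencies close to positive weights force the classes to be
          non-empty.\<close>
        have cs: "0 < class_size a j n l" for l
          using fr[of l] v by (cases "class_size a j n l = 0") (auto simp: freq_def)
        interpret finite_volume a \<beta> h j n by unfold_locales (use n cs \<beta> in auto)
        have nr: "0 < real n" "1 \<le> real n" using n by auto
        have xb: "\<bar>x $ l\<bar> \<le> 1 - \<delta>" for l using elim(3) unfolding snd by (simp add: less_imp_le)
        have Nv: "v * real n \<le> real (N l)" for l
          using fr[of l] nr unfolding freq_def by (simp add: field_simps)
        define \<eta> where "\<eta> = c / real n"
        let ?v = "\<lambda>l. freq a j n l - w l"
        have tn: "\<bar>x $ l - tanh (\<beta> * (a l * mag x + h))\<bar> \<le> \<eta>" for l
          unfolding \<eta>_def c_def by (rule almost_local_min_tanh[OF x \<delta> xb v Nv])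
        have dev: "\<bar>x $ l - m $ l\<bar> \<le> C1 * ((\<Sum>i\<in>UNIV. \<bar>?v i\<bar>) + \<eta>)" for l
          using elim(1)[rule_format, of \<eta> l] tn unfolding fst snd mag_def by blast
        have \<eta>0: "0 \<le> \<eta>" unfolding \<eta>_def using c0 by simp
        \<comment> \<open>After multiplication by \<open>n\<close>, the frequencies contribute their
          own squared fluctuation, while the error of order \<open>1 / n\<close> in the mean-field
          equation contributes at most a constant.\<close>
        have S1: "real n * (\<Sum>l\<in>UNIV. (x $ l - m $ l)\<^sup>2) \<le> 2 * k * C1\<^sup>2 * (k * (real n * (\<Sum>l\<in>UNIV. (?v l)\<^sup>2)) + c\<^sup>2)"
        proof -
          define V where "V = (\<Sum>i\<in>UNIV. \<bar>?v i\<bar>)"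
          have V2: "V\<^sup>2 \<le> k * (\<Sum>l\<in>UNIV. (?v l)\<^sup>2)" unfolding V_def k_def by (rule sum_square_le)
          have "(\<Sum>l\<in>UNIV. (x $ l - m $ l)\<^sup>2) \<le> (\<Sum>l\<in>(UNIV::'k set). (C1 * (V + \<eta>))\<^sup>2)"
          proof (rule sum_mono)
            fix l show "(x $ l - m $ l)\<^sup>2 \<le> (C1 * (V + \<eta>))\<^sup>2"
              using dev[of l] unfolding V_def by (metis abs_ge_zero power2_abs power_mono)
          qed
          also have "\<dots> = k * C1\<^sup>2 * (V + \<eta>)\<^sup>2" by (simp add: k_def power_mult_distrib)
          also have "\<dots> \<le> k * C1\<^sup>2 * (2 * V\<^sup>2 + 2 * \<eta>\<^sup>2)"
            using sum_squares_bound[of V \<eta>] k1 by (intro mult_left_mono) (auto simp: power2_sum)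
          also have "\<dots> \<le> k * C1\<^sup>2 * (2 * (k * (\<Sum>l\<in>UNIV. (?v l)\<^sup>2)) + 2 * \<eta>\<^sup>2)"
            using V2 k1 by (intro mult_left_mono) auto
          finally have "real n * (\<Sum>l\<in>UNIV. (x $ l - m $ l)\<^sup>2) \<le> real n * (k * C1\<^sup>2 * (2 * (k * (\<Sum>l\<in>UNIV. (?v l)\<^sup>2)) + 2 * \<eta>\<^sup>2))"
            by (intro mult_left_mono) auto
          also have "\<dots> = 2 * k * C1\<^sup>2 * (k * (real n * (\<Sum>l\<in>UNIV. (?v l)\<^sup>2)) + real n * \<eta>\<^sup>2)" by (simp add: algebra_simps)
          also have "\<dots> \<le> 2 * k * C1\<^sup>2 * (k * (real n * (\<Sum>l\<in>UNIV. (?v l)\<^sup>2)) + c\<^sup>2)"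
          proof -
            have "real n * \<eta>\<^sup>2 = c\<^sup>2 / real n" unfolding \<eta>_def using nr by (simp add: power2_eq_square)
            also have "\<dots> \<le> c\<^sup>2" using nr by (simp add: divide_le_eq mult_le_cancel_left1)
            finally show ?thesis using k1 by (intro mult_left_mono add_left_mono) auto
          qed
          finally show ?thesis .
        qed
        let ?G = "\<Sum>l\<in>UNIV. linear_response a w \<beta> h m l * ?v l"
        have ex: "\<bar>real n * (free_energy a (freq a j n) \<beta> h x - free_energy a w \<beta> h m - ?G)\<bar>
           \<le> real n * (C2 * ((\<Sum>l\<in>UNIV. (?v l)\<^sup>2) + (\<Sum>l\<in>UNIV. (x $ l - m $ l)\<^sup>2)))"
          using elim(2) unfolding fst snd abs_mult by (intro mult_mono) auto
        also have "\<dots> = C2 * (real n * (\<Sum>l\<in>UNIV. (?v l)\<^sup>2) + real n * (\<Sum>l\<in>UNIV. (x $ l - m $ l)\<^sup>2))" by (simp add: algebra_simps)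
        also have "\<dots> \<le> C2 * (real n * (\<Sum>l\<in>UNIV. (?v l)\<^sup>2) + 2 * k * C1\<^sup>2 * (k * (real n * (\<Sum>l\<in>UNIV. (?v l)\<^sup>2)) + c\<^sup>2))"
          using S1 C2 by (intro mult_left_mono add_left_mono) auto
        finally have ex2: "\<bar>real n * (free_energy a (freq a j n) \<beta> h x - free_energy a w \<beta> h m - ?G)\<bar>
           \<le> C2 * (real n * (\<Sum>l\<in>UNIV. (?v l)\<^sup>2) + 2 * k * C1\<^sup>2 * (k * (real n * (\<Sum>l\<in>UNIV. (?v l)\<^sup>2)) + c\<^sup>2))" .
        have xg: "x \<in> grid a j n" using x unfolding almost_local_min_def by auto
        have st: "\<bar>real n * F x - real n * free_energy a (freq a j n) \<beta> h x - (\<Sum>l\<in>UNIV. ln (real (N l))) / (2 * \<beta>)\<bar> \<le> C3"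
          unfolding C3_def k_def by (rule free_energy_n_stirling[OF xg \<delta> xb])
        define q where "q = real n * (\<Sum>l\<in>UNIV. (?v l)\<^sup>2)"
        have q0: "0 \<le> q" unfolding q_def by (intro mult_nonneg_nonneg sum_nonneg) auto
        have "\<bar>real n * F x - real n * free_energy a w \<beta> h m - real n * ?G - (\<Sum>l\<in>UNIV. ln (real (N l))) / (2 * \<beta>)\<bar>
            \<le> C3 + C2 * (q + 2 * k * C1\<^sup>2 * (k * q + c\<^sup>2))"
          using st ex2 unfolding q_def[symmetric] right_diff_distrib by linarith
        also have "\<dots> \<le> C * (1 + q)"
        proof -
          define B where "B = 2 * k * C1\<^sup>2"
          have B0: "0 \<le> B" unfolding B_def using k1 by simp
          have "C2 * (q + B * (k * q + c\<^sup>2)) \<le> C2 * ((1 + B * k + B * c\<^sup>2) * (1 + q))"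
          proof (rule mult_left_mono[OF _ C2])
            have "0 \<le> 1 + B * k + B * c\<^sup>2 * q" using B0 k1 q0 by (intro add_nonneg_nonneg mult_nonneg_nonneg) auto
            then show "q + B * (k * q + c\<^sup>2) \<le> (1 + B * k + B * c\<^sup>2) * (1 + q)" by (simp add: algebra_simps)
          qed
          moreover have "C3 \<le> \<bar>C3\<bar> * (1 + q)"
          proof -
            have "0 \<le> \<bar>C3\<bar> * q" using q0 by simp
            then show ?thesis by (simp add: distrib_left)
          qed
          ultimately show ?thesis unfolding C_def B_def[symmetric] by (simp add: algebra_simps)
        qed
        finally show "\<bar>real n * F x - real n * free_energy a w \<beta> h m - real n * ?G - (\<Sum>l\<in>UNIV. ln (real (N l))) / (2 * \<beta>)\<bar>
           \<le> C * (1 + real n * (\<Sum>l\<in>UNIV. (?v l)\<^sup>2))" unfolding q_def .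
      qed
    qed
  qed
qed

text \<open>The bound is the energy at the origin. At a critical point without field the weighted
  sum of \<open>u l * tanh (u l)\<close> equals \<open>\<beta> * K\<^sup>2\<close>, so the energy is
  \<open>K\<^sup>2 / 2\<close> minus the weighted mean of
  \<open>ln (2 * cosh (u l)) / \<beta>\<close>, and \<open>ln_cosh_gt_half\<close> applies.\<close>

lemma critical_free_energy_less:
  fixes a w :: "'k::finite \<Rightarrow> real" and m :: "real^'k"
  assumes \<beta>: "0 < \<beta>" and w: "\<And>l. 0 < w l" "(\<Sum>l\<in>UNIV. w l) = 1"
    and m: "m \<in> critical_points a w \<beta> 0" and K: "(\<Sum>i\<in>UNIV. a i * w i * m $ i) \<noteq> 0"
  shows "free_energy a w \<beta> 0 m < - (ln 2 / \<beta>)"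
proof -
  define K where "K = (\<Sum>i\<in>UNIV. a i * w i * m $ i)"
  define u where "u l = \<beta> * (a l * K)" for l
  have mu: "m $ l = tanh (u l)" for l
    using critical_point_tanh(1)[OF m \<beta> w(1), of l] unfolding u_def K_def by simp
  obtain l0 where l0: "a l0 \<noteq> 0"
    using K by (metis (mono_tags, lifting) mult_zero_left sum.neutral)
  have e: "(\<Sum>l\<in>UNIV. w l * cramer_entropy (m $ l))
      = (\<Sum>l\<in>UNIV. w l * (u l * tanh (u l))) - (\<Sum>l\<in>UNIV. w l * ln (cosh (u l))) - ln 2"
  proof -
    have "w l * cramer_entropy (m $ l) = w l * (u l * tanh (u l)) - w l * ln (cosh (u l)) - w l * ln 2" for l
      unfolding mu cramer_entropy_tanh by (simp add: ln_mult algebra_simps)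
    then show ?thesis using w(2) by (simp add: sum_subtractf sum_distrib_right[symmetric])
  qed
  have ut: "(\<Sum>l\<in>UNIV. w l * (u l * tanh (u l))) = \<beta> * K\<^sup>2"
  proof -
    have "(\<Sum>l\<in>UNIV. w l * (u l * tanh (u l))) = \<beta> * K * (\<Sum>l\<in>UNIV. a l * w l * m $ l)"
      unfolding sum_distrib_left mu u_def by (intro sum.cong refl) (simp add: mult_ac)
    then show ?thesis unfolding K_def[symmetric] by (simp add: power2_eq_square)
  qed
  have "(\<Sum>l\<in>UNIV. w l * (u l * tanh (u l) / 2)) < (\<Sum>l\<in>UNIV. w l * ln (cosh (u l)))"
  proof (rule sum_strict_mono_ex1)
    show "\<forall>l\<in>UNIV. w l * (u l * tanh (u l) / 2) \<le> w l * ln (cosh (u l))"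
    proof
      fix l show "w l * (u l * tanh (u l) / 2) \<le> w l * ln (cosh (u l))"
        using ln_cosh_gt_half[of "u l"] w(1)[of l] by (cases "u l = 0") (auto intro!: mult_left_mono less_imp_le)
    qed
    have "u l0 \<noteq> 0" using l0 \<beta> K unfolding u_def K_def by simp
    then show "\<exists>l\<in>UNIV. w l * (u l * tanh (u l) / 2) < w l * ln (cosh (u l))"
      using ln_cosh_gt_half[of "u l0"] w(1)[of l0] by (intro bexI[of _ l0] mult_strict_left_mono) auto
  qed simp
  also have "(\<Sum>l\<in>UNIV. w l * (u l * tanh (u l) / 2)) = \<beta> * K\<^sup>2 / 2"
    unfolding ut[symmetric] by (simp add: sum_divide_distrib)
  finally have "\<beta> * K\<^sup>2 / 2 < (\<Sum>l\<in>UNIV. w l * ln (cosh (u l)))" .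
  moreover have "free_energy a w \<beta> 0 m = - (1 / 2) * K\<^sup>2 + 1 / \<beta> * (\<beta> * K\<^sup>2 - (\<Sum>l\<in>UNIV. w l * ln (cosh (u l))) - ln 2)"
    unfolding free_energy_def e ut K_def[symmetric] by simp
  ultimately show ?thesis using \<beta> by (simp add: field_simps)
qed

section \<open>Fluctuations of the empirical frequencies\<close>

lemma whp_mono: "whp M P \<Longrightarrow> (\<And>n x. P n x \<Longrightarrow> Q n x) \<Longrightarrow> whp M Q"
  unfolding whp_def by blast

lemma whp_conj:
  assumes M: "prob_space M" and "whp M P" "whp M Q"
  shows "whp M (\<lambda>n x. P n x \<and> Q n x)"
proof -
  interpret prob_space M by fact
  obtain E where E: "\<And>n. E n \<in> sets M" "(\<lambda>n. prob (E n)) \<longlonglongrightarrow> 1" "\<And>n x. x \<in> E n \<Longrightarrow> P n x"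
    using assms(2) unfolding whp_def by blast
  obtain G where G: "\<And>n. G n \<in> sets M" "(\<lambda>n. prob (G n)) \<longlonglongrightarrow> 1" "\<And>n x. x \<in> G n \<Longrightarrow> Q n x"
    using assms(3) unfolding whp_def by blast
  have "(\<lambda>n. prob (E n \<inter> G n)) \<longlonglongrightarrow> 1"
  proof (rule tendsto_sandwich)
    show "(\<lambda>n. prob (E n) + prob (G n) - 1) \<longlonglongrightarrow> 1"
      using tendsto_diff[OF tendsto_add[OF E(2) G(2)] tendsto_const[of 1]] by simp
    show "\<forall>\<^sub>F n in sequentially. prob (E n) + prob (G n) - 1 \<le> prob (E n \<inter> G n)"
    proof (rule always_eventually, rule allI)
      fix n
      have "prob (E n \<union> G n) = prob (E n) + prob (G n) - prob (E n \<inter> G n)"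
        using measure_Un3[of "E n" M "G n"] E(1) G(1) by (simp add: fmeasurable_eq_sets)
      then show "prob (E n) + prob (G n) - 1 \<le> prob (E n \<inter> G n)" using prob_le_1[of "E n \<union> G n"] by linarith
    qed
    show "\<forall>\<^sub>F n in sequentially. prob (E n \<inter> G n) \<le> 1" by simp
  qed simp
  then show ?thesis unfolding whp_def using E G by (intro exI[of _ "\<lambda>n. E n \<inter> G n"]) auto
qed

lemma whp_eventually_sequentially:
  assumes M: "prob_space M" and "\<forall>\<^sub>F n in sequentially. P n"
  shows "whp M (\<lambda>n x. P n)"
proof -
  interpret prob_space M by fact
  show ?thesis unfolding whp_def
  proof (intro exI[of _ "\<lambda>n. if P n then space M else {}"] conjI)
    show "(\<lambda>n. prob (if P n then space M else {})) \<longlonglongrightarrow> 1"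
      by (rule tendsto_eventually) (use assms(2) in eventually_elim, simp add: prob_space)
  qed auto
qed

text \<open>A contradiction derived on typical events thereby refutes a deterministic assumption on
  the limits, such as degeneracy.\<close>

lemma whp_False:
  assumes "prob_space M" shows "\<not> whp M (\<lambda>n x. False)"
proof
  assume "whp M (\<lambda>n x. False)"
  then obtain E where E: "(\<lambda>n. measure M (E n)) \<longlonglongrightarrow> 1" "\<And>n x. x \<notin> E n" unfolding whp_def by blast
  have "E n = {}" for n using E(2) by blast
  then have "(\<lambda>n::nat. 0::real) \<longlonglongrightarrow> 1" using E(1) by simp
  then show False by (simp add: LIMSEQ_const_iff)
qed

text \<open>Carries statements about a neighbourhood of the limit over to typical events; the
  deterministic lemmas are phrased with \<open>nhds\<close> for this purpose.\<close>

lemma converges_in_prob_eventually: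
  assumes "converges_in_prob M X c" "\<forall>\<^sub>F p in nhds c. P p"
  shows "whp M (\<lambda>n x. P (X n x))"
proof -
  obtain d where d: "0 < d" "\<And>p. dist p c < d \<Longrightarrow> P p" using assms(2) unfolding eventually_nhds_metric by blast
  then show ?thesis using assms(1) unfolding converges_in_prob_def by (blast intro: whp_mono)
qed

lemma converges_in_prob_Pair:
  assumes M: "prob_space M" and X: "converges_in_prob M X c" and Y: "converges_in_prob M Y d"
  shows "converges_in_prob M (\<lambda>n x. (X n x, Y n x)) (c, d)"
  unfolding converges_in_prob_def
proof (intro allI impI)
  fix \<epsilon> :: real assume \<epsilon>: "0 < \<epsilon>"
  then have half: "0 < \<epsilon> / 2" by simp
  have "whp M (\<lambda>n x. dist (X n x) c < \<epsilon> / 2 \<and> dist (Y n x) d < \<epsilon> / 2)"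
    by (rule whp_conj[OF M X[unfolded converges_in_prob_def, rule_format, OF half]
        Y[unfolded converges_in_prob_def, rule_format, OF half]])
  then show "whp M (\<lambda>n x. dist (X n x, Y n x) (c, d) < \<epsilon>)"
  proof (rule whp_mono)
    fix n x assume *: "dist (X n x) c < \<epsilon> / 2 \<and> dist (Y n x) d < \<epsilon> / 2"
    have "dist (X n x, Y n x) (c, d) \<le> dist (X n x) c + dist (Y n x) d"
      unfolding dist_prod_def using sqrt_sum_squares_le_sum[of "dist (X n x) c" "dist (Y n x) d"] by simp
    then show "dist (X n x, Y n x) (c, d) < \<epsilon>" using * by linarith
  qed
qed

text \<open>The bound may fail off the typical events, but their complements have vanishing
  probability and are absorbed into half of \<epsilon> for large \<open>n\<close>.\<close>

lemma bounded_in_prob_whp_le: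
  assumes M: "prob_space M" and V: "bounded_in_prob M V" "\<And>n. V n \<in> borel_measurable M"
    and E: "whp M (\<lambda>n x. \<bar>E n x\<bar> \<le> C * (1 + \<bar>V n x\<bar>))" "\<And>n. E n \<in> borel_measurable M" and C: "0 \<le> C"
  shows "bounded_in_prob M E"
  unfolding bounded_in_prob_def
proof (intro allI impI)
  interpret prob_space M by fact
  note [measurable] = V(2) E(2)
  fix \<epsilon> :: real assume \<epsilon>: "0 < \<epsilon>"
  obtain B where B: "\<forall>\<^sub>F n in sequentially. prob {x \<in> space M. B < \<bar>V n x\<bar>} \<le> \<epsilon> / 2"
    using V(1) \<epsilon> unfolding bounded_in_prob_def by (meson half_gt_zero)
  obtain G where G: "\<And>n. G n \<in> sets M" "(\<lambda>n. prob (G n)) \<longlonglongrightarrow> 1" "\<And>n x. x \<in> G n \<Longrightarrow> \<bar>E n x\<bar> \<le> C * (1 + \<bar>V n x\<bar>)"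
    using E(1) unfolding whp_def by blast
  have "\<forall>\<^sub>F n in sequentially. 1 - \<epsilon> / 2 < prob (G n)"
    by (rule order_tendstoD(1)[OF G(2)]) (use \<epsilon> in simp)
  with B have "\<forall>\<^sub>F n in sequentially. prob {x \<in> space M. C * (1 + B) < \<bar>E n x\<bar>} \<le> \<epsilon>"
  proof eventually_elim
    case (elim n)
    have "prob {x \<in> space M. C * (1 + B) < \<bar>E n x\<bar>} \<le> prob ((space M - G n) \<union> {x \<in> space M. B < \<bar>V n x\<bar>})"
    proof (intro finite_measure_mono subsetI)
      fix x assume x: "x \<in> {x \<in> space M. C * (1 + B) < \<bar>E n x\<bar>}"
      show "x \<in> (space M - G n) \<union> {x \<in> space M. B < \<bar>V n x\<bar>}"
      proof (rule ccontr)
        assume "x \<notin> (space M - G n) \<union> {x \<in> space M. B < \<bar>V n x\<bar>}"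
        then have "x \<in> G n" "\<bar>V n x\<bar> \<le> B" using x by auto
        then have "\<bar>E n x\<bar> \<le> C * (1 + \<bar>V n x\<bar>)" "C * (1 + \<bar>V n x\<bar>) \<le> C * (1 + B)"
          using G(3) C by (auto intro!: mult_left_mono)
        then show False using x by auto
      qed
    qed (use G(1) in auto)
    also have "\<dots> \<le> prob (space M - G n) + prob {x \<in> space M. B < \<bar>V n x\<bar>}"
      by (rule measure_Un_le) (use G(1) in auto)
    also have "prob (space M - G n) = 1 - prob (G n)" by (rule prob_compl[OF G(1)])
    finally show ?case using elim by linarith
  qed
  then show "\<exists>B. \<forall>\<^sub>F n in sequentially. prob {x \<in> space M. B < \<bar>E n x\<bar>} \<le> \<epsilon>" ..
qed

section \<open>Class counts of i.i.d. couplings\<close>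

lemma class_size_indicator:
  "real (class_size a j n l) = (\<Sum>i\<in>{1..n}. indicator {a l} (j i))"
  unfolding class_size_def level_set_def by (simp add: indicator_def sum.If_cases Int_def)

locale disorder = prob_space M for M :: "'w measure" +
  fixes J :: "nat \<Rightarrow> 'w \<Rightarrow> real" and a w :: "'k::finite \<Rightarrow> real"
  assumes inj_a: "inj a" and w_pos: "\<And>l. 0 < w l" and w_sum: "(\<Sum>l\<in>UNIV. w l) = 1"
    and J_indep: "indep_vars (\<lambda>_. borel) J {1..}"
    and J_values: "\<And>i x. 1 \<le> i \<Longrightarrow> x \<in> space M \<Longrightarrow> J i x \<in> range a"
    and J_law: "\<And>i l. 1 \<le> i \<Longrightarrow> measure M {x \<in> space M. J i x = a l} = w l"
begin

abbreviation "fr n x l \<equiv> freq a (\<lambda>i. J i x) n l"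

lemma J_measurable: "1 \<le> i \<Longrightarrow> J i \<in> borel_measurable M"
  using J_indep unfolding indep_vars_def by auto

lemma w_le_1: "w l \<le> 1"
  using member_le_sum[of l UNIV w] w_pos w_sum by (simp add: less_imp_le)

lemma class_size_measurable: "(\<lambda>x. real (class_size a (\<lambda>i. J i x) n l)) \<in> borel_measurable M"
  unfolding class_size_indicator
proof (rule borel_measurable_sum)
  fix i assume "i \<in> {1..n}"
  then have [measurable]: "J i \<in> borel_measurable M" by (intro J_measurable) auto
  show "(\<lambda>x. indicator {a l} (J i x) :: real) \<in> borel_measurable M" by measurable
qed

text \<open>Binomial coefficients are treated as functions on a discrete space, so the count itself
  has to be measurable; it is recovered from its real version by rounding.\<close>

lemma class_size_count_measurable:
  "(\<lambda>x. class_size a (\<lambda>i. J i x) n l) \<in> M \<rightarrow>\<^sub>M count_space UNIV"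
proof -
  have "(\<lambda>x. nat \<lfloor>real (class_size a (\<lambda>i. J i x) n l)\<rfloor>) \<in> M \<rightarrow>\<^sub>M count_space UNIV"
    using class_size_measurable[of n l] by measurable
  then show ?thesis by simp
qed

lemma freq_measurable: "(\<lambda>x. fr n x l) \<in> borel_measurable M"
  unfolding freq_def using class_size_measurable by measurable

lemma free_energy_n_measurable:
  assumes y: "y \<in> borel_measurable M"
  shows "(\<lambda>x. free_energy_n a \<beta> h (\<lambda>i. J i x) n (y x)) \<in> borel_measurable M"
proof -
  have [measurable]: "(\<lambda>x. y x $ l) \<in> borel_measurable M" for l
    by (rule measurable_compose[OF y]) (intro borel_measurable_continuous_onI continuous_intros)
  note [measurable] = freq_measurable class_size_measurable class_size_count_measurable
  have "(\<lambda>x. nat \<lfloor>(1 + y x $ l) / 2 * real (class_size a (\<lambda>i. J i x) n l)\<rfloor>) \<in> M \<rightarrow>\<^sub>M count_space UNIV" for l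
    by measurable
  then have [measurable]: "(\<lambda>x. real (class_size a (\<lambda>i. J i x) n l choose nat \<lfloor>(1 + y x $ l) / 2 * real (class_size a (\<lambda>i. J i x) n l)\<rfloor>)) \<in> borel_measurable M" for l
    by measurable
  show ?thesis unfolding free_energy_n_def by measurable
qed

lemma centered_indicator:
  fixes l :: 'k and n :: nat
  defines "\<zeta> \<equiv> \<lambda>i x. indicator {a l} (J i x) - w l"
  shows "indep_vars (\<lambda>_. borel) \<zeta> {1..n}" "\<And>i x. \<bar>\<zeta> i x\<bar> \<le> 1"
    "\<And>i. 1 \<le> i \<Longrightarrow> expectation (\<zeta> i) = 0"
proof -
  have "indep_vars (\<lambda>_. borel) J {1..n}" using J_indep by (rule indep_vars_subset) auto
  then show "indep_vars (\<lambda>_. borel) \<zeta> {1..n}"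
    unfolding \<zeta>_def by (rule indep_vars_compose2[where Y="\<lambda>i y. indicator {a l} y - w l"]) measurable
  show "\<bar>\<zeta> i x\<bar> \<le> 1" for i x
    unfolding \<zeta>_def using w_pos[of l] w_le_1[of l] by (auto simp: indicator_def)
  fix i :: nat assume i: "1 \<le> i"
  note [measurable] = J_measurable[OF i]
  have e: "expectation (\<lambda>x. indicator {a l} (J i x) :: real) = w l"
  proof -
    have "expectation (\<lambda>x. indicator {a l} (J i x) :: real) = expectation (indicator {x \<in> space M. J i x = a l})"
      by (intro Bochner_Integration.integral_cong) (auto simp: indicator_def)
    then show ?thesis using J_law[OF i] by simp
  qed
  have "integrable M (\<lambda>x. indicator {a l} (J i x) :: real)"
    by (rule integrable_bounded[of _ 1]) (auto simp: indicator_def)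
  then show "expectation (\<zeta> i) = 0" unfolding \<zeta>_def using e by (simp add: prob_space)
qed

lemma freq_deviation:
  assumes "0 < n"
  shows "real n * (fr n x l - w l) = (\<Sum>i\<in>{1..n}. indicator {a l} (J i x) - w l)"
  using assms by (simp add: freq_def class_size_indicator sum_subtractf right_diff_distrib)

text \<open>Scaled so as to be of order one; it dominates the remainders of both expansions.\<close>

definition dev :: "nat \<Rightarrow> 'w \<Rightarrow> real" where
  "dev n x = real n * (\<Sum>l\<in>UNIV. (fr n x l - w l)\<^sup>2)"

lemma dev_measurable[measurable]: "dev n \<in> borel_measurable M"
  unfolding dev_def[abs_def] using freq_measurable by measurable

lemma dev_nonneg: "0 \<le> dev n x"
  unfolding dev_def by (intro mult_nonneg_nonneg sum_nonneg) auto

text \<open>Markov's inequality: each centred count has second moment at most \<open>n\<close>, so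
  the mean of \<open>dev n\<close> is at most the number of classes.\<close>

lemma dev_tail:
  assumes B: "0 < B"
  shows "prob {x \<in> space M. B \<le> dev n x} \<le> real CARD('k) / B"
proof (cases "n = 0")
  case True
  then have "{x \<in> space M. B \<le> dev n x} = {}" using B by (auto simp: dev_def)
  then have "prob {x \<in> space M. B \<le> dev n x} = 0" by (metis measure_empty)
  then show ?thesis using B by simp
next
  case False
  then have n: "0 < n" by simp
  let ?Q = "\<lambda>l x. (\<Sum>i\<in>{1..n}. indicator {a l} (J i x) - w l)\<^sup>2"
  have eq: "dev n x = (\<Sum>l\<in>UNIV. ?Q l x / real n)" for x
    unfolding dev_def freq_deviation[OF n, symmetric] using n
    by (simp add: sum_distrib_left power2_eq_square mult_ac)
  have Q: "integrable M (?Q l)" "expectation (?Q l) \<le> real n" for l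
  proof -
    note z1 = centered_indicator(1)[where l=l and n=n] and z2 = centered_indicator(2)[where l=l]
      and z3 = centered_indicator(3)[where l=l]
    show "integrable M (?Q l)"
      by (rule second_moment_sum(1)[OF _ z1, of 1]) (use z2 z3 in auto)
    have "expectation (?Q l) = (\<Sum>i\<in>{1..n}. expectation (\<lambda>x. (indicator {a l} (J i x) - w l)\<^sup>2))"
      by (rule second_moment_sum(2)[OF _ z1, of 1]) (use z2 z3 in auto)
    also have "\<dots> \<le> (\<Sum>i\<in>{1..n}. 1)"
    proof (rule sum_mono)
      fix i assume "i \<in> {1..n}"
      then have [measurable]: "J i \<in> borel_measurable M" by (intro J_measurable) auto
      have le: "(indicator {a l} (J i x) - w l)\<^sup>2 \<le> 1" for x using z2[of i x] by (simp add: abs_square_le_1)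
      have "expectation (\<lambda>x. (indicator {a l} (J i x) - w l)\<^sup>2) \<le> expectation (\<lambda>x. 1)"
        by (intro integral_mono) (auto intro!: integrable_bounded[of _ 1] simp: le)
      then show "expectation (\<lambda>x. (indicator {a l} (J i x) - w l)\<^sup>2) \<le> 1" by (simp add: prob_space)
    qed
    finally show "expectation (?Q l) \<le> real n" by simp
  qed
  have int: "integrable M (dev n)" unfolding eq[abs_def] using Q(1) by auto
  have "expectation (dev n) = (\<Sum>l\<in>UNIV. expectation (?Q l) / real n)"
    unfolding eq[abs_def] using Q(1) by (subst Bochner_Integration.integral_sum) auto
  also have "\<dots> \<le> (\<Sum>l\<in>(UNIV::'k set). 1)"
    using Q(2) n by (intro sum_mono) (simp add: divide_le_eq)
  finally have "expectation (dev n) \<le> real CARD('k)" by simp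
  moreover have "prob {x \<in> space M. B \<le> dev n x} \<le> expectation (dev n) / B"
    by (rule integral_Markov_inequality_measure[OF int, of "{}"]) (use B dev_nonneg in auto)
  ultimately show ?thesis using B by (meson divide_right_mono less_imp_le order_trans)
qed

lemma dev_bounded_in_prob: "bounded_in_prob M dev"
  unfolding bounded_in_prob_def
proof (intro allI impI)
  fix \<epsilon> :: real assume \<epsilon>: "0 < \<epsilon>"
  define B where "B = real CARD('k) / \<epsilon>"
  have B: "0 < B" unfolding B_def using \<epsilon> by simp
  have "prob {x \<in> space M. B < \<bar>dev n x\<bar>} \<le> \<epsilon>" for n
  proof -
    have "prob {x \<in> space M. B < \<bar>dev n x\<bar>} \<le> prob {x \<in> space M. B \<le> dev n x}"
      using dev_nonneg by (intro finite_measure_mono) auto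
    also have "\<dots> \<le> real CARD('k) / B" by (rule dev_tail[OF B])
    also have "\<dots> = \<epsilon>" unfolding B_def using \<epsilon> by simp
    finally show ?thesis .
  qed
  then show "\<exists>B. \<forall>\<^sub>F n in sequentially. prob {x \<in> space M. B < \<bar>dev n x\<bar>} \<le> \<epsilon>"
    by (intro exI[of _ B] always_eventually allI)
qed

text \<open>Weak law of large numbers, from \<open>dev_tail\<close> at the level
  \<open>n * \<epsilon>\<^sup>2\<close>.\<close>

lemma freq_converges: "converges_in_prob M (\<lambda>n x. \<chi> l. fr n x l) (\<chi> l. w l)"
  unfolding converges_in_prob_def
proof (intro allI impI)
  fix \<epsilon> :: real assume \<epsilon>: "0 < \<epsilon>"
  let ?E = "\<lambda>n. {x \<in> space M. dev n x < real n * \<epsilon>\<^sup>2}"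
  show "whp M (\<lambda>n x. dist (\<chi> l. fr n x l) (\<chi> l. w l) < \<epsilon>)"
    unfolding whp_def
  proof (intro exI[of _ ?E] conjI allI ballI)
    show "?E n \<in> sets M" for n by measurable
    show "(\<lambda>n. prob (?E n)) \<longlonglongrightarrow> 1"
    proof (rule tendsto_sandwich)
      show "(\<lambda>n. 1 - real CARD('k) / (real n * \<epsilon>\<^sup>2)) \<longlonglongrightarrow> 1" using \<epsilon> by real_asymp
      show "\<forall>\<^sub>F n in sequentially. 1 - real CARD('k) / (real n * \<epsilon>\<^sup>2) \<le> prob (?E n)"
        using eventually_gt_at_top[of 0]
      proof eventually_elim
        case (elim n)
        have "?E n = space M - {x \<in> space M. real n * \<epsilon>\<^sup>2 \<le> dev n x}" by auto
        then have "prob (?E n) = 1 - prob {x \<in> space M. real n * \<epsilon>\<^sup>2 \<le> dev n x}"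
          by (simp only:) (rule prob_compl, measurable)
        then show ?case using dev_tail[of "real n * \<epsilon>\<^sup>2" n] elim \<epsilon> by simp
      qed
      show "\<forall>\<^sub>F n in sequentially. prob (?E n) \<le> 1" by simp
    qed simp
    fix n x assume x: "x \<in> ?E n"
    then have n: "0 < real n" by (cases "n = 0") (auto simp: dev_def)
    have "(\<Sum>l\<in>UNIV. (fr n x l - w l)\<^sup>2) < \<epsilon>\<^sup>2" using x n unfolding dev_def by auto
    then have "sqrt (\<Sum>l\<in>UNIV. (fr n x l - w l)\<^sup>2) < \<epsilon>" using \<epsilon> by (intro real_less_lsqrt) (auto intro!: sum_nonneg)
    then show "dist (\<chi> l. fr n x l) (\<chi> l. w l) < \<epsilon>"
      by (simp add: dist_vec_def L2_set_def dist_real_def)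
  qed
qed

text \<open>The statistic is a sum of i.i.d. terms \<open>f (J i x)\<close> with
  \<open>f (a l) = c l - cb\<close>, bounded because there are finitely many classes. Their variance
  is the weighted variance of \<open>c\<close>, positive as soon as \<open>c\<close> is not
  constant.\<close>

lemma linear_statistic_berry_esseen:
  fixes c :: "'k \<Rightarrow> real"
  assumes nonconst: "\<not> (\<forall>l. c l = (\<Sum>i\<in>UNIV. w i * c i))"
  defines "S \<equiv> \<lambda>n x. real n * (\<Sum>l\<in>UNIV. c l * (fr n x l - w l))"
  obtains \<sigma> C where "0 < \<sigma>" "\<And>n z. 1 \<le> n \<Longrightarrow>
    \<bar>prob {x \<in> space M. S n x \<le> z * (\<sigma> * sqrt (real n))} - cdf std_normal_distribution z\<bar> \<le> C / sqrt (real n)"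
proof -
  let ?\<Phi> = "cdf std_normal_distribution"
  interpret N: real_distribution std_normal_distribution by (rule real_dist_normal_dist)
  define cb where "cb = (\<Sum>i\<in>UNIV. w i * c i)"
  define v where "v = (\<Sum>l\<in>UNIV. w l * (c l - cb)\<^sup>2)"
  obtain l0 where l0: "c l0 \<noteq> cb" using nonconst unfolding cb_def by auto
  have v: "0 < v"
    unfolding v_def
  proof (rule sum_pos2[of _ l0])
    show "0 < w l0 * (c l0 - cb)\<^sup>2" using l0 w_pos by simp
    show "0 \<le> w l * (c l - cb)\<^sup>2" for l using w_pos[of l] by simp
  qed auto
  define \<sigma> where "\<sigma> = sqrt v"
  have \<sigma>: "0 < \<sigma>" "\<sigma>\<^sup>2 = v" using v by (auto simp: \<sigma>_def)
  define f where "f y = (\<Sum>l\<in>UNIV. c l * (indicator {a l} y - w l))" for y :: real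
  have fa: "f (a l) = c l - cb" for l
  proof -
    have "f (a l) = (\<Sum>i\<in>UNIV. (if i = l then c l else 0) - w i * c i)"
      unfolding f_def using inj_a by (intro sum.cong refl) (auto simp: indicator_def inj_eq algebra_simps)
    then show ?thesis by (simp add: sum_subtractf cb_def)
  qed
  have [measurable]: "f \<in> borel_measurable borel" unfolding f_def[abs_def] by measurable
  define B where "B = 1 + Max (range (\<lambda>l. \<bar>c l - cb\<bar>))"
  have Bl: "\<bar>c l - cb\<bar> \<le> B" for l
  proof -
    have "\<bar>c l - cb\<bar> \<le> Max (range (\<lambda>l. \<bar>c l - cb\<bar>))" by (rule Max_ge) auto
    then show ?thesis unfolding B_def by linarith
  qed
  have B: "0 < B"
  proof -
    have "\<bar>c l0 - cb\<bar> \<le> B" by (rule Bl)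
    then show ?thesis using l0 by linarith
  qed
  have f_bd: "\<bar>f (J i x)\<bar> \<le> B" if "1 \<le> i" "x \<in> space M" for i x
  proof -
    obtain l where "J i x = a l" using J_values[OF \<open>1 \<le> i\<close> \<open>x \<in> space M\<close>] by auto
    then show ?thesis using Bl[of l] fa[of l] by (simp only:)
  qed
  have f_mean: "expectation (\<lambda>x. f (J i x)) = 0" if i: "1 \<le> i" for i
  proof -
    note [measurable] = J_measurable[OF i]
    have "expectation (\<lambda>x. f (J i x)) = (\<Sum>l\<in>UNIV. c l * expectation (\<lambda>x. indicator {a l} (J i x) - w l))"
    proof -
      have "integrable M (\<lambda>x. indicator {a l} (J i x) - w l)" for l
        by (rule integrable_bounded[of _ 1]) (use centered_indicator(2) in auto)
      then show ?thesis unfolding f_def by (subst Bochner_Integration.integral_sum) auto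
    qed
    then show ?thesis using centered_indicator(3)[OF i] by simp
  qed
  have f_var: "expectation (\<lambda>x. (f (J i x))\<^sup>2) = v" if i: "1 \<le> i" for i
  proof -
    note [measurable] = J_measurable[OF i]
    have int: "integrable M (\<lambda>x. indicator {a l} (J i x) :: real)" for l
      by (rule integrable_bounded[of _ 1]) (auto simp: indicator_def)
    have "expectation (\<lambda>x. (f (J i x))\<^sup>2) = expectation (\<lambda>x. \<Sum>l\<in>UNIV. (c l - cb)\<^sup>2 * indicator {a l} (J i x))"
    proof (intro Bochner_Integration.integral_cong refl)
      fix x assume "x \<in> space M"
      then obtain l where l: "J i x = a l" using J_values[OF i] by auto
      have "(\<Sum>k\<in>UNIV. (c k - cb)\<^sup>2 * indicator {a k} (a l)) = (\<Sum>k\<in>UNIV. if k = l then (c l - cb)\<^sup>2 else 0)"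
        using inj_a by (intro sum.cong refl) (auto simp: indicator_def inj_eq)
      then show "(f (J i x))\<^sup>2 = (\<Sum>l\<in>UNIV. (c l - cb)\<^sup>2 * indicator {a l} (J i x))"
        unfolding l fa by simp
    qed
    also have "\<dots> = (\<Sum>l\<in>UNIV. (c l - cb)\<^sup>2 * expectation (\<lambda>x. indicator {a l} (J i x)))"
      by (subst Bochner_Integration.integral_sum) (auto intro!: integrable_mult_right int)
    also have "\<dots> = v" unfolding v_def
    proof (intro sum.cong refl)
      fix l
      have "expectation (\<lambda>x. indicator {a l} (J i x) - w l) = 0" by (rule centered_indicator(3)[OF i])
      then have "expectation (\<lambda>x. indicator {a l} (J i x) :: real) = w l" using int[of l] by (simp add: prob_space)
      then show "(c l - cb)\<^sup>2 * expectation (\<lambda>x. indicator {a l} (J i x)) = w l * (c l - cb)\<^sup>2" by simp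
    qed
    finally show ?thesis .
  qed
  have S_eq: "S n x = (\<Sum>i\<in>{1..n}. f (J i x))" if "0 < n" for n x
  proof -
    have "S n x = (\<Sum>l\<in>UNIV. c l * (\<Sum>i\<in>{1..n}. indicator {a l} (J i x) - w l))"
      unfolding S_def freq_deviation[OF that, symmetric] by (simp add: sum_distrib_left mult_ac)
    also have "\<dots> = (\<Sum>i\<in>{1..n}. f (J i x))"
      unfolding f_def sum_distrib_left by (rule sum.swap)
    finally show ?thesis .
  qed
  have "\<bar>prob {x \<in> space M. S n x \<le> z * (\<sigma> * sqrt (real n))} - ?\<Phi> z\<bar> \<le> (52 * (B / \<sigma>)) / sqrt (real n)"
    if n1: "1 \<le> n" for n z
  proof -
    have n: "0 < n" "0 < real n" using n1 by auto
    define s where "s = \<sigma> * sqrt (real n)"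
    have s: "0 < s" "s\<^sup>2 = v * real n" using \<sigma> n by (auto simp: s_def power_mult_distrib)
    define \<delta> where "\<delta> = B / s"
    have \<delta>: "0 < \<delta>" using B s by (simp add: \<delta>_def)
    have \<delta>eq: "52 * (B / \<sigma>) / sqrt (real n) = 52 * \<delta>" unfolding \<delta>_def s_def by simp
    show ?thesis
    proof (cases "\<delta> \<le> 1")
      \<comment> \<open>The claimed bound then exceeds 52 and is trivial for a difference of two
        probabilities.\<close>
      case False
      have "0 \<le> prob {x \<in> space M. S n x \<le> z * (\<sigma> * sqrt (real n))}" "prob {x \<in> space M. S n x \<le> z * (\<sigma> * sqrt (real n))} \<le> 1" by auto
      then show ?thesis unfolding \<delta>eq using False N.cdf_bounded_prob[of z] N.cdf_nonneg[of z] by linarith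
    next
      case True
      let ?\<xi> = "\<lambda>i x. f (J i x) / s"
      have ind: "indep_vars (\<lambda>_. borel) ?\<xi> {1..n}"
        by (rule indep_vars_compose2[where Y="\<lambda>i y. f y / s", OF indep_vars_subset[OF J_indep]]) auto
      have "\<bar>prob {x \<in> space M. (\<Sum>i\<in>{1..n}. ?\<xi> i x) \<le> z} - ?\<Phi> z\<bar> \<le> 52 * \<delta>"
      proof (rule berry_esseen_bounded[OF _ ind])
        show "\<bar>?\<xi> i x\<bar> \<le> \<delta>" if "i \<in> {1..n}" "x \<in> space M" for i x
          using f_bd[of i x] that s unfolding \<delta>_def by (auto intro!: divide_right_mono)
        show "expectation (?\<xi> i) = 0" if "i \<in> {1..n}" for i using f_mean[of i] that by simp
        have "(\<Sum>i\<in>{1..n}. expectation (\<lambda>x. (?\<xi> i x)\<^sup>2)) = (\<Sum>i\<in>{1..n}. v / s\<^sup>2)"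
          using f_var by (intro sum.cong refl) (simp add: power_divide)
        also have "\<dots> = 1" using s v n by simp
        finally show "(\<Sum>i\<in>{1..n}. expectation (\<lambda>x. (?\<xi> i x)\<^sup>2)) = 1" .
      qed (use \<delta> True in auto)
      moreover have "{x \<in> space M. (\<Sum>i\<in>{1..n}. ?\<xi> i x) \<le> z} = {x \<in> space M. S n x \<le> z * (\<sigma> * sqrt (real n))}"
        unfolding sum_divide_distrib[symmetric] S_eq[OF n(1), symmetric] s_def[symmetric] using s by (simp add: divide_le_eq)
      ultimately show ?thesis unfolding \<delta>eq by simp
    qed
  qed
  then show thesis using that[of \<sigma> "52 * (B / \<sigma>)"] \<sigma> by blast
qed

end

section \<open>Asymptotics of the energy barrier\<close>

text \<open>The expansion in distribution with an O(1) error is expressed as an equality of laws for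
  every \<open>n\<close> with a tight remainder \<open>R\<close>. Hypothesis \<open>ii\<close> keeps
  the eigenvalues away from zero uniformly in \<open>n\<close>: eigenvalues that are merely non-zero
  could vanish in the limit and leave a degenerate critical point. With \<open>m = t\<close> the
  linear statistic would vanish identically.\<close>

theorem theorem1p3:
  fixes M :: "'w measure"
    and J :: "nat \<Rightarrow> 'w \<Rightarrow> real"
    and a w :: "'k::finite \<Rightarrow> real"
    and \<beta> h :: real
    and mn tn :: "nat \<Rightarrow> 'w \<Rightarrow> real^'k"
    and gate :: "nat \<Rightarrow> 'w \<Rightarrow> (real^'k) set"
    and m t :: "real^'k"
  assumes "prob_space M"
    and a: "inj a" "\<And>l. 0 \<le> a l"
    and w: "\<And>l. 0 < w l" "\<And>l. w l < 1" "(\<Sum>l\<in>UNIV. w l) = 1"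
    and J_indep: "prob_space.indep_vars M (\<lambda>_. borel) J {1..}"
    and J_values: "\<And>i x. 1 \<le> i \<Longrightarrow> x \<in> space M \<Longrightarrow> J i x \<in> range a"
    and J_law: "\<And>i l. 1 \<le> i \<Longrightarrow> measure M {x \<in> space M. J i x = a l} = w l"
    and rich: "\<exists>U. distributed M lborel U std_normal_density \<and> indep_of_seq M U J"
    and \<beta>: "beta_crit a w < \<beta>"
    and h: "0 \<le> h" "h < h_crit a w \<beta>"
    and meas: "\<And>n. mn n \<in> borel_measurable M" "\<And>n. tn n \<in> borel_measurable M"
    and mn: "whp M (\<lambda>n x. mn n x \<in> local_minima a \<beta> h (\<lambda>i. J i x) n)"
    and i: "whp M (\<lambda>n x. lower_minima a \<beta> h (\<lambda>i. J i x) n (mn n x) \<noteq> {})"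
    and gate: "whp M (\<lambda>n x. is_gate a \<beta> h (\<lambda>i. J i x) n {mn n x}
                 (lower_minima a \<beta> h (\<lambda>i. J i x) n (mn n x)) (gate n x))"
    and ii: "\<exists>\<epsilon>>0. whp M (\<lambda>n x. \<forall>y \<in> insert (mn n x) (gate n x). \<forall>c.
               is_eigenvalue (hessian_n a \<beta> (\<lambda>i. J i x) n y) c \<longrightarrow> \<epsilon> \<le> \<bar>c\<bar>)"
    and iii: "whp M (\<lambda>n x. gate n x = {tn n x})"
    and iv: "whp M (\<lambda>n x. inj (\<lambda>l. rate a \<beta> h (\<lambda>i. J i x) n (tn n x) l /
               (real (class_size a (\<lambda>i. J i x) n l) * (1 - (tn n x $ l)\<^sup>2))))"
    and m_crit: "m \<in> critical_points a w \<beta> h"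
    and m_closest: "whp M (\<lambda>n x. \<forall>y \<in> critical_points a w \<beta> h. dist (mn n x) m \<le> dist (mn n x) y)"
    and m_lim: "converges_in_prob M mn m"
    and t_crit: "t \<in> critical_points a w \<beta> h"
    and t_closest: "whp M (\<lambda>n x. \<forall>y \<in> critical_points a w \<beta> h. dist (tn n x) t \<le> dist (tn n x) y)"
    and t_lim: "converges_in_prob M tn t"
    and m_neq_t: "m \<noteq> t"
  shows "\<exists>\<sigma> Z R.
      0 < \<sigma> \<and> distributed M lborel Z (normal_density 0 \<sigma>) \<and> indep_of_seq M Z J \<and>
      (\<forall>n. R n \<in> borel_measurable M) \<and> tight (\<lambda>n. distr M borel (R n)) \<and>
      (\<forall>n. distr M borel
             (\<lambda>x. real n * (free_energy_n a \<beta> h (\<lambda>i. J i x) n (tn n x)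
                           - free_energy_n a \<beta> h (\<lambda>i. J i x) n (mn n x)))
         = distr M borel
             (\<lambda>x. real n * (free_energy a w \<beta> h t - free_energy a w \<beta> h m)
                 + Z x * sqrt (real n) + R n x))"
proof -
  interpret prob_space M by fact
  have \<beta>0: "0 < \<beta>"
  proof -
    have "0 \<le> beta_crit a w"
      unfolding beta_crit_def using w(1) by (intro divide_nonneg_nonneg sum_nonneg mult_nonneg_nonneg) (auto intro: less_imp_le)
    then show ?thesis using \<beta> by linarith
  qed
  interpret disorder M J a w
    by unfold_locales (use a w J_indep J_values J_law in auto)
  note M = prob_space_axioms
  \<comment> \<open>A single class would have weight one.\<close>
  obtain l1 l2 :: 'k where two: "l1 \<noteq> l2"
  proof (rule ccontr)
    assume "\<not> thesis"
    then have eq: "l = undefined" for l :: 'k using that by blast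
    then have U: "(UNIV :: 'k set) = {undefined}" by auto
    have "sum w {undefined} = 1" using w(3) by (simp only: U)
    then have "w undefined = 1" by simp
    then show False using w(2)[of undefined] by simp
  qed
  define A where "A = Max (range (\<lambda>l. \<bar>a l\<bar>))"
  have A: "\<bar>a l\<bar> \<le> A" for l unfolding A_def by (rule Max_ge) auto
  define W where "W = (\<chi> l. w l)"
  define V where "V n x = (\<chi> l. fr n x l)" for n x
  have V_conv: "converges_in_prob M V W"
    unfolding V_def[abs_def] W_def by (rule freq_converges)
  define Km where "Km = (\<Sum>i\<in>UNIV. a i * w i * m $ i)"
  define Kt where "Kt = (\<Sum>i\<in>UNIV. a i * w i * t $ i)"
  note mt = critical_point_tanh(1)[OF m_crit \<beta>0 w(1), folded Km_def]
  note tt = critical_point_tanh(1)[OF t_crit \<beta>0 w(1), folded Kt_def]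
  have fix_m: "T_map a w \<beta> h Km = Km" unfolding T_map_def mt[symmetric] by (simp add: Km_def)
  have fix_t: "T_map a w \<beta> h Kt = Kt" unfolding T_map_def tt[symmetric] by (simp add: Kt_def)
  \<comment> \<open>A critical point is determined by its magnetisation.\<close>
  have K_neq: "Km \<noteq> Kt"
  proof
    assume "Km = Kt"
    then have "m = t" unfolding vec_eq_iff using mt tt by metis
    then show False using m_neq_t by simp
  qed
  have pair_conv: "converges_in_prob M (\<lambda>n x. (V n x, Y n x)) (W, y)" if "converges_in_prob M Y y" for Y and y :: "real^'k"
    by (rule converges_in_prob_Pair[OF M V_conv that])
  \<comment> \<open>Slope one at the limit would produce eigenvalues of modulus below \<epsilon>
    with probability tending to one.\<close>
  have nondegenerate: "(\<Sum>l\<in>UNIV. (a l)\<^sup>2 * w l * (\<beta> * (1 - (y $ l)\<^sup>2))) \<noteq> 1"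
    if y: "y \<in> critical_points a w \<beta> h" "converges_in_prob M Y y" and \<epsilon>: "0 < \<epsilon>"
      and eig: "whp M (\<lambda>n x. \<forall>c. is_eigenvalue (hessian_n a \<beta> (\<lambda>i. J i x) n (Y n x)) c \<longrightarrow> \<epsilon> \<le> \<bar>c\<bar>)" for Y y \<epsilon>
  proof
    assume 1: "(\<Sum>l\<in>UNIV. (a l)\<^sup>2 * w l * (\<beta> * (1 - (y $ l)\<^sup>2))) = 1"
    have y1: "\<bar>y $ l\<bar> < 1" for l using y(1) by (auto simp: critical_points_def)
    have "whp M (\<lambda>n x. \<exists>c. \<bar>c\<bar> < \<epsilon> \<and> is_eigenvalue (hess a \<beta> (fst (V n x, Y n x)) (snd (V n x, Y n x))) c)"
      by (rule converges_in_prob_eventually[OF pair_conv[OF y(2)] small_eigenvalue[OF \<beta>0 w(1) y1 1 \<epsilon>, folded W_def]])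
    from whp_conj[OF M this eig] have "whp M (\<lambda>n x. False)"
      by (rule whp_mono) (auto simp: hessian_n_eq_hess V_def)
    then show False using whp_False[OF M] by blast
  qed
  obtain \<epsilon> where \<epsilon>: "0 < \<epsilon>" and eig: "whp M (\<lambda>n x. \<forall>y \<in> insert (mn n x) (gate n x). \<forall>c.
               is_eigenvalue (hessian_n a \<beta> (\<lambda>i. J i x) n y) c \<longrightarrow> \<epsilon> \<le> \<bar>c\<bar>)" using ii by blast
  have nd_m: "(\<Sum>l\<in>UNIV. (a l)\<^sup>2 * w l * (\<beta> * (1 - (m $ l)\<^sup>2))) \<noteq> 1"
    by (rule nondegenerate[OF m_crit m_lim \<epsilon>]) (rule whp_mono[OF eig], auto)
  have nd_t: "(\<Sum>l\<in>UNIV. (a l)\<^sup>2 * w l * (\<beta> * (1 - (t $ l)\<^sup>2))) \<noteq> 1"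
    by (rule nondegenerate[OF t_crit t_lim \<epsilon>]) (rule whp_mono[OF whp_conj[OF M eig iii]], auto)

  have fv: "whp M (\<lambda>n x. finite_volume a \<beta> (\<lambda>i. J i x) n)"
  proof -
    have "\<forall>\<^sub>F v in nhds W. \<forall>l\<in>UNIV. 0 < v $ l"
    proof (intro eventually_ball_finite ballI)
      fix l show "\<forall>\<^sub>F v in nhds W. 0 < v $ l"
        by (rule order_tendstoD(1)[OF tendsto_vec_nth[OF filterlim_ident]]) (simp add: W_def w)
    qed simp
    from converges_in_prob_eventually[OF V_conv this]
    show ?thesis
    proof (rule whp_mono)
      fix n x assume *: "\<forall>l\<in>UNIV. 0 < V n x $ l"
      then have "0 < fr n x l" for l by (simp add: V_def)
      then have p: "n \<noteq> 0 \<and> class_size a (\<lambda>i. J i x) n l \<noteq> 0" for l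
        by (metis freq_def divide_eq_0_iff less_irrefl of_nat_0)
      then show "finite_volume a \<beta> (\<lambda>i. J i x) n" using \<beta>0 by unfold_locales auto
    qed
  qed
  \<comment> \<open>Distinct limits keep the two points apart, as the gate argument
    requires.\<close>
  have neq: "whp M (\<lambda>n x. tn n x \<noteq> mn n x)"
  proof -
    have d: "0 < dist m t / 2" using m_neq_t by simp
    show ?thesis
    proof (rule whp_mono[OF whp_conj[OF M m_lim[unfolded converges_in_prob_def, rule_format, OF d]
            t_lim[unfolded converges_in_prob_def, rule_format, OF d]]])
      fix n x assume "dist (mn n x) m < dist m t / 2 \<and> dist (tn n x) t < dist m t / 2"
      then show "tn n x \<noteq> mn n x"
        using dist_triangle[of m t "mn n x"] dist_commute[of m "mn n x"] by auto
    qed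
  qed
  have alm_m: "whp M (\<lambda>n x. almost_local_min a \<beta> h (\<lambda>i. J i x) n (4 * A\<^sup>2) (mn n x))"
    by (rule whp_mono[OF mn]) (rule local_minima_almost_local_min, auto)
  have gate_t: "whp M (\<lambda>n x. is_gate a \<beta> h (\<lambda>i. J i x) n {mn n x}
                 (lower_minima a \<beta> h (\<lambda>i. J i x) n (mn n x)) {tn n x})"
    by (rule whp_mono[OF whp_conj[OF M gate iii]]) auto
  have alm_t: "whp M (\<lambda>n x. almost_local_min a \<beta> h (\<lambda>i. J i x) n (4 * A\<^sup>2) (tn n x))"
  proof (rule whp_mono[OF whp_conj[OF M gate_t whp_conj[OF M neq fv]]], elim conjE)
    fix n x
    assume g: "is_gate a \<beta> h (\<lambda>i. J i x) n {mn n x} (lower_minima a \<beta> h (\<lambda>i. J i x) n (mn n x)) {tn n x}"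
      and ne: "tn n x \<noteq> mn n x" and f: "finite_volume a \<beta> (\<lambda>i. J i x) n"
    interpret F: finite_volume a \<beta> h "\<lambda>i. J i x" n by (rule f)
    show "almost_local_min a \<beta> h (\<lambda>i. J i x) n (4 * A\<^sup>2) (tn n x)"
      by (rule F.gate_point_almost_local_min[OF A g _ ne]) (auto simp: lower_minima_def)
  qed

  \<comment> \<open>Common to both points, so it drops out of the difference although it grows
    logarithmically in \<open>n\<close>.\<close>
  define entropy_term where "entropy_term n x = (\<Sum>l\<in>UNIV. ln (real (class_size a (\<lambda>i. J i x) n l))) / (2 * \<beta>)" for n x
  have expansion: "\<exists>C\<ge>0. whp M (\<lambda>n x. 0 < n \<and>
    \<bar>real n * free_energy_n a \<beta> h (\<lambda>i. J i x) n (Y n x) - real n * free_energy a w \<beta> h y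
      - real n * (\<Sum>l\<in>UNIV. linear_response a w \<beta> h y l * (fr n x l - w l)) - entropy_term n x\<bar>
    \<le> C * (1 + dev n x))"
    if y: "y \<in> critical_points a w \<beta> h" "converges_in_prob M Y y"
      and nd: "(\<Sum>l\<in>UNIV. (a l)\<^sup>2 * w l * (\<beta> * (1 - (y $ l)\<^sup>2))) \<noteq> 1"
      and alm: "whp M (\<lambda>n x. almost_local_min a \<beta> h (\<lambda>i. J i x) n (4 * A\<^sup>2) (Y n x))" for Y y
  proof -
    have A2: "0 \<le> 4 * A\<^sup>2" by simp
    from local_expansion[OF \<beta>0 w(1,3) y(1) A2 nd, folded W_def]
    obtain C where C: "0 \<le> C" and ev: "\<forall>\<^sub>F p in nhds (W, y). \<forall>j n x. 0 < n \<and> p = (\<chi> l. freq a j n l, x) \<and> almost_local_min a \<beta> h j n (4 * A\<^sup>2) x \<longrightarrow>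
      \<bar>real n * free_energy_n a \<beta> h j n x - real n * free_energy a w \<beta> h y
        - real n * (\<Sum>l\<in>UNIV. linear_response a w \<beta> h y l * (freq a j n l - w l))
        - (\<Sum>l\<in>UNIV. ln (real (class_size a j n l))) / (2 * \<beta>)\<bar>
      \<le> C * (1 + real n * (\<Sum>l\<in>UNIV. (freq a j n l - w l)\<^sup>2))" by blast
    note w1 = converges_in_prob_eventually[OF pair_conv[OF y(2)] ev]
    have w2: "whp M (\<lambda>n x. 0 < n)"
      by (rule whp_eventually_sequentially[OF M eventually_gt_at_top])
    show ?thesis
    proof (intro exI[of _ C] conjI C, rule whp_mono[OF whp_conj[OF M w1 whp_conj[OF M alm w2]]], elim conjE, intro conjI)
      fix n x
      assume *: "\<forall>j na xa. 0 < na \<and> (V n x, Y n x) = (\<chi> l. freq a j na l, xa) \<and> almost_local_min a \<beta> h j na (4 * A\<^sup>2) xa \<longrightarrow>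
        \<bar>real na * free_energy_n a \<beta> h j na xa - real na * free_energy a w \<beta> h y
          - real na * (\<Sum>l\<in>UNIV. linear_response a w \<beta> h y l * (freq a j na l - w l))
          - (\<Sum>l\<in>UNIV. ln (real (class_size a j na l))) / (2 * \<beta>)\<bar>
        \<le> C * (1 + real na * (\<Sum>l\<in>UNIV. (freq a j na l - w l)\<^sup>2))"
        and alm: "almost_local_min a \<beta> h (\<lambda>i. J i x) n (4 * A\<^sup>2) (Y n x)" and n: "0 < n"
      show "0 < n" by fact
      show "\<bar>real n * free_energy_n a \<beta> h (\<lambda>i. J i x) n (Y n x) - real n * free_energy a w \<beta> h y
        - real n * (\<Sum>l\<in>UNIV. linear_response a w \<beta> h y l * (fr n x l - w l)) - entropy_term n x\<bar>
        \<le> C * (1 + dev n x)"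
        unfolding entropy_term_def dev_def
        by (rule *[rule_format, of n "\<lambda>i. J i x" "Y n x"]) (use alm n in \<open>simp add: V_def\<close>)
    qed
  qed
  obtain Cm where Cm: "0 \<le> Cm" and ex_m: "whp M (\<lambda>n x. 0 < n \<and>
    \<bar>real n * free_energy_n a \<beta> h (\<lambda>i. J i x) n (mn n x) - real n * free_energy a w \<beta> h m
      - real n * (\<Sum>l\<in>UNIV. linear_response a w \<beta> h m l * (fr n x l - w l)) - entropy_term n x\<bar>
    \<le> Cm * (1 + dev n x))"
    using expansion[OF m_crit m_lim nd_m alm_m] by blast
  obtain Ct where Ct: "0 \<le> Ct" and ex_t: "whp M (\<lambda>n x. 0 < n \<and>
    \<bar>real n * free_energy_n a \<beta> h (\<lambda>i. J i x) n (tn n x) - real n * free_energy a w \<beta> h t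
      - real n * (\<Sum>l\<in>UNIV. linear_response a w \<beta> h t l * (fr n x l - w l)) - entropy_term n x\<bar>
    \<le> Ct * (1 + dev n x))"
    using expansion[OF t_crit t_lim nd_t alm_t] by blast

  text \<open>For \<open>h = 0\<close> the gate point cannot approach the mirror image \<open>-m\<close> of the metastable minimum:
    a path between the two crosses zero magnetisation, where the energy is macroscopically larger.\<close>
  have not_mirror: "\<not> (h = 0 \<and> Km = - Kt)"
  proof (rule notI, elim conjE)
    assume h0: "h = 0" and mirror: "Km = - Kt"
    have Kt0: "Kt \<noteq> 0" using mirror K_neq by auto
    \<comment> \<open>The gap between the energy at zero magnetisation and the energy of
      \<open>t\<close>. The frequency fluctuations and the terms that vanish with \<open>n\<close>
      are each allowed a third of it; the last third yields the contradiction.\<close>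
    define \<gamma> where "\<gamma> = - (ln 2 / \<beta>) - free_energy a w \<beta> h t"
    have \<gamma>: "0 < \<gamma>"
      using critical_free_energy_less[OF \<beta>0 w(1,3) t_crit[unfolded h0]] Kt0 unfolding \<gamma>_def h0 Kt_def by simp
    have mag_conv: "\<forall>\<^sub>F p in nhds (W, y). 0 < r * (\<Sum>i\<in>UNIV. a i * fst p $ i * snd p $ i)"
      if "0 < r * (\<Sum>i\<in>UNIV. a i * w i * y $ i)" for r y
    proof (rule order_tendstoD(1))
      show "((\<lambda>p. r * (\<Sum>i\<in>UNIV. a i * fst p $ i * snd p $ i)) \<longlongrightarrow> r * (\<Sum>i\<in>UNIV. a i * W $ i * y $ i)) (nhds (W, y))"
        by (intro tendsto_intros nhds_prod_components)
    qed (use that in \<open>simp add: W_def\<close>)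
    have "0 < Kt * Kt" using not_real_square_gt_zero[of Kt] Kt0 by blast
    then have pm: "0 < (- Kt) * Km" and pt: "0 < Kt * Kt" unfolding mirror by simp_all
    \<comment> \<open>The limits have opposite magnetisations; \<open>wm\<close> and
      \<open>wt\<close> transfer this to the finite system, expressed relative to the sign of
      \<open>Kt\<close>.\<close>
    have wm: "whp M (\<lambda>n x. 0 < (- Kt) * (\<Sum>i\<in>UNIV. a i * fr n x i * mn n x $ i))"
      using converges_in_prob_eventually[OF pair_conv[OF m_lim] mag_conv[OF pm[unfolded Km_def]]] by (simp add: V_def)
    have wt: "whp M (\<lambda>n x. 0 < Kt * (\<Sum>i\<in>UNIV. a i * fr n x i * tn n x $ i))"
      using converges_in_prob_eventually[OF pair_conv[OF t_lim] mag_conv[of Kt t, folded Kt_def, OF pt]] by (simp add: V_def)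
    have wv: "whp M (\<lambda>n x. (\<Sum>l\<in>UNIV. linear_response a w \<beta> h t l * (V n x $ l - w l)) + Ct * (\<Sum>l\<in>UNIV. (V n x $ l - w l)\<^sup>2) < \<gamma> / 3)"
    proof (rule converges_in_prob_eventually[OF V_conv])
      have "((\<lambda>v. (\<Sum>l\<in>UNIV. linear_response a w \<beta> h t l * (v $ l - w l)) + Ct * (\<Sum>l\<in>UNIV. (v $ l - w l)\<^sup>2))
         \<longlongrightarrow> (\<Sum>l\<in>UNIV. linear_response a w \<beta> h t l * (W $ l - w l)) + Ct * (\<Sum>l\<in>UNIV. (W $ l - w l)\<^sup>2)) (nhds W)"
        by (intro tendsto_intros filterlim_ident)
      then show "\<forall>\<^sub>F v in nhds W. (\<Sum>l\<in>UNIV. linear_response a w \<beta> h t l * (v $ l - w l)) + Ct * (\<Sum>l\<in>UNIV. (v $ l - w l)\<^sup>2) < \<gamma> / 3"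
        by (rule order_tendstoD(2)) (use \<gamma> in \<open>simp add: W_def\<close>)
    qed
    define k where "k = real CARD('k)"
    have "((\<lambda>n. k * ln (real n) / (2 * \<beta>) / real n + Ct / real n + 2 * A\<^sup>2 / (real n)\<^sup>2) \<longlongrightarrow> 0) sequentially"
      using \<beta>0 by real_asymp
    then have "\<forall>\<^sub>F n in sequentially. k * ln (real n) / (2 * \<beta>) / real n + Ct / real n + 2 * A\<^sup>2 / (real n)\<^sup>2 < \<gamma> / 3"
      by (rule order_tendstoD(2)) (use \<gamma> in simp)
    note wn = whp_eventually_sequentially[OF M this]
    have "whp M (\<lambda>n x. False)"
    proof (rule whp_mono[OF whp_conj[OF M wm whp_conj[OF M wt whp_conj[OF M wv whp_conj[OF M wn whp_conj[OF M ex_t whp_conj[OF M gate_t fv]]]]]]], elim conjE)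
      fix n x
      assume sm: "0 < (- Kt) * (\<Sum>i\<in>UNIV. a i * fr n x i * mn n x $ i)"
        and st: "0 < Kt * (\<Sum>i\<in>UNIV. a i * fr n x i * tn n x $ i)"
        and sv: "(\<Sum>l\<in>UNIV. linear_response a w \<beta> h t l * (V n x $ l - w l)) + Ct * (\<Sum>l\<in>UNIV. (V n x $ l - w l)\<^sup>2) < \<gamma> / 3"
        and sn: "k * ln (real n) / (2 * \<beta>) / real n + Ct / real n + 2 * A\<^sup>2 / (real n)\<^sup>2 < \<gamma> / 3"
        and n: "0 < n"
        and se: "\<bar>real n * free_energy_n a \<beta> h (\<lambda>i. J i x) n (tn n x) - real n * free_energy a w \<beta> h t
          - real n * (\<Sum>l\<in>UNIV. linear_response a w \<beta> h t l * (fr n x l - w l)) - entropy_term n x\<bar> \<le> Ct * (1 + dev n x)"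
        and g: "is_gate a \<beta> h (\<lambda>i. J i x) n {mn n x} (lower_minima a \<beta> h (\<lambda>i. J i x) n (mn n x)) {tn n x}"
        and f: "finite_volume a \<beta> (\<lambda>i. J i x) n"
      interpret F: finite_volume a \<beta> h "\<lambda>i. J i x" n by (rule f)
      have nr: "0 < real n" using n by simp
      have opp: "F.mag (mn n x) \<ge> 0 \<and> F.mag (tn n x) \<le> 0 \<or> F.mag (mn n x) \<le> 0 \<and> F.mag (tn n x) \<ge> 0"
        using sm st unfolding F.mag_def[symmetric] by (auto simp: zero_less_mult_iff mult_less_0_iff)
      have lower: "- 2 * A\<^sup>2 / real n - real n / \<beta> * ln 2 \<le> real n * free_energy_n a \<beta> h (\<lambda>i. J i x) n (tn n x)"
        by (rule F.gate_barrier[OF A inj_a h0 g opp])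
      have ent: "entropy_term n x \<le> k * ln (real n) / (2 * \<beta>)"
      proof -
        have "(\<Sum>l\<in>UNIV. ln (real (class_size a (\<lambda>i. J i x) n l))) \<le> (\<Sum>l\<in>(UNIV::'k set). ln (real n))"
        proof (rule sum_mono)
          fix l
          have "class_size a (\<lambda>i. J i x) n l \<le> (\<Sum>l\<in>UNIV. class_size a (\<lambda>i. J i x) n l)"
            by (rule member_le_sum) auto
          also have "\<dots> \<le> n" by (rule F.sum_size_le[OF inj_a])
          finally show "ln (real (class_size a (\<lambda>i. J i x) n l)) \<le> ln (real n)"
            using F.size_pos[of l] by (subst ln_le_cancel_iff) (auto intro: less_le_trans)
        qed
        then show ?thesis unfolding entropy_term_def k_def using \<beta>0 by (simp add: divide_right_mono)
      qed
      have "real n * free_energy_n a \<beta> h (\<lambda>i. J i x) n (tn n x)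
          \<le> real n * free_energy a w \<beta> h t + real n * (\<Sum>l\<in>UNIV. linear_response a w \<beta> h t l * (fr n x l - w l))
            + k * ln (real n) / (2 * \<beta>) + Ct * (1 + dev n x)" using se ent by linarith
      also have "\<dots> = real n * (free_energy a w \<beta> h t + ((\<Sum>l\<in>UNIV. linear_response a w \<beta> h t l * (V n x $ l - w l))
            + Ct * (\<Sum>l\<in>UNIV. (V n x $ l - w l)\<^sup>2)) + (k * ln (real n) / (2 * \<beta>) / real n + Ct / real n))"
        unfolding dev_def V_def using nr by (simp add: algebra_simps)
      also have "\<dots> \<le> real n * (free_energy a w \<beta> h t + \<gamma> / 3 + (\<gamma> / 3 - 2 * A\<^sup>2 / (real n)\<^sup>2))"
        using sv sn nr by (intro mult_left_mono) auto
      also have "\<dots> = real n * (free_energy a w \<beta> h t + 2 * \<gamma> / 3) - 2 * A\<^sup>2 / real n"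
        using nr by (simp add: algebra_simps power2_eq_square)
      finally have "- (real n / \<beta> * ln 2) \<le> real n * (free_energy a w \<beta> h t + 2 * \<gamma> / 3)"
        using lower by simp
      then have "real n * (- (ln 2 / \<beta>)) \<le> real n * (free_energy a w \<beta> h t + 2 * \<gamma> / 3)" by simp
      then have "- (ln 2 / \<beta>) \<le> free_energy a w \<beta> h t + 2 * \<gamma> / 3" using nr by (simp only: mult_le_cancel_left_pos)
      moreover have "free_energy a w \<beta> h t = - (ln 2 / \<beta>) - \<gamma>" unfolding \<gamma>_def by simp
      ultimately show False using \<gamma> by linarith
    qed
    then show False using whp_False[OF M] by blast
  qed

  define c where "c l = linear_response a w \<beta> h t l - linear_response a w \<beta> h m l" for l
  \<comment> \<open>Positivity of the variance: the contributions of \<open>ln 2\<close> cancel, so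
    \<open>c l\<close> equals \<open>- profile \<beta> h Km Kt (a l) / \<beta>\<close>.\<close>
  have nonconst: "\<not> (\<forall>l. c l = (\<Sum>i\<in>UNIV. w i * c i))"
  proof
    assume const: "\<forall>l. c l = (\<Sum>i\<in>UNIV. w i * c i)"
    have "profile \<beta> h Km Kt (a l) = - \<beta> * (\<Sum>i\<in>UNIV. w i * c i)" for l
    proof -
      have "c l = - profile \<beta> h Km Kt (a l) / \<beta>"
        unfolding c_def linear_response_eq[OF t_crit \<beta>0 w(1)] linear_response_eq[OF m_crit \<beta>0 w(1)]
          Km_def[symmetric] Kt_def[symmetric] profile_def
        by (simp add: ln_mult diff_divide_distrib add_divide_distrib)
      then show ?thesis using const[rule_format, of l] \<beta>0 by (simp add: field_simps)
    qed
    then show False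
      using profile_nonconstant[OF \<beta>0 h(1) a w(1) two fix_m fix_t K_neq not_mirror] by blast
  qed
  define S where "S n x = real n * (\<Sum>l\<in>UNIV. c l * (fr n x l - w l))" for n x
  obtain \<sigma> C where \<sigma>: "0 < \<sigma>" and be: "\<And>n z. 1 \<le> n \<Longrightarrow>
    \<bar>prob {x \<in> space M. S n x \<le> z * (\<sigma> * sqrt (real n))} - cdf std_normal_distribution z\<bar> \<le> C / sqrt (real n)"
    using linear_statistic_berry_esseen[OF nonconst] unfolding S_def by blast
  define X where "X n x = real n * (free_energy_n a \<beta> h (\<lambda>i. J i x) n (tn n x) - free_energy_n a \<beta> h (\<lambda>i. J i x) n (mn n x))" for n x
  define c0 where "c0 n = real n * (free_energy a w \<beta> h t - free_energy a w \<beta> h m)" for n :: nat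
  \<comment> \<open>Whatever the linear statistic misses, so that
    \<open>c0 n + S n x + E n x\<close> is the energy difference itself.\<close>
  define E where "E n x = X n x - c0 n - S n x" for n x
  have mS: "S n \<in> borel_measurable M" for n
    unfolding S_def[abs_def] using freq_measurable by measurable
  have mX: "X n \<in> borel_measurable M" for n
    unfolding X_def[abs_def] using free_energy_n_measurable[OF meas(1)] free_energy_n_measurable[OF meas(2)] by measurable
  have mE: "E n \<in> borel_measurable M" for n
    unfolding E_def[abs_def] using mS mX by measurable
  \<comment> \<open>The rank encoding in the coupling needs finitely many values.\<close>
  have finS: "finite (S n ` space M)" for n
  proof (rule finite_subset)
    show "S n ` space M \<subseteq> (\<lambda>f. real n * (\<Sum>l\<in>UNIV. c l * (real (f l) / real n - w l))) ` (UNIV \<rightarrow>\<^sub>E {..n})"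
    proof
      fix s assume "s \<in> S n ` space M"
      then obtain x where s: "s = S n x" by auto
      have "class_size a (\<lambda>i. J i x) n l \<le> card {1..n}" for l
        unfolding class_size_def level_set_def by (rule card_mono) auto
      then have "(\<lambda>l. class_size a (\<lambda>i. J i x) n l) \<in> UNIV \<rightarrow>\<^sub>E {..n}" by auto
      then show "s \<in> (\<lambda>f. real n * (\<Sum>l\<in>UNIV. c l * (real (f l) / real n - w l))) ` (UNIV \<rightarrow>\<^sub>E {..n})"
        unfolding s S_def freq_def by (rule rev_image_eqI) simp
    qed
    show "finite ((\<lambda>f. real n * (\<Sum>l\<in>UNIV. c l * (real (f l) / real n - w l))) ` (UNIV \<rightarrow>\<^sub>E {..n}))"
      by (intro finite_imageI finite_PiE) auto
  qed
  have bE: "bounded_in_prob M E"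
  proof (rule bounded_in_prob_whp_le[OF M dev_bounded_in_prob dev_measurable _ mE])
    show "0 \<le> Cm + Ct" using Cm Ct by simp
    show "whp M (\<lambda>n x. \<bar>E n x\<bar> \<le> (Cm + Ct) * (1 + \<bar>dev n x\<bar>))"
    proof (rule whp_mono[OF whp_conj[OF M ex_m ex_t]], elim conjE)
      fix n x
      assume m: "\<bar>real n * free_energy_n a \<beta> h (\<lambda>i. J i x) n (mn n x) - real n * free_energy a w \<beta> h m
          - real n * (\<Sum>l\<in>UNIV. linear_response a w \<beta> h m l * (fr n x l - w l)) - entropy_term n x\<bar> \<le> Cm * (1 + dev n x)"
        and t: "\<bar>real n * free_energy_n a \<beta> h (\<lambda>i. J i x) n (tn n x) - real n * free_energy a w \<beta> h t
          - real n * (\<Sum>l\<in>UNIV. linear_response a w \<beta> h t l * (fr n x l - w l)) - entropy_term n x\<bar> \<le> Ct * (1 + dev n x)"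
      have "S n x = real n * (\<Sum>l\<in>UNIV. linear_response a w \<beta> h t l * (fr n x l - w l))
          - real n * (\<Sum>l\<in>UNIV. linear_response a w \<beta> h m l * (fr n x l - w l))"
        unfolding S_def c_def by (simp add: left_diff_distrib sum_subtractf right_diff_distrib)
      then have "\<bar>E n x\<bar> \<le> Cm * (1 + dev n x) + Ct * (1 + dev n x)"
        using m t unfolding E_def X_def c0_def right_diff_distrib by linarith
      then show "\<bar>E n x\<bar> \<le> (Cm + Ct) * (1 + \<bar>dev n x\<bar>)" using dev_nonneg[of n x] by (simp add: distrib_right)
    qed
  qed
  obtain U where U: "distributed M lborel U std_normal_density" and UJ: "indep_of_seq M U J" using rich by blast
  obtain R where R: "\<And>n. R n \<in> borel_measurable M" "tight (\<lambda>n. distr M borel (R n))"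
    "\<And>n. distr M borel (\<lambda>x. c0 n + S n x + E n x) = distr M borel (\<lambda>x. c0 n + \<sigma> * U x * sqrt (real n) + R n x)"
    by (rule gaussian_coupling[OF U mS mE finS \<sigma> be bE, of c0], assumption) (rule that)
  define Z where "Z x = \<sigma> * U x" for x
  have Z: "distributed M lborel Z (normal_density 0 \<sigma>)"
    using U \<sigma> by (subst normal_standard_normal_convert) (auto simp: Z_def)
  \<comment> \<open>Scaling does not enlarge the generated sigma-algebra, so independence passes
    from \<open>U\<close> to \<open>Z\<close>.\<close>
  have ZJ: "indep_of_seq M Z J"
  proof -
    have "sets (vimage_algebra (space M) Z borel) \<subseteq> sets (vimage_algebra (space M) U borel)"
    proof
      fix B assume "B \<in> sets (vimage_algebra (space M) Z borel)"
      then obtain D where D: "D \<in> sets borel" "B = Z -` D \<inter> space M" by (auto simp: sets_vimage_algebra2)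
      have "(\<lambda>u. \<sigma> * u) -` D \<inter> space borel \<in> sets borel"
        using D(1) by (intro measurable_sets[of "\<lambda>u. \<sigma> * u" borel borel]) auto
      moreover have "B = U -` ((\<lambda>u. \<sigma> * u) -` D \<inter> space borel) \<inter> space M" unfolding D(2) Z_def by auto
      ultimately show "B \<in> sets (vimage_algebra (space M) U borel)" by (auto simp: sets_vimage_algebra2)
    qed
    then show ?thesis
      using UJ unfolding indep_of_seq_def indep_set_def
      by (elim indep_sets_mono_sets) (auto split: bool.splits)
  qed
  have law: "distr M borel (X n) = distr M borel (\<lambda>x. c0 n + Z x * sqrt (real n) + R n x)" for n
    using R(3)[of n] unfolding E_def Z_def by simp
  show ?thesis
    by (intro exI[of _ \<sigma>] exI[of _ Z] exI[of _ R] conjI allI \<sigma> Z ZJ R(1,2)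
        law[unfolded X_def[abs_def] c0_def])
qed

end
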